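(* Let $\lambda\in\mathbb{R}$, let $s\ge 0$ and $2<p\le\infty$, and set $\gamma_p=\frac32+\frac1p$ (so $\gamma_p\in[\frac32,2)$, with $\frac1\infty=0$). Let $\xi\in\hat b^{s,p}$ be a real-valued potential on $\mathbb{T}=(-\pi,\pi)$. Then the Cauchy problem $$i\partial_t u+\partial_{xx}u+\xi u=\lambda|u|^2u\quad (x\in\mathbb{T},\ t>0),\qquad u(0,x)=u_0(x),$$ is locally well-posed in $H^{s+\gamma_p-}(\mathbb{T})$; that is, for every sufficiently small $\epsilon>0$ it is locally well-posed in $X_0=H^{s+\gamma_p-\epsilon}(\mathbb{T})$.
   Context: $\mathbb{T}=(-\pi,\pi)$ is the one-dimensional torus (periodic boundary conditions); $u(t,x)$ is complex-valued. Write $f(x)=\sum_{k\in\mathbb{Z}}\hat f_k e^{ikx}$. For $s\ge 0$, $1\le p\le\infty$, $\hat b^{s,p}=\{f:\ |\hat f_0|+\||k|^s\hat f_k\|_{l^p_k}<\infty\}$. $H^\sigma(\mathbb{T})$ is the Sobolev space with norm $\sqrt{2\pi}\big(\sum_k(1+|k|^2)^{\sigma}|\hat f_k|^2\big)^{1/2}$. The notation $a-$ means $a-\epsilon$ with $\epsilon>0$ arbitrarily small. Solutions (strong solutions) are understood through Duhamel's formula $u(t)=e^{it\partial_x^2}u_0+i\int_0^te^{i(t-\rho)\partial_x^2}\big(\xi u(\rho)-\lambda|u(\rho)|^2u(\rho)\big)\,d\rho$, the product $\xi u$ having Fourier coefficients $\sum_{k_1+k_2=k}\hat\xi_{k_1}\hat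 u_{k_2}$. Local well-posedness in a space $X_0$ means: (1) there is unconditional uniqueness in $C_t(I;X_0)$, i.e. two solutions in $C_t(I;X_0)$ with the same initial data coincide; (2) for every $u_0\in X_0$ there exists a strong solution $u[u_0]\in C_t(I;X_0)$ defined on a maximal time interval $I=[0,T_{\max})$, $T_{\max}\in(0,+\infty]$; (3) the solution map $u_0\mapsto u[u_0]$ is continuous from $X_0$ to $X_0$ (i.e. $u_0\mapsto u[u_0](t)$ is continuous in $X_0$ at each time $t$ of existence). *)

theory Defs
  imports "HOL-Analysis.Analysis"
begin

text \<open>
  A periodic distribution \<open>f = \<Sum>\<^sub>k f k e\<^sup>i\<^sup>k\<^sup>x\<close> on the torus \<open>(-\<pi>,\<pi>)\<close> is identified with its sequence
  of Fourier coefficients. A genuine distribution is needed for the potential, which in the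
  roughest case only has bounded coefficients (e.g. a Dirac mass).
\<close>

type_synonym torus_dist = "int \<Rightarrow> complex"

definition lp_seq :: "ereal \<Rightarrow> (int \<Rightarrow> complex) \<Rightarrow> bool" where
  "lp_seq p a \<longleftrightarrow>
     (if p = \<infinity> then bounded (range a)
      else (\<lambda>k. norm (a k) powr real_of_ereal p) summable_on UNIV)"

text \<open>
  The summand \<open>|f 0|\<close> of the norm is always finite and does not affect membership; neither does
  the convention \<open>0 powr 0 = 0\<close>, which only concerns the frequency \<open>k = 0\<close>.
\<close>

definition bhat :: "real \<Rightarrow> ereal \<Rightarrow> torus_dist set" where
  "bhat s p = {f. lp_seq p (\<lambda>k. of_real (\<bar>real_of_int k\<bar> powr s) * f k)}"

text \<open>The complex conjugate of a distribution has Fourier coefficients \<open>cnj (f (-k))\<close>.\<close>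

definition conj_dist :: "torus_dist \<Rightarrow> torus_dist" where
  "conj_dist f = (\<lambda>k. cnj (f (- k)))"

definition real_valued :: "torus_dist \<Rightarrow> bool" where
  "real_valued f \<longleftrightarrow> conj_dist f = f"

definition sobolev :: "real \<Rightarrow> torus_dist set" where
  "sobolev \<sigma> =
     {f. (\<lambda>k. (1 + (real_of_int k)\<^sup>2) powr \<sigma> * (norm (f k))\<^sup>2) summable_on UNIV}"

definition sobolev_norm :: "real \<Rightarrow> torus_dist \<Rightarrow> real" where
  "sobolev_norm \<sigma> f =
     sqrt (2 * pi) * sqrt (\<Sum>\<^sub>\<infinity>k. (1 + (real_of_int k)\<^sup>2) powr \<sigma> * (norm (f k))\<^sup>2)"

definition sobolev_dist :: "real \<Rightarrow> torus_dist \<Rightarrow> torus_dist \<Rightarrow> real" where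
  "sobolev_dist \<sigma> f g = sobolev_norm \<sigma> (\<lambda>k. f k - g k)"

definition dist_mult :: "torus_dist \<Rightarrow> torus_dist \<Rightarrow> torus_dist" where
  "dist_mult f g = (\<lambda>k. \<Sum>\<^sub>\<infinity>l. f (k - l) * g l)"

text \<open>
  For \<open>f\<close> in \<open>sobolev \<sigma>\<close> with \<open>\<sigma> > 1/2\<close> the Fourier series converges absolutely, so that
  \<open>torus_fun f\<close> is the continuous periodic function represented by \<open>f\<close>. In the same range, the
  sum in \<open>dist_mult \<xi> f\<close> converges absolutely for every \<open>\<xi>\<close> with bounded coefficients.
\<close>

definition torus_fun :: "torus_dist \<Rightarrow> real \<Rightarrow> complex" where
  "torus_fun f x = (\<Sum>\<^sub>\<infinity>k. f k * cis (real_of_int k * x))"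

definition fourier_coeff :: "(real \<Rightarrow> complex) \<Rightarrow> torus_dist" where
  "fourier_coeff F = (\<lambda>k. integral {-pi..pi} (\<lambda>x. F x * cis (- real_of_int k * x)) / (2 * pi))"

definition cubic :: "torus_dist \<Rightarrow> torus_dist" where
  "cubic f = fourier_coeff (\<lambda>x. (norm (torus_fun f x))\<^sup>2 *\<^sub>R torus_fun f x)"

text \<open>The group \<open>exp (i t \<partial>\<^sub>x\<^sup>2)\<close>.\<close>

definition schroedinger :: "real \<Rightarrow> torus_dist \<Rightarrow> torus_dist" where
  "schroedinger t f = (\<lambda>k. cis (- t * (real_of_int k)\<^sup>2) * f k)"

definition time_interval :: "real set \<Rightarrow> bool" where
  "time_interval I \<longleftrightarrow> is_interval I \<and> 0 \<in> I \<and> I \<subseteq> {0..}"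

definition continuous_into_sobolev :: "real \<Rightarrow> real set \<Rightarrow> (real \<Rightarrow> torus_dist) \<Rightarrow> bool" where
  "continuous_into_sobolev \<sigma> I u \<longleftrightarrow>
     (\<forall>t\<in>I. u t \<in> sobolev \<sigma>) \<and>
     (\<forall>t\<in>I. ((\<lambda>r. sobolev_dist \<sigma> (u r) (u t)) \<longlongrightarrow> 0) (at t within I))"

definition nls_forcing :: "torus_dist \<Rightarrow> real \<Rightarrow> torus_dist \<Rightarrow> torus_dist" where
  "nls_forcing \<xi> lam f = (\<lambda>k. dist_mult \<xi> f k - of_real lam * cubic f k)"

text \<open>
  The time integral in Duhamel's formula is taken coefficient by coefficient, i.e. in the sense of
  distributions, since \<open>\<xi> u\<close> is in general less regular than \<open>u\<close>.
\<close>

definition strong_solution ::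
    "torus_dist \<Rightarrow> real \<Rightarrow> real \<Rightarrow> real set \<Rightarrow> torus_dist \<Rightarrow> (real \<Rightarrow> torus_dist) \<Rightarrow> bool" where
  "strong_solution \<xi> lam \<sigma> I u0 u \<longleftrightarrow>
     time_interval I \<and> continuous_into_sobolev \<sigma> I u \<and>
     (\<forall>t\<in>I. \<forall>k.
        (\<lambda>r. schroedinger (t - r) (nls_forcing \<xi> lam (u r)) k) integrable_on {0..t} \<and>
        u t k = schroedinger t u0 k
          + \<i> * integral {0..t} (\<lambda>r. schroedinger (t - r) (nls_forcing \<xi> lam (u r)) k))"

definition maximal_strong_solution ::
    "torus_dist \<Rightarrow> real \<Rightarrow> real \<Rightarrow> real set \<Rightarrow> torus_dist \<Rightarrow> (real \<Rightarrow> torus_dist) \<Rightarrow> bool" where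
  "maximal_strong_solution \<xi> lam \<sigma> I u0 u \<longleftrightarrow>
     strong_solution \<xi> lam \<sigma> I u0 u \<and>
     (\<forall>J v. strong_solution \<xi> lam \<sigma> J u0 v \<and> I \<subseteq> J \<and> (\<forall>t\<in>I. v t = u t) \<longrightarrow> J = I)"

definition unconditional_uniqueness :: "torus_dist \<Rightarrow> real \<Rightarrow> real \<Rightarrow> bool" where
  "unconditional_uniqueness \<xi> lam \<sigma> \<longleftrightarrow>
     (\<forall>I u0 u v. strong_solution \<xi> lam \<sigma> I u0 u \<and> strong_solution \<xi> lam \<sigma> I u0 v
        \<longrightarrow> (\<forall>t\<in>I. u t = v t))"

text \<open>
  Below, \<open>S u0\<close> is the maximal solution with datum \<open>u0\<close> and \<open>T u0\<close> its lifespan. Continuity of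
  \<open>u0 \<mapsto> S u0 t\<close> at a datum whose solution exists at time \<open>t\<close> includes that the map is defined
  near that datum, i.e. that nearby solutions also exist at time \<open>t\<close>.
\<close>

definition solution_map ::
    "torus_dist \<Rightarrow> real \<Rightarrow> real \<Rightarrow> (torus_dist \<Rightarrow> ereal) \<Rightarrow> (torus_dist \<Rightarrow> real \<Rightarrow> torus_dist) \<Rightarrow> bool" where
  "solution_map \<xi> lam \<sigma> T S \<longleftrightarrow>
     (\<forall>u0\<in>sobolev \<sigma>. 0 < T u0 \<and>
        maximal_strong_solution \<xi> lam \<sigma> {t. 0 \<le> t \<and> ereal t < T u0} u0 (S u0))"

definition continuous_solution_map ::
    "real \<Rightarrow> (torus_dist \<Rightarrow> ereal) \<Rightarrow> (torus_dist \<Rightarrow> real \<Rightarrow> torus_dist) \<Rightarrow> bool" where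
  "continuous_solution_map \<sigma> T S \<longleftrightarrow>
     (\<forall>u0\<in>sobolev \<sigma>. \<forall>t\<ge>0. ereal t < T u0 \<longrightarrow>
        (\<forall>e>0. \<exists>d>0. \<forall>v0\<in>sobolev \<sigma>. sobolev_dist \<sigma> v0 u0 < d \<longrightarrow>
           ereal t < T v0 \<and> sobolev_dist \<sigma> (S v0 t) (S u0 t) < e))"

definition locally_well_posed :: "torus_dist \<Rightarrow> real \<Rightarrow> real \<Rightarrow> bool" where
  "locally_well_posed \<xi> lam \<sigma> \<longleftrightarrow>
     unconditional_uniqueness \<xi> lam \<sigma> \<and>
     (\<exists>T S. solution_map \<xi> lam \<sigma> T S \<and> continuous_solution_map \<sigma> T S)"

definition gamma_exp :: "ereal \<Rightarrow> real" where
  "gamma_exp p = 3 / 2 + real_of_ereal (1 / p)"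

end

theory Submission
  imports Defs
begin

text \<open>
  The Schroedinger operator \<open>- \<partial>\<^sub>x\<^sup>2 - \<xi>\<close> is conjugated to \<open>- \<partial>\<^sub>x\<^sup>2\<close> plus a bounded operator. Solving
  the homological equation row by row, one finds a kernel \<open>Y\<close> supported on frequency pairs with
  \<open>k\<^sup>2 \<noteq> l\<^sup>2\<close>, at least one of them of size \<open>\<ge> N\<close>, such that \<open>(1 + Y) (- \<partial>\<^sub>x\<^sup>2 - \<xi>) = - \<partial>\<^sub>x\<^sup>2 (1 + Y) + R\<close>
  with a resonant, hence bounded, \<open>R\<close>. The divisor \<open>k\<^sup>2 - l\<^sup>2\<close> gains the two derivatives by which \<open>\<xi>\<close>
  falls short of \<open>H\<^sup>\<sigma>\<close> (this is where the bound on \<open>\<sigma>\<close> enters), and it makes \<open>Y\<close> small for large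
  \<open>N\<close>, so that \<open>1 + Y\<close> is invertible on \<open>H\<^sup>\<sigma>\<close>. In the variable \<open>z t = exp (- \<i> t \<partial>\<^sub>x\<^sup>2) (1 + Y) (u t)\<close>
  Duhamel's formula becomes an ordinary differential equation in \<open>l\<^sup>2\<close> with a locally Lipschitz right-hand
  side. The two formulations are equivalent since \<open>1 + Y\<close> is also injective on the much larger weighted
  \<open>l\<^sup>1\<close> space that contains the residual of Duhamel's formula.
\<close>

section \<open>Ordinary differential equations in Banach spaces\<close>

text \<open>Picard iteration on Duhamel's formula does not close in \<open>H^\<sigma>\<close>:
  \<open>\<xi> u\<close> is too rough and the free group does not smooth. Only time oscillation,
  that is, division by k^2 - l^2, can pay for the loss. Carrying out the division on the operator
  rather than on a solution leaves nothing dispersive to estimate, and since every continuous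
  \<open>H^\<sigma>\<close>-valued solution is transformed, uniqueness is unconditional. The
  threshold expresses the transfer from low to high frequencies: it needs <k>^(\<sigma>-2) \<xi>_k
  in l^2. Passing from l^p to l^2 by Hoelder costs any power of <k> above 1/2 - 1/p = 2 - gamma_p,
  whence \<sigma> < s + gamma_p. A first order kernel, \<xi> over the divisor, would leave an error
  Y \<xi> for which the estimates gain only half a power of <k>; this is why the rows solve the
  homological equation exactly. Three conditions determine N: contraction of the row equation, norm
  at most 1/2 of Y on \<open>H^\<sigma>\<close>, and norm at most 1/2 of Y on a weighted l^1 space.
  The last is separate from the second because the residual contains k^2 u_k and \<xi> u, which lie
  outside \<open>H^\<sigma>\<close> in general.\<close>

lemma gronwall:
  fixes \<phi> :: "real \<Rightarrow> real"
  assumes cont: "continuous_on {0..T} \<phi>" and K: "0 \<le> K"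
    and le: "\<And>t. 0 \<le> t \<Longrightarrow> t \<le> T \<Longrightarrow> \<phi> t \<le> a + K * integral {0..t} \<phi>"
    and t: "0 \<le> t" "t \<le> T"
  shows "\<phi> t \<le> a * exp (K * t)"
proof -
  \<comment> \<open>The integrating factor turns the integral inequality into monotonicity of
    \<open>\<psi>\<close>.\<close>
  define \<psi> where "\<psi> s = exp (- K * s) * (a + K * integral {0..s} \<phi>)" for s
  have c: "continuous_on {0..t} \<phi>"
    by (rule continuous_on_subset[OF cont]) (use t in auto)
  have "\<psi> t \<le> \<psi> 0"
  proof (rule DERIV_nonpos_imp_decreasing_open[OF t(1)])
    fix x assume x: "0 < x" "x < t"
    have "((\<lambda>s. integral {0..s} \<phi>) has_real_derivative \<phi> x) (at x within {0..t})"
      by (rule integral_has_real_derivative[OF c]) (use x in auto)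
    then have I: "((\<lambda>s. integral {0..s} \<phi>) has_real_derivative \<phi> x) (at x)"
      using x by (metis at_within_Icc_at)
    have "(\<psi> has_real_derivative
        exp (- K * x) * (- K) * (a + K * integral {0..x} \<phi>) + exp (- K * x) * (K * \<phi> x)) (at x)"
      unfolding \<psi>_def by (auto intro!: derivative_eq_intros I)
    moreover have "exp (- K * x) * (- K) * (a + K * integral {0..x} \<phi>) + exp (- K * x) * (K * \<phi> x)
      = exp (- K * x) * K * (\<phi> x - (a + K * integral {0..x} \<phi>))"
      by (simp add: algebra_simps)
    moreover have "\<dots> \<le> 0"
      using le[of x] x t K by (intro mult_nonneg_nonpos mult_nonneg_nonneg) auto
    ultimately show "\<exists>y. (\<psi> has_real_derivative y) (at x) \<and> y \<le> 0" by auto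
  next
    have "continuous_on {0..t} (\<lambda>s. integral {0..s} \<phi>)"
      by (rule indefinite_integral_continuous_1[OF integrable_continuous_real[OF c]])
    then show "continuous_on {0..t} \<psi>" unfolding \<psi>_def by (intro continuous_intros)
  qed
  then have "exp (- K * t) * (a + K * integral {0..t} \<phi>) \<le> a"
    by (simp add: \<psi>_def)
  then have "exp (K * t) * (exp (- K * t) * (a + K * integral {0..t} \<phi>)) \<le> exp (K * t) * a"
    by (intro mult_left_mono) auto
  then have "a + K * integral {0..t} \<phi> \<le> a * exp (K * t)"
    by (simp add: mult.assoc[symmetric] exp_add[symmetric] mult.commute)
  then show ?thesis using le[OF t] by linarith
qed

text \<open>Radial retraction onto the closed ball of radius M; the maximum in the denominator
  replaces a case distinction at the boundary. Composition with it makes a locally Lipschitz field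
  globally Lipschitz.\<close>

definition ball_retract :: "real \<Rightarrow> 'a::real_normed_vector \<Rightarrow> 'a" where
  "ball_retract M x = (M / max M (norm x)) *\<^sub>R x"

lemma ball_retract_id: "0 < M \<Longrightarrow> norm x \<le> M \<Longrightarrow> ball_retract M x = x"
  by (simp add: ball_retract_def max_def)

lemma norm_ball_retract_le: "0 < M \<Longrightarrow> norm (ball_retract M x) \<le> M"
  by (cases "norm x \<le> M") (auto simp: ball_retract_def max_def)

lemma ball_retract_0: "ball_retract M 0 = 0"
  by (simp add: ball_retract_def)

text \<open>The constant 2 is valid in every normed space: one unit comes from moving the point at a
  fixed scaling factor, one from changing the factor.\<close>

lemma ball_retract_lipschitz:
  assumes M: "0 < M"
  shows "norm (ball_retract M x - ball_retract M y) \<le> 2 * norm (x - y)"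
proof -
  define a b where "a = max M (norm x)" and "b = max M (norm y)"
  have ab: "M \<le> a" "M \<le> b" "0 < a" "0 < b" "norm y \<le> b" using M by (auto simp: a_def b_def)
  have "ball_retract M x - ball_retract M y = (M / a) *\<^sub>R (x - y) + (M / a - M / b) *\<^sub>R y"
    by (simp add: ball_retract_def a_def b_def algebra_simps)
  then have "norm (ball_retract M x - ball_retract M y)
      \<le> norm ((M / a) *\<^sub>R (x - y)) + norm ((M / a - M / b) *\<^sub>R y)"
    by (metis norm_triangle_ineq)
  moreover have "norm ((M / a) *\<^sub>R (x - y)) \<le> norm (x - y)"
    using mult_right_mono[of "M / a" 1 "norm (x - y)"] M ab by simp
  moreover have "norm ((M / a - M / b) *\<^sub>R y) \<le> norm (x - y)"
  proof -
    have "M / a - M / b = (M / a) * ((b - a) / b)" using ab by (simp add: field_simps)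
    then have "norm ((M / a - M / b) *\<^sub>R y) = (M / a) * (\<bar>b - a\<bar> * (norm y / b))"
      using ab M by (simp add: abs_mult)
    also have "\<dots> \<le> 1 * (\<bar>b - a\<bar> * 1)"
      using ab M by (intro mult_mono mult_nonneg_nonneg) auto
    also have "\<bar>b - a\<bar> \<le> \<bar>norm x - norm y\<bar>" by (auto simp: a_def b_def)
    also have "\<dots> \<le> norm (x - y)" by (rule norm_triangle_ineq3)
    finally show ?thesis by simp
  qed
  ultimately show ?thesis by linarith
qed

definition ode_solution :: "(real \<Rightarrow> 'a \<Rightarrow> 'a) \<Rightarrow> real set \<Rightarrow> 'a \<Rightarrow> (real \<Rightarrow> 'a::banach) \<Rightarrow> bool" where
  "ode_solution F I z0 z \<longleftrightarrow> continuous_on I z \<and>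
     (\<forall>t\<in>I. z t = z0 + integral {0..t} (\<lambda>r. F r (z r)))"

lemma time_interval_subset: "time_interval I \<Longrightarrow> t \<in> I \<Longrightarrow> {0..t} \<subseteq> I"
  unfolding time_interval_def is_interval_1 by auto

lemma time_interval_Icc: "0 \<le> t \<Longrightarrow> time_interval {0..t}"
  by (simp add: time_interval_def)

lemma ode_solution_subset:
  "ode_solution F I z0 z \<Longrightarrow> J \<subseteq> I \<Longrightarrow> ode_solution F J z0 z"
  unfolding ode_solution_def by (auto intro: continuous_on_subset)

text \<open>Continuity in time is required for each fixed state only, since the phases of the
  application are strongly but not norm continuous. The zero solution provides a bounded starting
  point for the contraction on the half-line.\<close>

locale banach_ode =
  fixes F :: "real \<Rightarrow> 'a::banach \<Rightarrow> 'a"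
  assumes cont: "\<And>x. continuous_on {0..} (\<lambda>t. F t x)"
    and lip: "\<And>M. \<exists>K>0. \<forall>t\<ge>0. \<forall>x y. norm x \<le> M \<longrightarrow> norm y \<le> M \<longrightarrow>
      norm (F t x - F t y) \<le> K * norm (x - y)"
    and zero: "\<And>t. F t 0 = 0"
begin

lemma continuous_on_comp:
  assumes z: "continuous_on I z" and I: "I \<subseteq> {0..}"
  shows "continuous_on I (\<lambda>r. F r (z r))"
  unfolding continuous_on_def
proof
  fix t assume t: "t \<in> I"
  obtain K where K: "K > 0" and L: "\<And>r x y. r \<ge> 0 \<Longrightarrow> norm x \<le> norm (z t) + 1 \<Longrightarrow>
      norm y \<le> norm (z t) + 1 \<Longrightarrow> norm (F r x - F r y) \<le> K * norm (x - y)"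
    using lip[of "norm (z t) + 1"] by blast
  have zt: "(z \<longlongrightarrow> z t) (at t within I)" using z t by (auto simp: continuous_on_def)
  have 1: "((\<lambda>r. F r (z t)) \<longlongrightarrow> F t (z t)) (at t within I)"
    using continuous_on_subset[OF cont I] t by (auto simp: continuous_on_def)
  have "((\<lambda>r. F r (z r) - F r (z t)) \<longlongrightarrow> 0) (at t within I)"
  proof (rule Lim_null_comparison)
    have "\<forall>\<^sub>F r in at t within I. dist (z r) (z t) < 1"
      using zt by (rule tendstoD) simp
    moreover have "\<forall>\<^sub>F r in at t within I. r \<in> I"
      by (simp add: eventually_at_filter)
    ultimately show "\<forall>\<^sub>F r in at t within I. norm (F r (z r) - F r (z t)) \<le> K * norm (z r - z t)"
    proof eventually_elim
      case (elim r)
      then have "norm (z r) \<le> norm (z t) + 1"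
        using norm_triangle_ineq2[of "z r" "z t"] by (simp add: dist_norm)
      then show ?case using elim I by (intro L) auto
    qed
    have "((\<lambda>r. K * norm (z r - z t)) \<longlongrightarrow> K * norm (z t - z t)) (at t within I)"
      by (intro tendsto_intros zt)
    then show "((\<lambda>r. K * norm (z r - z t)) \<longlongrightarrow> 0) (at t within I)" by simp
  qed
  from tendsto_add[OF this 1] show "((\<lambda>r. F r (z r)) \<longlongrightarrow> F t (z t)) (at t within I)" by simp
qed

text \<open>The Lipschitz bound is asked for along the two trajectories only, so that the estimate
  serves both the locally Lipschitz field on bounded trajectories and its global
  truncations.\<close>

lemma stability:
  assumes z: "ode_solution F {0..T} z0 z" and w: "ode_solution F {0..T} w0 w"
    and K: "0 \<le> K"
    and L: "\<And>r. 0 \<le> r \<Longrightarrow> r \<le> T \<Longrightarrow> norm (F r (z r) - F r (w r)) \<le> K * norm (z r - w r)"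
    and t: "0 \<le> t" "t \<le> T"
  shows "norm (z t - w t) \<le> norm (z0 - w0) * exp (K * t)"
proof (rule gronwall[OF _ K _ t])
  have cz: "continuous_on {0..T} z" and cw: "continuous_on {0..T} w"
    using z w by (auto simp: ode_solution_def)
  show "continuous_on {0..T} (\<lambda>t. norm (z t - w t))" using cz cw by (intro continuous_intros)
  fix s assume s: "0 \<le> s" "s \<le> T"
  have sub: "{0..s} \<subseteq> {0..T}" "{0..s} \<subseteq> {0..}" using s by auto
  have iz: "(\<lambda>r. F r (z r)) integrable_on {0..s}" and iw: "(\<lambda>r. F r (w r)) integrable_on {0..s}"
    by (intro integrable_continuous_real continuous_on_comp sub
      continuous_on_subset[OF cz sub(1)] continuous_on_subset[OF cw sub(1)])+
  have "z s - w s = (z0 - w0) + integral {0..s} (\<lambda>r. F r (z r) - F r (w r))"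
    using z w s by (simp add: ode_solution_def integral_diff[OF iz iw])
  then have "norm (z s - w s) \<le> norm (z0 - w0) + norm (integral {0..s} (\<lambda>r. F r (z r) - F r (w r)))"
    by (metis norm_triangle_ineq)
  also have "norm (integral {0..s} (\<lambda>r. F r (z r) - F r (w r)))
     \<le> integral {0..s} (\<lambda>r. K * norm (z r - w r))"
  proof (rule integral_norm_bound_integral)
    show "(\<lambda>r. F r (z r) - F r (w r)) integrable_on {0..s}" by (rule integrable_diff[OF iz iw])
    show "(\<lambda>r. K * norm (z r - w r)) integrable_on {0..s}"
      by (intro integrable_continuous_real continuous_intros
        continuous_on_subset[OF cz sub(1)] continuous_on_subset[OF cw sub(1)])
  qed (use L s in auto)
  finally show "norm (z s - w s) \<le> norm (z0 - w0) + K * integral {0..s} (\<lambda>r. norm (z r - w r))"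
    by simp
qed

lemma bounded_on_Icc:
  fixes z :: "real \<Rightarrow> 'a"
  assumes "continuous_on {0..T} z"
  obtains M where "M > 0" "\<And>t. 0 \<le> t \<Longrightarrow> t \<le> T \<Longrightarrow> norm (z t) < M"
proof -
  have "compact (z ` {0..T})" using assms by (intro compact_continuous_image compact_Icc)
  then obtain B where "B > 0" "\<forall>x\<in>z ` {0..T}. norm x \<le> B"
    using compact_imp_bounded bounded_pos by blast
  then show ?thesis by (intro that[of "B + 1"]) force+
qed

lemma solution_unique:
  assumes I: "time_interval I"
    and z: "ode_solution F I z0 z" and w: "ode_solution F I z0 w" and t: "t \<in> I"
  shows "z t = w t"
proof -
  have sub: "{0..t} \<subseteq> I" and t0: "0 \<le> t"
    using time_interval_subset[OF I t] I t by (auto simp: time_interval_def)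
  note z' = ode_solution_subset[OF z sub] and w' = ode_solution_subset[OF w sub]
  obtain A where A: "\<And>r. 0 \<le> r \<Longrightarrow> r \<le> t \<Longrightarrow> norm (z r) < A"
    by (rule bounded_on_Icc[of t z]) (use z' in \<open>auto simp: ode_solution_def\<close>)
  obtain B where B: "\<And>r. 0 \<le> r \<Longrightarrow> r \<le> t \<Longrightarrow> norm (w r) < B"
    by (rule bounded_on_Icc[of t w]) (use w' in \<open>auto simp: ode_solution_def\<close>)
  obtain K where K: "K > 0" and L: "\<And>r x y. r \<ge> 0 \<Longrightarrow> norm x \<le> max A B \<Longrightarrow>
      norm y \<le> max A B \<Longrightarrow> norm (F r x - F r y) \<le> K * norm (x - y)"
    using lip[of "max A B"] by blast
  have "norm (z t - w t) \<le> norm (z0 - z0) * exp (K * t)"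
  proof (rule stability[OF z' w'])
    fix r assume "0 \<le> r" "r \<le> t"
    then show "norm (F r (z r) - F r (w r)) \<le> K * norm (z r - w r)"
      using A[of r] B[of r] by (intro L) auto
  qed (use K t0 in auto)
  then show ?thesis by simp
qed

end

section \<open>Globally Lipschitz fields: solutions on the half-line\<close>

locale banach_ode_global = banach_ode F for F :: "real \<Rightarrow> 'a::banach \<Rightarrow> 'a" +
  fixes K :: real
  assumes K: "K > 0" and glip: "\<And>t x y. t \<ge> 0 \<Longrightarrow> norm (F t x - F t y) \<le> K * norm (x - y)"
begin

text \<open>The weight \<open>exp (- 2 K t)\<close> makes the Duhamel map a contraction on the whole half-line.\<close>

lemma global_solution: "\<exists>z. ode_solution F {0..} z0 z"
proof -
  \<comment> \<open>The unknown is \<open>w t = exp (- 2 * K * t) *\<^sub>R z t\<close>. The maximum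
    freezes the map at negative times, so that bounded continuous functions on the whole line form
    the complete space.\<close>
  define P where "P w t = exp (- 2 * K * max 0 t) *\<^sub>R
    (z0 + integral {0..max 0 t} (\<lambda>r. F r (exp (2 * K * r) *\<^sub>R w r)))" for w :: "real \<Rightarrow> 'a" and t
  have expint: "integral {0..t} (\<lambda>r. K * (exp (2 * K * r) * D)) = (exp (2 * K * t) - 1) / 2 * D"
    "(\<lambda>r. K * (exp (2 * K * r) * D)) integrable_on {0..t}"
    if "t \<ge> 0" for t D :: real
  proof -
    have "((\<lambda>r. K * (exp (2 * K * r) * D)) has_integral
       (exp (2 * K * t) / 2 * D - exp (2 * K * 0) / 2 * D)) {0..t}"
      using that K by (intro fundamental_theorem_of_calculus)
        (auto intro!: derivative_eq_intros simp flip: has_real_derivative_iff_has_vector_derivative)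
    then show "integral {0..t} (\<lambda>r. K * (exp (2 * K * r) * D)) = (exp (2 * K * t) - 1) / 2 * D"
      "(\<lambda>r. K * (exp (2 * K * r) * D)) integrable_on {0..t}"
      by (auto simp: has_integral_iff algebra_simps diff_divide_distrib)
  qed
  have cF: "continuous_on {0..} (\<lambda>r. F r (exp (2 * K * r) *\<^sub>R w r))"
    if "continuous_on UNIV w" for w :: "real \<Rightarrow> 'a"
    by (intro continuous_on_comp continuous_intros continuous_on_subset[OF that]) auto
  have iF: "(\<lambda>r. F r (exp (2 * K * r) *\<^sub>R w r)) integrable_on {0..t}"
    if "continuous_on UNIV w" for w :: "real \<Rightarrow> 'a" and t
    by (rule integrable_continuous_real[OF continuous_on_subset[OF cF[OF that]]]) auto
  have contract: "norm (P v t - P w t) \<le> D / 2"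
    if v: "continuous_on UNIV v" and w: "continuous_on UNIV w"
      and D: "\<And>r. norm (v r - w r) \<le> D" for v w :: "real \<Rightarrow> 'a" and t D
  proof -
    define s where "s = max 0 t"
    have s: "s \<ge> 0" by (simp add: s_def)
    have D0: "0 \<le> D" using D[of 0] norm_ge_zero order_trans by blast
    have "norm (P v t - P w t) = exp (- 2 * K * s) *
      norm (integral {0..s} (\<lambda>r. F r (exp (2 * K * r) *\<^sub>R v r) - F r (exp (2 * K * r) *\<^sub>R w r)))"
      by (simp add: P_def s_def[symmetric] scaleR_diff_right[symmetric] integral_diff iF v w)
    also have "norm (integral {0..s} (\<lambda>r. F r (exp (2 * K * r) *\<^sub>R v r) - F r (exp (2 * K * r) *\<^sub>R w r)))
       \<le> integral {0..s} (\<lambda>r. K * (exp (2 * K * r) * D))"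
    proof (rule integral_norm_bound_integral)
      fix r assume "r \<in> {0..s}"
      then have "norm (F r (exp (2 * K * r) *\<^sub>R v r) - F r (exp (2 * K * r) *\<^sub>R w r))
        \<le> K * norm (exp (2 * K * r) *\<^sub>R v r - exp (2 * K * r) *\<^sub>R w r)"
        by (intro glip) auto
      also have "\<dots> = K * (exp (2 * K * r) * norm (v r - w r))"
        by (simp add: scaleR_diff_right[symmetric])
      also have "\<dots> \<le> K * (exp (2 * K * r) * D)" using K D by (intro mult_left_mono) auto
      finally show "norm (F r (exp (2 * K * r) *\<^sub>R v r) - F r (exp (2 * K * r) *\<^sub>R w r))
        \<le> K * (exp (2 * K * r) * D)" .
    qed (use expint s iF v w in \<open>auto intro!: integrable_diff\<close>)
    also have "\<dots> = (exp (2 * K * s) - 1) / 2 * D" by (rule expint(1)[OF s])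
    finally have "norm (P v t - P w t) \<le> exp (- 2 * K * s) * ((exp (2 * K * s) - 1) / 2 * D)" by simp
    also have "\<dots> = (1 - exp (- 2 * K * s)) / 2 * D"
      by (simp add: algebra_simps exp_minus divide_simps)
    also have "\<dots> \<le> 1 / 2 * D" using D0 by (intro mult_right_mono) auto
    finally show ?thesis by simp
  qed
  have contP: "continuous_on UNIV (P w)" if w: "continuous_on UNIV w" for w
  proof -
    have c0: "continuous_on {0..} (\<lambda>s. integral {0..s} (\<lambda>r. F r (exp (2 * K * r) *\<^sub>R w r)))"
    proof (rule continuous_on_eq_continuous_within[THEN iffD2], rule)
      fix x :: real assume x: "x \<in> {0..}"
      have "continuous_on {0..x+1} (\<lambda>s. integral {0..s} (\<lambda>r. F r (exp (2 * K * r) *\<^sub>R w r)))"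
        by (rule indefinite_integral_continuous_1[OF iF[OF w]])
      then have "continuous (at x within {0..x+1}) (\<lambda>s. integral {0..s} (\<lambda>r. F r (exp (2 * K * r) *\<^sub>R w r)))"
        using x by (auto simp: continuous_on_eq_continuous_within)
      moreover have "at x within {0..} = at x within {0..x+1}"
        by (rule at_within_nhd[of _ "{x-1<..<x+1}"]) auto
      ultimately show "continuous (at x within {0..}) (\<lambda>s. integral {0..s} (\<lambda>r. F r (exp (2 * K * r) *\<^sub>R w r)))"
        by simp
    qed
    have "continuous_on UNIV (\<lambda>t. integral {0..max 0 t} (\<lambda>r. F r (exp (2 * K * r) *\<^sub>R w r)))"
      by (rule continuous_on_compose2[OF c0]) (auto intro!: continuous_intros)
    then show ?thesis unfolding P_def[abs_def] by (intro continuous_intros)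
  qed
  have P0: "norm (P (\<lambda>_. 0) t) \<le> norm z0" for t
    using K by (simp add: P_def zero mult_left_le_one_le)
  have PB: "P (apply_bcontfun w) \<in> bcontfun" for w
  proof (rule bcontfun_normI[where b = "norm z0 + norm w / 2"])
    fix x
    have "norm (P w x - P (\<lambda>_. 0) x) \<le> norm w / 2"
      by (rule contract) (auto intro: norm_bounded)
    then show "norm (P w x) \<le> norm z0 + norm w / 2"
      using P0[of x] norm_triangle_sub[of "P w x" "P (\<lambda>_. 0) x"] by linarith
  qed (simp add: contP)
  define Q where "Q w = Bcontfun (P (apply_bcontfun w))" for w
  have Q: "apply_bcontfun (Q w) = P w" for w
    unfolding Q_def by (rule Bcontfun_inverse[OF PB])
  have "\<exists>!w. Q w = w"
  proof (rule banach_fix_type[of "1/2"], simp, simp, intro allI)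
    fix v w
    show "dist (Q v) (Q w) \<le> 1 / 2 * dist v w"
    proof (rule dist_bound)
      fix x
      have "norm (P v x - P w x) \<le> dist v w / 2"
        by (rule contract) (auto simp: dist_norm[symmetric] dist_bounded)
      then show "dist (Q v x) (Q w x) \<le> 1 / 2 * dist v w" by (simp add: Q dist_norm)
    qed
  qed
  then obtain w where w: "Q w = w" by blast
  define z where "z t = exp (2 * K * t) *\<^sub>R apply_bcontfun w t" for t
  have "continuous_on {0..} z" unfolding z_def by (intro continuous_intros) auto
  moreover have "z t = z0 + integral {0..t} (\<lambda>r. F r (z r))" if "t \<ge> 0" for t
  proof -
    have "apply_bcontfun w t = P w t" using Q[of w] w by simp
    then show ?thesis using that
      by (simp add: z_def P_def exp_add[symmetric])
  qed
  ultimately show ?thesis by (auto simp: ode_solution_def)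
qed

end

section \<open>Locally Lipschitz fields: truncation, continuation and the maximal flow\<close>

context banach_ode
begin

lemma truncation:
  assumes "0 < M"
  obtains K where "banach_ode_global (\<lambda>t x. F t (ball_retract M x)) K"
proof -
  obtain L where L: "L > 0" "\<And>r x y. r \<ge> 0 \<Longrightarrow> norm x \<le> M \<Longrightarrow>
      norm y \<le> M \<Longrightarrow> norm (F r x - F r y) \<le> L * norm (x - y)"
    using lip[of M] by blast
  have G: "norm (F t (ball_retract M x) - F t (ball_retract M y)) \<le> 2 * L * norm (x - y)"
    if "t \<ge> 0" for t x y
  proof -
    have "norm (F t (ball_retract M x) - F t (ball_retract M y))
      \<le> L * norm (ball_retract M x - ball_retract M y)"
      using that assms by (intro L norm_ball_retract_le)
    also have "\<dots> \<le> L * (2 * norm (x - y))"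
      using L(1) assms by (intro mult_left_mono ball_retract_lipschitz) auto
    finally show ?thesis by simp
  qed
  show ?thesis
  proof (rule that[of "2 * L"], unfold_locales)
    show "\<exists>K>0. \<forall>t\<ge>0. \<forall>x y. norm x \<le> N \<longrightarrow> norm y \<le> N \<longrightarrow>
        norm (F t (ball_retract M x) - F t (ball_retract M y)) \<le> K * norm (x - y)" for N
      using G L(1) by (intro exI[of _ "2 * L"]) auto
  qed (use G L(1) cont zero in \<open>auto simp: ball_retract_0\<close>)
qed

text \<open>A solution on \<open>[0,T]\<close> is bounded by some \<open>M\<close> and therefore solves the globally Lipschitz equation
  truncated at radius \<open>M + 1\<close>; nearby solutions of the latter stay in the ball on a slightly longer
  interval.\<close>

lemma solutions_near:
  assumes z: "ode_solution F {0..T} z0 z" and T: "0 \<le> T"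
  obtains d T' L where "d > 0" "T' > T" "L > 0"
    "\<And>w0. norm (w0 - z0) < d \<Longrightarrow> \<exists>w. ode_solution F {0..T'} w0 w \<and>
      (\<forall>t\<in>{0..T}. norm (w t - z t) \<le> L * norm (w0 - z0))"
proof -
  obtain M where M: "M > 0" "\<And>t. 0 \<le> t \<Longrightarrow> t \<le> T \<Longrightarrow> norm (z t) < M"
    by (rule bounded_on_Icc[of T z]) (use z in \<open>auto simp: ode_solution_def\<close>)
  define N where "N = M + 1"
  have N: "N > 0" using M by (simp add: N_def)
  define G where "G = (\<lambda>t x. F t (ball_retract N x))"
  obtain K where "banach_ode_global G K" using truncation[OF N] unfolding G_def by blast
  then interpret G: banach_ode_global G K .
  have FG: "ode_solution F {0..t} w0 w \<longleftrightarrow> ode_solution G {0..t} w0 w"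
    if "\<And>r. 0 \<le> r \<Longrightarrow> r \<le> t \<Longrightarrow> norm (w r) \<le> N" for t w0 w
  proof -
    have "integral {0..s} (\<lambda>r. F r (w r)) = integral {0..s} (\<lambda>r. G r (w r))" if "s \<in> {0..t}" for s
      using that \<open>\<And>r. 0 \<le> r \<Longrightarrow> r \<le> t \<Longrightarrow> norm (w r) \<le> N\<close> N
      by (intro integral_cong) (auto simp: G_def ball_retract_id)
    then show ?thesis by (simp add: ode_solution_def)
  qed
  obtain y where y: "ode_solution G {0..} z0 y" using G.global_solution by blast
  have "ode_solution G {0..T} z0 z"
  proof (rule FG[THEN iffD1, OF _ z])
    show "norm (z r) \<le> N" if "0 \<le> r" "r \<le> T" for r
      using M(2)[OF that] by (simp add: N_def)
  qed
  then have zy: "z t = y t" if "0 \<le> t" "t \<le> T" for t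
    by (rule G.solution_unique[OF time_interval_Icc[OF T]])
      (use that in \<open>auto intro: ode_solution_subset[OF y]\<close>)
  have cy: "continuous_on {0..} y" using y by (simp add: ode_solution_def)
  \<comment> \<open>The truncated solution \<open>y\<close> exists beyond T, and continuity at T
    keeps it below M for a little longer. This extra time is what makes the set of existence times
    open to the right.\<close>
  have "\<exists>e>0. \<forall>t\<ge>0. dist t T < e \<longrightarrow> dist (y t) (y T) < M - norm (y T)"
  proof -
    have "M - norm (y T) > 0" using M(2)[of T] zy[of T] T by simp
    with cy T show ?thesis unfolding continuous_on_iff by (metis atLeast_iff)
  qed
  then obtain e where e: "e > 0" "\<And>t. t \<ge> 0 \<Longrightarrow> dist t T < e \<Longrightarrow> dist (y t) (y T) < M - norm (y T)"
    by blast
  define T' where "T' = T + e / 2"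
  have T': "T' > T" using e by (simp add: T'_def)
  have yM: "norm (y t) < M" if "0 \<le> t" "t \<le> T'" for t
  proof (cases "t \<le> T")
    case True then show ?thesis using M(2) zy that by metis
  next
    case False
    then have "dist (y t) (y T) < M - norm (y T)"
      using that e(1) by (intro e(2)) (auto simp: T'_def dist_real_def)
    then show ?thesis using norm_triangle_sub[of "y t" "y T"] by (simp add: dist_norm)
  qed
  show ?thesis
  \<comment> \<open>With d = exp (- K T') the stability estimate allows a deviation of at most 1,
    the margin between M and N; hence the truncation is never active along \<open>w\<close>.\<close>
  proof (rule that[OF _ T', of "exp (- (K * T'))" "exp (K * T')"])
    fix w0 assume w0: "norm (w0 - z0) < exp (- (K * T'))"
    obtain w where w: "ode_solution G {0..} w0 w" using G.global_solution by blast
    have wT: "ode_solution G {0..T'} w0 w" by (rule ode_solution_subset[OF w]) auto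
    have yT: "ode_solution G {0..T'} z0 y" by (rule ode_solution_subset[OF y]) auto
    have wy: "norm (w t - y t) \<le> exp (K * T') * norm (w0 - z0)" if t: "0 \<le> t" "t \<le> T'" for t
    proof -
      have "norm (w t - y t) \<le> norm (w0 - z0) * exp (K * t)"
        by (rule G.stability[OF wT yT less_imp_le[OF G.K] G.glip t])
      also have "\<dots> \<le> norm (w0 - z0) * exp (K * T')"
        using t G.K by (intro mult_left_mono) auto
      finally show ?thesis by (simp add: mult.commute)
    qed
    have wN: "norm (w t) \<le> N" if t: "0 \<le> t" "t \<le> T'" for t
    proof -
      note wy[OF t]
      also have "exp (K * T') * norm (w0 - z0) \<le> exp (K * T') * exp (- (K * T'))"
        using w0 by (intro mult_left_mono) auto
      also have "\<dots> = 1" by (simp add: exp_add[symmetric])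
      finally show ?thesis using yM[OF t] norm_triangle_sub[of "w t" "y t"] by (simp add: N_def)
    qed
    have "ode_solution F {0..T'} w0 w"
      by (rule FG[THEN iffD2, OF wN wT])
    then show "\<exists>w. ode_solution F {0..T'} w0 w \<and>
        (\<forall>t\<in>{0..T}. norm (w t - z t) \<le> exp (K * T') * norm (w0 - z0))"
      using wy zy T' by (intro exI[of _ w]) auto
  qed auto
qed

text \<open>The constant function solves the equation on the degenerate interval [0,0], and
  \<open>solutions_near\<close> reaches strictly past any given interval.\<close>

lemma local_solution: "\<exists>T>0. \<exists>z. ode_solution F {0..T} z0 z"
proof -
  have "ode_solution F {0..0} z0 (\<lambda>_. z0)" by (simp add: ode_solution_def)
  then obtain d T where "d > 0" "T > 0"
    "\<And>w0. norm (w0 - z0) < d \<Longrightarrow> \<exists>w. ode_solution F {0..T} w0 w"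
    using solutions_near[of 0 z0 "\<lambda>_. z0"] by (metis order_refl)
  then show ?thesis by (intro exI[of _ T]) auto
qed

definition existence_times :: "'a \<Rightarrow> real set" where
  "existence_times z0 = {t. 0 \<le> t \<and> (\<exists>z. ode_solution F {0..t} z0 z)}"

definition lifespan :: "'a \<Rightarrow> ereal" where
  "lifespan z0 = (SUP t\<in>existence_times z0. ereal t)"

text \<open>A separate solution is chosen for every end point \<open>t\<close>; by uniqueness the
  choices agree, which is \<open>flow_eq\<close>.\<close>

definition flow :: "'a \<Rightarrow> real \<Rightarrow> 'a" where
  "flow z0 t = (SOME z. ode_solution F {0..t} z0 z) t"

lemma existence_times_extend:
  assumes "t \<in> existence_times z0"
  shows "\<exists>t'>t. t' \<in> existence_times z0"
proof -
  obtain z where z: "ode_solution F {0..t} z0 z" and t: "0 \<le> t"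
    using assms by (auto simp: existence_times_def)
  obtain d t' where "d > 0" "t' > t" "\<And>w0. norm (w0 - z0) < d \<Longrightarrow> \<exists>w. ode_solution F {0..t'} w0 w"
    using solutions_near[OF z t] by metis
  then show ?thesis using t by (intro exI[of _ t']) (auto simp: existence_times_def)
qed

text \<open>Every existence time can be exceeded, so the supremum is not attained and the interval
  of existence is half-open, the form in which \<open>solution_map\<close> describes it.\<close>

lemma existence_times_eq: "existence_times z0 = {t. 0 \<le> t \<and> ereal t < lifespan z0}"
proof (intro set_eqI iffI)
  fix t assume t: "t \<in> existence_times z0"
  obtain t' where "t' > t" "t' \<in> existence_times z0" using existence_times_extend[OF t] by blast
  then have "ereal t < lifespan z0"
    unfolding lifespan_def less_SUP_iff by (intro bexI[of _ t']) auto
  then show "t \<in> {t. 0 \<le> t \<and> ereal t < lifespan z0}" using t by (auto simp: existence_times_def)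
next
  fix t assume t: "t \<in> {t. 0 \<le> t \<and> ereal t < lifespan z0}"
  then obtain t' where "t < t'" "t' \<in> existence_times z0"
    by (auto simp: lifespan_def less_SUP_iff)
  then obtain z where "ode_solution F {0..t'} z0 z" by (auto simp: existence_times_def)
  then have "ode_solution F {0..t} z0 z"
    by (rule ode_solution_subset) (use \<open>t < t'\<close> in auto)
  then show "t \<in> existence_times z0" using t by (auto simp: existence_times_def)
qed

lemma lifespan_pos: "0 < lifespan z0"
proof -
  obtain T where "T > 0" "T \<in> existence_times z0"
    using local_solution[of z0] by (auto simp: existence_times_def)
  then show ?thesis unfolding lifespan_def less_SUP_iff by (intro bexI[of _ T]) auto
qed

lemma flow_eq:
  assumes "ode_solution F {0..T} z0 z" "0 \<le> t" "t \<le> T"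
  shows "flow z0 t = z t"
proof -
  have z: "ode_solution F {0..t} z0 z" by (rule ode_solution_subset[OF assms(1)]) (use assms in auto)
  then have "ode_solution F {0..t} z0 (SOME z. ode_solution F {0..t} z0 z)"
    by (rule someI[where P = "ode_solution F {0..t} z0"])
  from solution_unique[OF time_interval_Icc this z] assms show ?thesis by (simp add: flow_def)
qed

lemma time_interval_existence_times: "time_interval (existence_times z0)"
proof -
  have "0 \<in> existence_times z0" using lifespan_pos[of z0] by (simp add: existence_times_eq zero_ereal_def)
  moreover have "x \<in> existence_times z0" if "a \<in> existence_times z0" "b \<in> existence_times z0" "a \<le> x" "x \<le> b"
    for a b x
    using that by (auto simp: existence_times_eq intro: le_less_trans[of "ereal x" "ereal b"])
  moreover have "existence_times z0 \<subseteq> {0..}" by (auto simp: existence_times_def)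
  ultimately show ?thesis
    unfolding time_interval_def is_interval_1 by blast
qed

lemma ode_solution_flow: "ode_solution F (existence_times z0) z0 (flow z0)"
proof -
  let ?E = "existence_times z0"
  \<comment> \<open>A solution that lives strictly beyond \<open>t\<close> gives continuity at
    \<open>t\<close> from both sides.\<close>
  have "\<exists>T z. t < T \<and> T \<in> ?E \<and> ode_solution F {0..T} z0 z" if "t \<in> ?E" for t
    using existence_times_extend[OF that] by (auto simp: existence_times_def)
  then obtain T z where Tz: "\<And>t. t \<in> ?E \<Longrightarrow> t < T t \<and> T t \<in> ?E \<and> ode_solution F {0..T t} z0 (z t)"
    by metis
  have eq: "flow z0 r = z t r" if "t \<in> ?E" "0 \<le> r" "r \<le> T t" for t r
    using flow_eq Tz that by blast
  show ?thesis unfolding ode_solution_def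
  proof (intro conjI ballI)
    show "continuous_on ?E (flow z0)" unfolding continuous_on_eq_continuous_within
    proof
      fix t assume t: "t \<in> ?E"
      have t0: "0 \<le> t" using t by (simp add: existence_times_def)
      have "continuous_on {0..T t} (flow z0)"
        using Tz[OF t] eq[OF t]
        by (subst continuous_on_cong[OF refl, of _ _ "z t"]) (auto simp: ode_solution_def)
      then have "continuous (at t within {0..T t}) (flow z0)"
        using t0 Tz[OF t] by (auto simp: continuous_on_eq_continuous_within)
      moreover have "at t within ?E = at t within {0..T t}"
      proof (rule at_within_nhd[of _ "{t-1<..<T t}"])
        have "{0..T t} \<subseteq> ?E"
          using Tz[OF t] time_interval_subset[OF time_interval_existence_times] by blast
        then show "?E \<inter> {t-1<..<T t} - {t} = {0..T t} \<inter> {t-1<..<T t} - {t}"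
          by (auto simp: existence_times_def)
      qed (use Tz[OF t] in auto)
      ultimately show "continuous (at t within ?E) (flow z0)" by simp
    qed
  next
    fix t assume t: "t \<in> ?E"
    have t0: "0 \<le> t" using t by (simp add: existence_times_def)
    have "integral {0..t} (\<lambda>r. F r (flow z0 r)) = integral {0..t} (\<lambda>r. F r (z t r))"
      using eq[OF t] Tz[OF t] by (intro integral_cong) auto
    then show "flow z0 t = z0 + integral {0..t} (\<lambda>r. F r (flow z0 r))"
      using Tz[OF t] eq[OF t, of t] t0 by (auto simp: ode_solution_def)
  qed
qed

lemma flow_maximal:
  assumes J: "time_interval J" and z: "ode_solution F J z0 z"
  shows "J \<subseteq> existence_times z0"
proof
  fix t assume t: "t \<in> J"
  then have "ode_solution F {0..t} z0 z"
    by (intro ode_solution_subset[OF z] time_interval_subset[OF J])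
  then show "t \<in> existence_times z0"
    using t J by (auto simp: existence_times_def time_interval_def)
qed

lemma flow_continuous:
  assumes t: "t \<in> existence_times z0" and e: "e > 0"
  obtains d where "d > 0" "\<And>w0. norm (w0 - z0) < d \<Longrightarrow>
    t \<in> existence_times w0 \<and> norm (flow w0 t - flow z0 t) < e"
proof -
  have t0: "0 \<le> t" using t by (simp add: existence_times_def)
  obtain z where z: "ode_solution F {0..t} z0 z" using t by (auto simp: existence_times_def)
  obtain d T L where d: "d > 0" and T: "T > t" and L: "L > 0"
    and w: "\<And>w0. norm (w0 - z0) < d \<Longrightarrow> \<exists>w. ode_solution F {0..T} w0 w \<and>
      (\<forall>r\<in>{0..t}. norm (w r - z r) \<le> L * norm (w0 - z0))"
    using solutions_near[OF z t0] by metis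
  show ?thesis
  proof (rule that[of "min d (e / L)"])
    fix w0 assume w0: "norm (w0 - z0) < min d (e / L)"
    then obtain w where w: "ode_solution F {0..T} w0 w" "norm (w t - z t) \<le> L * norm (w0 - z0)"
      using w[of w0] t0 by auto
    have "ode_solution F {0..t} w0 w" by (rule ode_solution_subset[OF w(1)]) (use T in auto)
    moreover have "L * norm (w0 - z0) < e" using w0 L by (simp add: field_simps)
    ultimately show "t \<in> existence_times w0 \<and> norm (flow w0 t - flow z0 t) < e"
      using w t0 T flow_eq[OF z t0 order_refl] flow_eq[OF w(1) t0] by (auto simp: existence_times_def)
  qed (use d e L in auto)
qed

end

section \<open>The Hilbert space of square summable families\<close>

definition square_summable :: "('a \<Rightarrow> complex) \<Rightarrow> bool" where
  "square_summable f \<longleftrightarrow> (\<lambda>k. (norm (f k))\<^sup>2) summable_on UNIV"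

definition l2_norm :: "('a \<Rightarrow> complex) \<Rightarrow> real" where
  "l2_norm f = sqrt (\<Sum>\<^sub>\<infinity>k. (norm (f k))\<^sup>2)"

lemma l2_norm_nonneg [simp]: "0 \<le> l2_norm f"
  by (simp add: l2_norm_def infsum_nonneg)

lemma L2_set_le_l2_norm:
  assumes "square_summable f" "finite K"
  shows "L2_set (\<lambda>k. norm (f k)) K \<le> l2_norm f"
  unfolding L2_set_def l2_norm_def
  by (intro real_sqrt_le_mono finite_sum_le_infsum) (use assms in \<open>auto simp: square_summable_def\<close>)

lemma
  assumes "\<And>K. finite K \<Longrightarrow> L2_set (\<lambda>k. norm (f k)) K \<le> B"
  shows square_summableI: "square_summable f" and l2_norm_le: "l2_norm f \<le> B"
proof -
  have B: "0 \<le> B" using assms[of "{}"] by simp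
  have *: "(\<Sum>k\<in>K. (norm (f k))\<^sup>2) \<le> B\<^sup>2" if "finite K" for K
    using assms[OF that] B real_le_lsqrt unfolding L2_set_def
    by (metis real_sqrt_le_iff real_sqrt_abs abs_of_nonneg)
  then show ss: "square_summable f"
    unfolding square_summable_def
    by (intro nonneg_bdd_above_summable_on) (auto intro!: bdd_aboveI[of _ "B\<^sup>2"])
  have "(\<Sum>\<^sub>\<infinity>k. (norm (f k))\<^sup>2) \<le> B\<^sup>2"
    using ss * by (intro infsum_le_finite_sums) (auto simp: square_summable_def)
  then show "l2_norm f \<le> B"
    unfolding l2_norm_def using B by (metis abs_of_nonneg real_sqrt_abs real_sqrt_le_iff)
qed

lemma norm_le_l2_norm: "square_summable f \<Longrightarrow> norm (f k) \<le> l2_norm f"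
  using L2_set_le_l2_norm[of f "{k}"] by simp

lemma
  assumes f: "square_summable f" and g: "square_summable g"
  shows square_summable_add: "square_summable (\<lambda>k. f k + g k)"
    and l2_norm_triangle: "l2_norm (\<lambda>k. f k + g k) \<le> l2_norm f + l2_norm g"
proof -
  have *: "L2_set (\<lambda>k. norm (f k + g k)) K \<le> l2_norm f + l2_norm g" if K: "finite K" for K
  proof -
    have "L2_set (\<lambda>k. norm (f k + g k)) K \<le> L2_set (\<lambda>k. norm (f k) + norm (g k)) K"
      by (intro L2_set_mono norm_triangle_ineq) auto
    also have "\<dots> \<le> L2_set (\<lambda>k. norm (f k)) K + L2_set (\<lambda>k. norm (g k)) K"
      by (rule L2_set_triangle_ineq)
    finally show ?thesis using L2_set_le_l2_norm[OF f K] L2_set_le_l2_norm[OF g K] by linarith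
  qed
  show "square_summable (\<lambda>k. f k + g k)" by (rule square_summableI[OF *])
  show "l2_norm (\<lambda>k. f k + g k) \<le> l2_norm f + l2_norm g" by (rule l2_norm_le[OF *])
qed

lemma square_summable_cmult: "square_summable f \<Longrightarrow> square_summable (\<lambda>k. c * f k)"
  by (simp add: square_summable_def norm_mult power_mult_distrib summable_on_cmult_right)

lemma l2_norm_cmult: "l2_norm (\<lambda>k. c * f k) = norm c * l2_norm f"
  by (simp add: l2_norm_def norm_mult power_mult_distrib infsum_cmult_right' real_sqrt_mult)

lemma square_summable_0: "square_summable (\<lambda>_. 0)"
  by (simp add: square_summable_def)

lemma square_summable_diff:
  "square_summable f \<Longrightarrow> square_summable g \<Longrightarrow> square_summable (\<lambda>k. f k - g k)"
  using square_summable_add[of f "\<lambda>k. (-1) * g k"] square_summable_cmult[of g "-1"] by simp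

lemma l2_norm_eq_0_iff: "square_summable f \<Longrightarrow> l2_norm f = 0 \<longleftrightarrow> (\<forall>k. f k = 0)"
  using norm_le_l2_norm[of f] by (force simp: l2_norm_def)

lemma l2_norm_mono:
  assumes "\<And>k. norm (f k) \<le> norm (g k)" and g: "square_summable g"
  shows "l2_norm f \<le> l2_norm g" and "square_summable f"
proof -
  have *: "L2_set (\<lambda>k. norm (f k)) K \<le> l2_norm g" if "finite K" for K
    using L2_set_mono[of K "\<lambda>k. norm (f k)" "\<lambda>k. norm (g k)"] assms(1) L2_set_le_l2_norm[OF g that]
    by (metis norm_ge_zero order_trans)
  show "l2_norm f \<le> l2_norm g" by (rule l2_norm_le[OF *])
  show "square_summable f" by (rule square_summableI[OF *])
qed

text \<open>A type rather than a set, so that it becomes an instance of \<open>banach\<close> and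
  the theory of \<open>banach_ode\<close> applies. All \<open>H^\<sigma>\<close> are modelled on
  this one space through the weights <k>^\<sigma>.\<close>

typedef 'a ell2 = "{f :: 'a \<Rightarrow> complex. square_summable f}"
  morphisms coef Ell2
  using square_summable_0 by blast

lemma square_summable_coef [simp]: "square_summable (coef x)"
  using coef by blast

lemma coef_Ell2: "square_summable f \<Longrightarrow> coef (Ell2 f) = f"
  by (simp add: Ell2_inverse)

lemma ell2_eqI: "(\<And>k. coef x k = coef y k) \<Longrightarrow> x = y"
  by (metis coef_inject ext)

instantiation ell2 :: (type) real_normed_vector
begin

definition "norm_ell2 x = l2_norm (coef x)"
definition "zero_ell2 = Ell2 (\<lambda>_. 0)"
definition "plus_ell2 x y = Ell2 (\<lambda>k. coef x k + coef y k)"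
definition "minus_ell2 x y = Ell2 (\<lambda>k. coef x k - coef y k)"
definition "uminus_ell2 x = Ell2 (\<lambda>k. - coef x k)"
definition "scaleR_ell2 r x = Ell2 (\<lambda>k. r *\<^sub>R coef x k)"
definition "dist_ell2 x y = norm (x - y :: 'a ell2)"
definition "sgn_ell2 x = inverse (norm x) *\<^sub>R (x :: 'a ell2)"
definition [code del]: "uniformity_ell2 = (INF e\<in>{0<..}. principal {(x :: 'a ell2, y). dist x y < e})"
definition [code del]: "open_ell2 (U :: 'a ell2 set) \<longleftrightarrow> (\<forall>x\<in>U. \<forall>\<^sub>F (x', y) in uniformity. x' = x \<longrightarrow> y \<in> U)"

lemma coef_0 [simp]: "coef 0 k = 0"
  by (simp add: zero_ell2_def coef_Ell2 square_summable_0)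
lemma coef_add [simp]: "coef (x + y) k = coef x k + coef y k"
  by (simp add: plus_ell2_def coef_Ell2 square_summable_add)
lemma coef_diff [simp]: "coef (x - y) k = coef x k - coef y k"
  by (simp add: minus_ell2_def coef_Ell2 square_summable_diff)
lemma coef_uminus [simp]: "coef (- x) k = - coef x k"
  using square_summable_cmult[of "coef x" "-1"] by (simp add: uminus_ell2_def coef_Ell2)
lemma coef_scaleR [simp]: "coef (r *\<^sub>R x) k = r *\<^sub>R coef x k"
  using square_summable_cmult[of "coef x" "of_real r"]
  by (simp add: scaleR_ell2_def coef_Ell2 scaleR_conv_of_real)

instance
proof
  fix x y :: "'a ell2" and a :: real
  show "norm x = 0 \<longleftrightarrow> x = 0"
    by (auto simp: norm_ell2_def l2_norm_eq_0_iff intro: ell2_eqI)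
  have "coef (x + y) = (\<lambda>k. coef x k + coef y k)" by auto
  then show "norm (x + y) \<le> norm x + norm y"
    by (simp add: norm_ell2_def l2_norm_triangle)
  have "coef (a *\<^sub>R x) = (\<lambda>k. of_real a * coef x k)" by (auto simp: scaleR_conv_of_real)
  then show "norm (a *\<^sub>R x) = \<bar>a\<bar> * norm x"
    by (simp add: norm_ell2_def l2_norm_cmult)
qed (auto intro!: ell2_eqI simp: algebra_simps dist_ell2_def sgn_ell2_def
      uniformity_ell2_def open_ell2_def)

end

lemma norm_coef_le: "norm (coef x k) \<le> norm x"
  by (simp add: norm_ell2_def norm_le_l2_norm)

lemma bounded_linear_coef: "bounded_linear (\<lambda>x. coef x k)"
  by (rule bounded_linear_intro[of _ 1]) (auto simp: norm_coef_le)

lemma L2_set_coef_le: "finite K \<Longrightarrow> L2_set (\<lambda>k. norm (coef x k)) K \<le> norm x"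
  by (simp add: norm_ell2_def L2_set_le_l2_norm)

instance ell2 :: (type) banach
proof
  fix X :: "nat \<Rightarrow> 'a ell2" assume X: "Cauchy X"
  have "Cauchy (\<lambda>n. coef (X n) k)" for k
    by (rule bounded_linear.Cauchy[OF bounded_linear_coef X])
  then have "\<exists>l. (\<lambda>n. coef (X n) k) \<longlonglongrightarrow> l" for k
    by (simp add: Cauchy_convergent_iff convergent_def)
  then obtain f where f: "\<And>k. (\<lambda>n. coef (X n) k) \<longlonglongrightarrow> f k" by metis
  \<comment> \<open>Bounds over finite index sets pass to the coordinatewise limit. Being uniform in
    \<open>K\<close>, they give both membership of the limit and convergence in norm.\<close>
  have diff: "L2_set (\<lambda>k. norm (coef (X n) k - f k)) K \<le> e"
    if K: "finite K" and e: "\<And>m. m \<ge> n \<Longrightarrow> norm (X n - X m) < e" for K e n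
  proof (rule LIMSEQ_le_const2)
    show "(\<lambda>m. L2_set (\<lambda>k. norm (coef (X n) k - coef (X m) k)) K)
        \<longlonglongrightarrow> L2_set (\<lambda>k. norm (coef (X n) k - f k)) K"
      unfolding L2_set_def by (intro tendsto_intros f)
    show "\<exists>N. \<forall>m\<ge>N. L2_set (\<lambda>k. norm (coef (X n) k - coef (X m) k)) K \<le> e"
    proof (intro exI[of _ n] allI impI)
      fix m assume "n \<le> m"
      then show "L2_set (\<lambda>k. norm (coef (X n) k - coef (X m) k)) K \<le> e"
        using L2_set_coef_le[OF K, of "X n - X m"] e[of m] by simp
    qed
  qed
  have Nex: "\<exists>N. \<forall>n\<ge>N. \<forall>m\<ge>n. norm (X n - X m) < e" if "e > 0" for e
    using X that unfolding Cauchy_def dist_norm by (meson order_trans)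
  obtain N where N: "\<And>m. m \<ge> N \<Longrightarrow> norm (X N - X m) < 1"
    using Nex[of 1] by auto
  have "square_summable (\<lambda>k. coef (X N) k - f k)"
    by (rule square_summableI[of _ 1]) (use diff N in auto)
  from square_summable_diff[OF square_summable_coef this, of "X N"]
  have ss: "square_summable f" by simp
  have "X \<longlonglongrightarrow> Ell2 f"
  proof (rule LIMSEQ_I)
    fix e :: real assume "e > 0"
    then obtain N where N: "\<And>n m. n \<ge> N \<Longrightarrow> m \<ge> n \<Longrightarrow> norm (X n - X m) < e / 2"
      using Nex[of "e / 2"] by auto
    have "norm (X n - Ell2 f) < e" if "n \<ge> N" for n
    proof -
      have "norm (X n - Ell2 f) \<le> e / 2"
        unfolding norm_ell2_def
      proof (rule l2_norm_le)
        fix K :: "'a set" assume "finite K"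
        from diff[OF this N[OF that]] show "L2_set (\<lambda>k. norm (coef (X n - Ell2 f) k)) K \<le> e / 2"
          by (simp add: coef_Ell2[OF ss])
      qed
      then show ?thesis using \<open>e > 0\<close> by simp
    qed
    then show "\<exists>N. \<forall>n\<ge>N. norm (X n - Ell2 f) < e" by blast
  qed
  then show "convergent X" by (auto simp: convergent_def)
qed

section \<open>Kernel operators\<close>

text \<open>An operator norm bound on l^2 for a nonnegative kernel, tested on finite sections and
  nonnegative vectors. Convergence questions are thus postponed to \<open>kernel_op\<close>, and the
  notion is monotone in the kernel.\<close>

definition kernel_bound :: "real \<Rightarrow> ('b \<Rightarrow> 'a \<Rightarrow> real) \<Rightarrow> bool" where
  "kernel_bound C A \<longleftrightarrow> 0 \<le> C \<and> (\<forall>K L f. finite K \<longrightarrow> finite L \<longrightarrow> (\<forall>l. 0 \<le> f l) \<longrightarrow>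
     L2_set (\<lambda>k. \<Sum>l\<in>L. A k l * f l) K \<le> C * L2_set f L)"

lemma kernel_boundD:
  "kernel_bound C A \<Longrightarrow> finite K \<Longrightarrow> finite L \<Longrightarrow> (\<And>l. 0 \<le> f l) \<Longrightarrow>
    L2_set (\<lambda>k. \<Sum>l\<in>L. A k l * f l) K \<le> C * L2_set f L"
  by (auto simp: kernel_bound_def)

lemma kernel_bound_add:
  assumes A: "kernel_bound C A" and B: "kernel_bound D B"
  shows "kernel_bound (C + D) (\<lambda>k l. A k l + B k l)"
  unfolding kernel_bound_def
proof (intro conjI allI impI)
  show "0 \<le> C + D" using A B by (auto simp: kernel_bound_def)
  fix K :: "'a set" and L :: "'b set" and f :: "'b \<Rightarrow> real" assume *: "finite K" "finite L" "\<forall>l. 0 \<le> f l"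
  have "L2_set (\<lambda>k. \<Sum>l\<in>L. (A k l + B k l) * f l) K
    = L2_set (\<lambda>k. (\<Sum>l\<in>L. A k l * f l) + (\<Sum>l\<in>L. B k l * f l)) K"
    by (simp add: algebra_simps sum.distrib)
  also have "\<dots> \<le> L2_set (\<lambda>k. \<Sum>l\<in>L. A k l * f l) K + L2_set (\<lambda>k. \<Sum>l\<in>L. B k l * f l) K"
    by (rule L2_set_triangle_ineq)
  also have "\<dots> \<le> C * L2_set f L + D * L2_set f L"
    using * by (intro add_mono kernel_boundD[OF A] kernel_boundD[OF B]) auto
  finally show "L2_set (\<lambda>k. \<Sum>l\<in>L. (A k l + B k l) * f l) K \<le> (C + D) * L2_set f L"
    by (simp add: algebra_simps)
qed

lemma kernel_bound_cmult:
  assumes A: "kernel_bound C A" and c: "0 \<le> c"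
  shows "kernel_bound (c * C) (\<lambda>k l. c * A k l)"
  unfolding kernel_bound_def
proof (intro conjI allI impI)
  show "0 \<le> c * C" using A c by (auto simp: kernel_bound_def)
  fix K :: "'a set" and L :: "'b set" and f :: "'b \<Rightarrow> real" assume *: "finite K" "finite L" "\<forall>l. 0 \<le> f l"
  have "L2_set (\<lambda>k. \<Sum>l\<in>L. c * A k l * f l) K = c * L2_set (\<lambda>k. \<Sum>l\<in>L. A k l * f l) K"
    using c by (simp add: L2_set_right_distrib sum_distrib_left mult.assoc)
  also have "\<dots> \<le> c * (C * L2_set f L)"
    using * c by (intro mult_left_mono kernel_boundD[OF A]) auto
  finally show "L2_set (\<lambda>k. \<Sum>l\<in>L. c * A k l * f l) K \<le> c * C * L2_set f L" by (simp add: mult.assoc)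
qed

lemma kernel_bound_mono:
  assumes A: "kernel_bound C A" and C: "C \<le> D" and B: "\<And>k l. 0 \<le> B k l \<and> B k l \<le> A k l"
  shows "kernel_bound D B"
  unfolding kernel_bound_def
proof (intro conjI allI impI)
  show "0 \<le> D" using A C by (auto simp: kernel_bound_def)
  fix K :: "'a set" and L :: "'b set" and f :: "'b \<Rightarrow> real" assume *: "finite K" "finite L" "\<forall>l. 0 \<le> f l"
  have "L2_set (\<lambda>k. \<Sum>l\<in>L. B k l * f l) K \<le> L2_set (\<lambda>k. \<Sum>l\<in>L. A k l * f l) K"
    using * B by (intro L2_set_mono sum_mono mult_right_mono sum_nonneg mult_nonneg_nonneg) auto
  also have "\<dots> \<le> C * L2_set f L" using * by (intro kernel_boundD[OF A]) auto
  also have "\<dots> \<le> D * L2_set f L" using C by (intro mult_right_mono) (auto simp: L2_set_nonneg)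
  finally show "L2_set (\<lambda>k. \<Sum>l\<in>L. B k l * f l) K \<le> D * L2_set f L" .
qed

text \<open>Schur's test with one bound for rows and columns: write A f as sqrt A times (sqrt A f),
  apply Cauchy-Schwarz in each row, then sum over columns.\<close>

lemma kernel_bound_Schur:
  assumes A: "\<And>k l. 0 \<le> A k l"
    and row: "\<And>k L. finite L \<Longrightarrow> (\<Sum>l\<in>L. A k l) \<le> R"
    and col: "\<And>l K. finite K \<Longrightarrow> (\<Sum>k\<in>K. A k l) \<le> R"
  shows "kernel_bound R A"
  unfolding kernel_bound_def
proof (intro conjI allI impI)
  show R: "0 \<le> R" using row[of "{}"] by simp
  fix K :: "'a set" and L :: "'b set" and f :: "'b \<Rightarrow> real" assume *: "finite K" "finite L" "\<forall>l. 0 \<le> f l"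
  have CS: "(\<Sum>l\<in>L. A k l * f l)\<^sup>2 \<le> R * (\<Sum>l\<in>L. A k l * (f l)\<^sup>2)" for k
  proof -
    have "(\<Sum>l\<in>L. A k l * f l) = (\<Sum>l\<in>L. sqrt (A k l) * (sqrt (A k l) * f l))"
      using A by (simp add: mult.assoc[symmetric])
    also have "\<dots>\<^sup>2 \<le> (\<Sum>l\<in>L. (sqrt (A k l))\<^sup>2) * (\<Sum>l\<in>L. (sqrt (A k l) * f l)\<^sup>2)"
      by (rule Cauchy_Schwarz_ineq_sum)
    also have "\<dots> = (\<Sum>l\<in>L. A k l) * (\<Sum>l\<in>L. A k l * (f l)\<^sup>2)"
      using A by (simp add: power_mult_distrib)
    also have "\<dots> \<le> R * (\<Sum>l\<in>L. A k l * (f l)\<^sup>2)"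
      using A * by (intro mult_right_mono row sum_nonneg) auto
    finally show ?thesis .
  qed
  have "(\<Sum>k\<in>K. (\<Sum>l\<in>L. A k l * f l)\<^sup>2) \<le> (\<Sum>k\<in>K. R * (\<Sum>l\<in>L. A k l * (f l)\<^sup>2))"
    by (intro sum_mono CS)
  also have "\<dots> = R * (\<Sum>l\<in>L. (\<Sum>k\<in>K. A k l) * (f l)\<^sup>2)"
    by (simp add: sum_distrib_left sum_distrib_right sum.swap[of _ L] mult.assoc)
  also have "\<dots> \<le> R * (\<Sum>l\<in>L. R * (f l)\<^sup>2)"
    using R * by (intro mult_left_mono sum_mono mult_right_mono col) auto
  also have "\<dots> = R\<^sup>2 * (\<Sum>l\<in>L. (f l)\<^sup>2)"
    by (simp add: sum_distrib_left power2_eq_square mult.assoc)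
  finally have "sqrt (\<Sum>k\<in>K. (\<Sum>l\<in>L. A k l * f l)\<^sup>2) \<le> sqrt (R\<^sup>2 * (\<Sum>l\<in>L. (f l)\<^sup>2))"
    by (rule real_sqrt_le_mono)
  then show "L2_set (\<lambda>k. \<Sum>l\<in>L. A k l * f l) K \<le> R * L2_set f L"
    using R by (simp add: L2_set_def real_sqrt_mult)
qed

lemma kernel_bound_Hilbert_Schmidt:
  assumes C: "0 \<le> C"
    and A: "\<And>K L. finite K \<Longrightarrow> finite L \<Longrightarrow> (\<Sum>k\<in>K. \<Sum>l\<in>L. (A k l)\<^sup>2) \<le> C\<^sup>2"
  shows "kernel_bound C A"
  unfolding kernel_bound_def
proof (intro conjI allI impI C)
  fix K :: "'a set" and L :: "'b set" and f :: "'b \<Rightarrow> real" assume *: "finite K" "finite L" "\<forall>l. 0 \<le> f l"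
  have "(\<Sum>k\<in>K. (\<Sum>l\<in>L. A k l * f l)\<^sup>2) \<le> (\<Sum>k\<in>K. (\<Sum>l\<in>L. (A k l)\<^sup>2) * (\<Sum>l\<in>L. (f l)\<^sup>2))"
    by (intro sum_mono Cauchy_Schwarz_ineq_sum)
  also have "\<dots> = (\<Sum>k\<in>K. \<Sum>l\<in>L. (A k l)\<^sup>2) * (\<Sum>l\<in>L. (f l)\<^sup>2)"
    by (simp add: sum_distrib_right)
  also have "\<dots> \<le> C\<^sup>2 * (\<Sum>l\<in>L. (f l)\<^sup>2)"
    using * by (intro mult_right_mono A sum_nonneg) auto
  finally have "sqrt (\<Sum>k\<in>K. (\<Sum>l\<in>L. A k l * f l)\<^sup>2) \<le> sqrt (C\<^sup>2 * (\<Sum>l\<in>L. (f l)\<^sup>2))"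
    by (rule real_sqrt_le_mono)
  then show "L2_set (\<lambda>k. \<Sum>l\<in>L. A k l * f l) K \<le> C * L2_set f L"
    using C by (simp add: L2_set_def real_sqrt_mult)
qed

definition kernel_op :: "('b \<Rightarrow> 'a \<Rightarrow> complex) \<Rightarrow> 'a ell2 \<Rightarrow> 'b ell2" where
  "kernel_op M x = Ell2 (\<lambda>k. \<Sum>\<^sub>\<infinity>l. M k l * coef x l)"

context
  fixes C :: real and M :: "'b \<Rightarrow> 'a \<Rightarrow> complex"
  assumes bound: "kernel_bound C (\<lambda>k l. norm (M k l))"
begin

lemma kernel_op_abs_summable: "(\<lambda>l. norm (M k l * coef x l)) summable_on UNIV"
proof (rule nonneg_bdd_above_summable_on)
  show "bdd_above (sum (\<lambda>l. norm (M k l * coef x l)) ` {L. L \<subseteq> UNIV \<and> finite L})"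
  proof (rule bdd_aboveI2)
    fix L :: "'a set" assume "L \<in> {L. L \<subseteq> UNIV \<and> finite L}"
    then have L: "finite L" by simp
    have "(\<Sum>l\<in>L. norm (M k l * coef x l)) = L2_set (\<lambda>k. \<Sum>l\<in>L. norm (M k l) * norm (coef x l)) {k}"
      by (simp add: norm_mult sum_nonneg)
    also have "\<dots> \<le> C * L2_set (\<lambda>l. norm (coef x l)) L"
      using L by (intro kernel_boundD[OF bound]) auto
    also have "\<dots> \<le> C * norm x"
      using bound L by (intro mult_left_mono L2_set_coef_le) (auto simp: kernel_bound_def)
    finally show "(\<Sum>l\<in>L. norm (M k l * coef x l)) \<le> C * norm x" .
  qed
qed auto

lemma kernel_op_summable: "(\<lambda>l. M k l * coef x l) summable_on UNIV"
  using kernel_op_abs_summable by (rule abs_summable_summable)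

lemma kernel_op_L2_set:
  assumes K: "finite K"
  shows "L2_set (\<lambda>k. norm (\<Sum>\<^sub>\<infinity>l. M k l * coef x l)) K \<le> C * norm x"
proof (rule tendsto_upperbound)
  show "((\<lambda>L. L2_set (\<lambda>k. norm (\<Sum>l\<in>L. M k l * coef x l)) K) \<longlongrightarrow>
      L2_set (\<lambda>k. norm (\<Sum>\<^sub>\<infinity>l. M k l * coef x l)) K) (finite_subsets_at_top UNIV)"
    unfolding L2_set_def by (intro tendsto_intros infsum_tendsto kernel_op_summable)
  show "\<forall>\<^sub>F L in finite_subsets_at_top UNIV. L2_set (\<lambda>k. norm (\<Sum>l\<in>L. M k l * coef x l)) K \<le> C * norm x"
  proof (rule eventually_finite_subsets_at_top_weakI)
    fix L :: "'a set" assume L: "finite L"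
    have "L2_set (\<lambda>k. norm (\<Sum>l\<in>L. M k l * coef x l)) K \<le> L2_set (\<lambda>k. \<Sum>l\<in>L. norm (M k l) * norm (coef x l)) K"
      by (intro L2_set_mono sum_norm_le) (auto simp: norm_mult)
    also have "\<dots> \<le> C * L2_set (\<lambda>l. norm (coef x l)) L"
      using L K by (intro kernel_boundD[OF bound]) auto
    also have "\<dots> \<le> C * norm x"
      using bound L by (intro mult_left_mono L2_set_coef_le) (auto simp: kernel_bound_def)
    finally show "L2_set (\<lambda>k. norm (\<Sum>l\<in>L. M k l * coef x l)) K \<le> C * norm x" .
  qed
qed auto

lemma coef_kernel_op: "coef (kernel_op M x) k = (\<Sum>\<^sub>\<infinity>l. M k l * coef x l)"
  unfolding kernel_op_def by (simp add: coef_Ell2[OF square_summableI[OF kernel_op_L2_set]])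

lemma norm_kernel_op_le: "norm (kernel_op M x) \<le> C * norm x"
  unfolding norm_ell2_def[of "kernel_op M x"] coef_kernel_op[abs_def]
  by (rule l2_norm_le[OF kernel_op_L2_set])

lemma bounded_linear_kernel_op: "bounded_linear (kernel_op M)"
proof (rule bounded_linear_intro[of _ C])
  show "kernel_op M (x + y) = kernel_op M x + kernel_op M y" for x y
    by (rule ell2_eqI) (simp add: coef_kernel_op distrib_left infsum_add kernel_op_summable)
  show "kernel_op M (r *\<^sub>R x) = r *\<^sub>R kernel_op M x" for r x
    by (rule ell2_eqI)
      (simp add: coef_kernel_op infsum_scaleR_right flip: scaleR_right.minus)
  show "norm (kernel_op M x) \<le> norm x * C" for x
    using norm_kernel_op_le[of x] by (simp add: mult.commute)
qed

end

text \<open>Neumann series in fixed point form: x = v - A x is a contraction. The constants come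
  from 1 - 1/2 = 1/2 and 1 + 1/2 <= 2.\<close>

lemma perturbed_identity_bij:
  fixes A :: "'a::banach \<Rightarrow> 'a"
  assumes A: "bounded_linear A" and half: "\<And>x. norm (A x) \<le> norm x / 2"
  shows "bij (\<lambda>x. x + A x)"
    and "norm (x - y) \<le> 2 * norm ((x + A x) - (y + A y))"
    and "norm ((x + A x) - (y + A y)) \<le> 2 * norm (x - y)"
proof -
  interpret A: bounded_linear A by (rule A)
  have eq: "(x + A x) - (y + A y) = (x - y) + A (x - y)" for x y
    by (simp add: A.diff)
  show lower: "norm (x - y) \<le> 2 * norm ((x + A x) - (y + A y))" for x y
    using half[of "x - y"] norm_diff_ineq[of "x - y" "A (x - y)"] unfolding eq by linarith
  show "norm ((x + A x) - (y + A y)) \<le> 2 * norm (x - y)"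
    using half[of "x - y"] norm_triangle_ineq[of "x - y" "A (x - y)"] norm_ge_zero[of "x - y"]
    unfolding eq by linarith
  show "bij (\<lambda>x. x + A x)"
  proof (rule bijI)
    show "inj (\<lambda>x. x + A x)"
    proof (rule injI)
      fix x y assume "x + A x = y + A y"
      then show "x = y" using lower[of x y] by simp
    qed
    show "surj (\<lambda>x. x + A x)"
      unfolding surj_def
    proof
      fix v
      have "\<exists>!x. v - A x = x"
      proof (rule banach_fix_type[of "1/2"], simp, simp, intro allI)
        fix x y
        have "norm (A (y - x)) \<le> norm (y - x) / 2" by (rule half)
        then show "dist (v - A x) (v - A y) \<le> 1 / 2 * dist x y"
          by (simp add: dist_norm A.diff norm_minus_commute)
      qed
      then obtain x where "v - A x = x" by blast
      then show "\<exists>x. v = x + A x" by (intro exI[of _ x]) (simp add: algebra_simps)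
    qed
  qed
qed

section \<open>Weights and Sobolev spaces\<close>

text \<open>The Japanese bracket <k>.\<close>

definition jap :: "int \<Rightarrow> real" where
  "jap k = sqrt (1 + (real_of_int k)\<^sup>2)"

lemma jap_ge_1: "1 \<le> jap k"
  by (simp add: jap_def)

lemma jap_pos [simp]: "0 < jap k" and jap_nonneg [simp]: "0 \<le> jap k" and jap_nz [simp]: "jap k \<noteq> 0"
  using jap_ge_1[of k] by linarith+

lemma jap_minus [simp]: "jap (- k) = jap k"
  by (simp add: jap_def)

lemma jap_power2: "(jap k)\<^sup>2 = 1 + (real_of_int k)\<^sup>2"
  by (simp add: jap_def)

lemma abs_le_jap: "\<bar>real_of_int k\<bar> \<le> jap k"
  unfolding jap_def by (rule real_le_rsqrt) simp

lemma jap_le: "jap k \<le> 1 + \<bar>real_of_int k\<bar>"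
  unfolding jap_def by (rule real_le_lsqrt) (auto simp: power2_sum)

lemma jap_mono: "\<bar>k\<bar> \<le> \<bar>l\<bar> \<Longrightarrow> jap k \<le> jap l"
  unfolding jap_def by (intro real_sqrt_le_mono add_left_mono) (simp add: abs_le_square_iff flip: of_int_power)

lemma jap_triangle: "jap (k + l) \<le> jap k + jap l"
proof (rule power2_le_imp_le)
  have "real_of_int k * real_of_int l \<le> \<bar>real_of_int k\<bar> * \<bar>real_of_int l\<bar>"
    by (simp add: abs_mult[symmetric])
  also have "\<dots> \<le> jap k * jap l" by (intro mult_mono abs_le_jap) auto
  finally show "(jap (k + l))\<^sup>2 \<le> (jap k + jap l)\<^sup>2"
    unfolding power2_sum jap_power2 by (simp add: power2_sum)
qed simp

lemma jap_triangle_diff: "jap k \<le> jap (k - l) + jap l"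
  using jap_triangle[of "k - l" l] by simp

lemma jap_powr_power2: "(jap k powr a)\<^sup>2 = jap k powr (2 * a)"
  by (simp add: powr_add[symmetric] power2_eq_square)

lemma one_plus_square_powr: "(1 + (real_of_int k)\<^sup>2) powr a = (jap k powr a)\<^sup>2"
proof -
  have "1 + (real_of_int k)\<^sup>2 = jap k powr 2" by (simp add: jap_power2)
  then show ?thesis by (simp only: powr_powr jap_powr_power2)
qed

lemma jap_powr_cancel [simp]:
  "jap k powr a * jap k powr (- a) = 1" "jap k powr (- a) * jap k powr a = 1"
  by (simp_all add: powr_add[symmetric])

lemma summable_jap:
  assumes a: "a > 1"
  shows "(\<lambda>k. jap k powr (- a)) summable_on UNIV"
proof -
  have "summable (\<lambda>n. jap (int n) powr (- a))"
  proof (rule summable_comparison_test_ev)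
    show "summable (\<lambda>n. real n powr (- a))" using a by (simp add: summable_real_powr_iff)
    show "\<forall>\<^sub>F n in sequentially. norm (jap (int n) powr (- a)) \<le> real n powr (- a)"
      using eventually_gt_at_top[of 0]
    proof eventually_elim
      case (elim n)
      then show ?case using a abs_le_jap[of "int n"] by (auto intro!: powr_mono2')
    qed
  qed
  then have n: "(\<lambda>n. jap (int n) powr (- a)) summable_on UNIV"
    by (rule summable_nonneg_imp_summable_on) auto
  have 1: "(\<lambda>k. jap k powr (- a)) summable_on range int"
    using n by (subst summable_on_reindex) (auto simp: o_def)
  have 2: "(\<lambda>k. jap k powr (- a)) summable_on range (\<lambda>n. - int n)"
    using n by (subst summable_on_reindex) (auto simp: o_def inj_on_def)
  have "range int \<union> range (\<lambda>n. - int n) = UNIV"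
  proof (intro set_eqI iffI UNIV_I)
    fix k :: int
    show "k \<in> range int \<union> range (\<lambda>n. - int n)" by (cases k rule: int_cases2) auto
  qed
  then show ?thesis using summable_on_union[OF 1 2] by simp
qed

section \<open>Sobolev spaces as weighted copies of l^2\<close>

definition weighted :: "real \<Rightarrow> torus_dist \<Rightarrow> torus_dist" where
  "weighted \<sigma> f = (\<lambda>k. of_real (jap k powr \<sigma>) * f k)"

lemma norm_weighted: "norm (weighted \<sigma> f k) = jap k powr \<sigma> * norm (f k)"
  by (simp add: weighted_def norm_mult)

lemma weighted_power2: "(norm (weighted \<sigma> f k))\<^sup>2 = (1 + (real_of_int k)\<^sup>2) powr \<sigma> * (norm (f k))\<^sup>2"
  by (simp add: norm_weighted power_mult_distrib one_plus_square_powr)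

lemma sobolev_iff: "f \<in> sobolev \<sigma> \<longleftrightarrow> square_summable (weighted \<sigma> f)"
  by (simp add: sobolev_def square_summable_def weighted_power2)

lemma sobolev_norm_eq: "sobolev_norm \<sigma> f = sqrt (2 * pi) * l2_norm (weighted \<sigma> f)"
  by (simp add: sobolev_norm_def l2_norm_def weighted_power2)

text \<open>Up to the factor sqrt (2 pi) an isometry of \<open>sobolev \<sigma>\<close> onto l^2
  with inverse \<open>of_ell2\<close>; outside \<open>sobolev \<sigma>\<close> its value is
  unspecified.\<close>

definition to_ell2 :: "real \<Rightarrow> torus_dist \<Rightarrow> int ell2" where
  "to_ell2 \<sigma> f = Ell2 (weighted \<sigma> f)"

definition of_ell2 :: "real \<Rightarrow> int ell2 \<Rightarrow> torus_dist" where
  "of_ell2 \<sigma> x = weighted (- \<sigma>) (coef x)"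

lemma weighted_weighted_minus [simp]:
  "weighted \<sigma> (weighted (- \<sigma>) f) = f" "weighted (- \<sigma>) (weighted \<sigma> f) = f"
  by (simp_all add: weighted_def mult.assoc[symmetric] of_real_mult[symmetric] del: of_real_mult)

lemma coef_to_ell2: "f \<in> sobolev \<sigma> \<Longrightarrow> coef (to_ell2 \<sigma> f) = weighted \<sigma> f"
  by (simp add: to_ell2_def coef_Ell2 sobolev_iff)

lemma of_ell2_in_sobolev [simp]: "of_ell2 \<sigma> x \<in> sobolev \<sigma>"
  by (simp add: sobolev_iff of_ell2_def)

lemma of_to_ell2 [simp]: "f \<in> sobolev \<sigma> \<Longrightarrow> of_ell2 \<sigma> (to_ell2 \<sigma> f) = f"
  by (simp add: of_ell2_def coef_to_ell2)

lemma to_of_ell2 [simp]: "to_ell2 \<sigma> (of_ell2 \<sigma> x) = x"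
  by (rule ell2_eqI) (simp add: coef_to_ell2, simp add: of_ell2_def)

lemma of_ell2_add: "of_ell2 \<sigma> (x + y) k = of_ell2 \<sigma> x k + of_ell2 \<sigma> y k"
  and of_ell2_scaleR: "of_ell2 \<sigma> (r *\<^sub>R x) k = r *\<^sub>R of_ell2 \<sigma> x k"
  by (simp_all add: of_ell2_def weighted_def algebra_simps)

lemma sobolev_norm_to_ell2: "f \<in> sobolev \<sigma> \<Longrightarrow> sobolev_norm \<sigma> f = sqrt (2 * pi) * norm (to_ell2 \<sigma> f)"
  by (simp add: sobolev_norm_eq norm_ell2_def coef_to_ell2)

lemma sobolev_diff: "f \<in> sobolev \<sigma> \<Longrightarrow> g \<in> sobolev \<sigma> \<Longrightarrow> (\<lambda>k. f k - g k) \<in> sobolev \<sigma>"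
  using square_summable_diff[of "weighted \<sigma> f" "weighted \<sigma> g"]
  by (simp add: sobolev_iff weighted_def algebra_simps)

lemma sobolev_dist_to_ell2:
  assumes "f \<in> sobolev \<sigma>" "g \<in> sobolev \<sigma>"
  shows "sobolev_dist \<sigma> f g = sqrt (2 * pi) * norm (to_ell2 \<sigma> f - to_ell2 \<sigma> g)"
proof -
  have "to_ell2 \<sigma> (\<lambda>k. f k - g k) = to_ell2 \<sigma> f - to_ell2 \<sigma> g"
    by (rule ell2_eqI) (simp add: coef_to_ell2 assms sobolev_diff, simp add: weighted_def algebra_simps)
  then show ?thesis
    by (simp add: sobolev_dist_def sobolev_norm_to_ell2 sobolev_diff assms)
qed

lemma bounded_linear_of_ell2: "bounded_linear (\<lambda>x. of_ell2 \<sigma> x k)"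
  unfolding of_ell2_def weighted_def
  by (intro bounded_linear_const_mult bounded_linear_coef)

text \<open>By Cauchy-Schwarz, for \<sigma> > 1/2 a bound for the embedding of
  \<open>H^\<sigma>\<close> into the absolutely convergent Fourier series.\<close>

definition embedding_const :: "real \<Rightarrow> real" where
  "embedding_const \<sigma> = sqrt (\<Sum>\<^sub>\<infinity>k. jap k powr (- 2 * \<sigma>))"

lemma embedding_const_nonneg [simp]: "0 \<le> embedding_const \<sigma>"
  by (simp add: embedding_const_def infsum_nonneg)

lemma jap_L2_set_le:
  assumes "\<sigma> > 1 / 2" "finite K"
  shows "L2_set (\<lambda>k. jap k powr (- \<sigma>)) K \<le> embedding_const \<sigma>"
proof -
  have "(\<Sum>k\<in>K. jap k powr (- 2 * \<sigma>)) \<le> (\<Sum>\<^sub>\<infinity>k. jap k powr (- 2 * \<sigma>))"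
    by (rule finite_sum_le_infsum) (use summable_jap[of "2 * \<sigma>"] assms in auto)
  then show ?thesis by (simp add: L2_set_def embedding_const_def jap_powr_power2)
qed

lemma sobolev_finite_sum:
  assumes \<sigma>: "\<sigma> > 1 / 2" and K: "finite K"
  shows "(\<Sum>k\<in>K. norm (of_ell2 \<sigma> x k)) \<le> embedding_const \<sigma> * norm x"
proof -
  have "(\<Sum>k\<in>K. norm (of_ell2 \<sigma> x k)) = (\<Sum>k\<in>K. \<bar>jap k powr (- \<sigma>)\<bar> * \<bar>norm (coef x k)\<bar>)"
    by (simp add: of_ell2_def norm_weighted)
  also have "\<dots> \<le> L2_set (\<lambda>k. jap k powr (- \<sigma>)) K * L2_set (\<lambda>k. norm (coef x k)) K"
    by (rule L2_set_mult_ineq)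
  also have "\<dots> \<le> embedding_const \<sigma> * norm x"
    by (intro mult_mono jap_L2_set_le[OF \<sigma> K] L2_set_coef_le[OF K]) (auto simp: L2_set_nonneg)
  finally show ?thesis .
qed

lemma sobolev_abs_summable:
  assumes \<sigma>: "\<sigma> > 1 / 2"
  shows "(\<lambda>k. norm (of_ell2 \<sigma> x k)) summable_on UNIV"
  using sobolev_finite_sum[OF \<sigma>]
  by (intro nonneg_bdd_above_summable_on bdd_aboveI2) auto

section \<open>Convolution kernels and the algebra property of Sobolev spaces\<close>

lemma powr_triangle:
  fixes a b c :: real
  assumes "0 \<le> s" "0 \<le> a" "0 \<le> b" "0 \<le> c" "a \<le> b + c"
  shows "a powr s \<le> 2 powr s * (b powr s + c powr s)"
proof -
  have "a powr s \<le> (2 * max b c) powr s" using assms by (intro powr_mono2) auto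
  also have "\<dots> = 2 powr s * max b c powr s" using assms by (simp add: powr_mult)
  also have "\<dots> \<le> 2 powr s * (b powr s + c powr s)"
    using assms by (intro mult_left_mono) (auto simp: max_def)
  finally show ?thesis .
qed

lemma sum_shift_int:
  fixes g :: "int \<Rightarrow> real"
  shows "(\<Sum>k\<in>K. g (k - l)) = sum g ((\<lambda>k. k - l) ` K)" "(\<Sum>l\<in>K. g (k - l)) = sum g ((\<lambda>l. k - l) ` K)"
  by (subst sum.reindex; simp add: inj_on_def)+

lemma kernel_bound_convolution:
  assumes b: "\<And>K. finite K \<Longrightarrow> (\<Sum>k\<in>K. b k) \<le> R" "\<And>k. 0 \<le> b k"
  shows "kernel_bound R (\<lambda>k l :: int. b (k - l))"
  by (rule kernel_bound_Schur) (use b in \<open>auto simp: sum_shift_int\<close>)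

text \<open>The shift (k,l) -> (k-l,l) factors the Hilbert-Schmidt norm into two l^2 norms. Both the
  algebra property and the far part of the conjugating kernel rest on this.\<close>

lemma kernel_bound_convolution_HS:
  fixes a b :: "int \<Rightarrow> real"
  assumes a: "\<And>K. finite K \<Longrightarrow> L2_set a K \<le> A" and b: "\<And>K. finite K \<Longrightarrow> L2_set b K \<le> B"
  shows "kernel_bound (A * B) (\<lambda>k l. a (k - l) * b l)"
proof (rule kernel_bound_Hilbert_Schmidt)
  have A: "0 \<le> A" and B: "0 \<le> B" using a[of "{}"] b[of "{}"] by auto
  then show "0 \<le> A * B" by simp
  fix K L :: "int set" assume K: "finite K" "finite L"
  have a2: "(\<Sum>k\<in>S. (a k)\<^sup>2) \<le> A\<^sup>2" if "finite S" for S
    using a[OF that] A by (simp add: L2_set_def sqrt_le_D)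
  have b2: "(\<Sum>k\<in>L. (b k)\<^sup>2) \<le> B\<^sup>2"
    using b[OF K(2)] by (simp add: L2_set_def sqrt_le_D)
  have "(\<Sum>k\<in>K. \<Sum>l\<in>L. (a (k - l) * b l)\<^sup>2) = (\<Sum>l\<in>L. (\<Sum>k\<in>K. (a (k - l))\<^sup>2) * (b l)\<^sup>2)"
    by (subst sum.swap) (simp add: power_mult_distrib sum_distrib_right)
  also have "\<dots> \<le> (\<Sum>l\<in>L. A\<^sup>2 * (b l)\<^sup>2)"
    using a2 K by (intro sum_mono mult_right_mono) (auto simp: sum_shift_int(1)[where g = "\<lambda>k. (a k)\<^sup>2"])
  also have "\<dots> \<le> A\<^sup>2 * B\<^sup>2"
    using b2 by (simp add: sum_distrib_left[symmetric] mult_left_mono)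
  finally show "(\<Sum>k\<in>K. \<Sum>l\<in>L. (a (k - l) * b l)\<^sup>2) \<le> (A * B)\<^sup>2"
    by (simp add: power_mult_distrib)
qed

text \<open>Conjugation with the weights: M is bounded on \<open>H^\<sigma>\<close> when this kernel
  is bounded on l^2.\<close>

abbreviation sobolev_kernel :: "real \<Rightarrow> (int \<Rightarrow> int \<Rightarrow> complex) \<Rightarrow> int \<Rightarrow> int \<Rightarrow> complex" where
  "sobolev_kernel \<sigma> M k l \<equiv> of_real (jap k powr \<sigma>) * M k l * of_real (jap l powr (- \<sigma>))"

definition conv_kernel :: "real \<Rightarrow> torus_dist \<Rightarrow> int \<Rightarrow> int \<Rightarrow> complex" where
  "conv_kernel \<sigma> f k l = of_real (jap k powr \<sigma>) * f (k - l) * of_real (jap l powr (- \<sigma>))"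

text \<open>The algebra property of \<open>H^\<sigma>\<close>. After <k>^\<sigma> <= 2^\<sigma>
  (<k-l>^\<sigma> + <l>^\<sigma>), the first term is a Hilbert-Schmidt kernel with both factors in
  l^2, the second a convolution with an l^1 sequence.\<close>

lemma conv_kernel_bound:
  assumes \<sigma>: "\<sigma> > 1 / 2"
  shows "kernel_bound (2 powr \<sigma> * 2 * embedding_const \<sigma> * norm x)
    (\<lambda>k l. norm (conv_kernel \<sigma> (of_ell2 \<sigma> x) k l))"
proof -
  let ?f = "of_ell2 \<sigma> x"
  have HS: "kernel_bound (norm x * embedding_const \<sigma>)
      (\<lambda>k l. norm (coef x (k - l)) * jap l powr (- \<sigma>))"
    by (rule kernel_bound_convolution_HS) (use \<sigma> in \<open>auto intro: L2_set_coef_le jap_L2_set_le\<close>)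
  have Sch: "kernel_bound (embedding_const \<sigma> * norm x) (\<lambda>k l. norm (?f (k - l)))"
    by (rule kernel_bound_convolution) (use sobolev_finite_sum[OF \<sigma>] in auto)
  have "norm (conv_kernel \<sigma> ?f k l)
     \<le> 2 powr \<sigma> * (norm (coef x (k - l)) * jap l powr (- \<sigma>) + norm (?f (k - l)))" for k l
  proof -
    have "norm (conv_kernel \<sigma> ?f k l) = jap k powr \<sigma> * (norm (?f (k - l)) * jap l powr (- \<sigma>))"
      by (simp add: conv_kernel_def norm_mult)
    also have "\<dots> \<le> 2 powr \<sigma> * (jap (k - l) powr \<sigma> + jap l powr \<sigma>) * (norm (?f (k - l)) * jap l powr (- \<sigma>))"
      using \<sigma> by (intro mult_right_mono powr_triangle jap_triangle_diff) auto
    also have "\<dots> = 2 powr \<sigma> * ((jap (k - l) powr \<sigma> * norm (?f (k - l))) * jap l powr (- \<sigma>)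
        + norm (?f (k - l)) * (jap l powr \<sigma> * jap l powr (- \<sigma>)))"
      by (simp only: algebra_simps)
    also have "\<dots> = 2 powr \<sigma> * (norm (coef x (k - l)) * jap l powr (- \<sigma>) + norm (?f (k - l)))"
      by (simp only: jap_powr_cancel norm_weighted[symmetric]) (simp add: of_ell2_def)
    finally show ?thesis .
  qed
  then show ?thesis
    by (intro kernel_bound_mono[OF kernel_bound_cmult[OF kernel_bound_add[OF HS Sch], of "2 powr \<sigma>"]]) auto
qed

definition sobolev_mult :: "real \<Rightarrow> int ell2 \<Rightarrow> int ell2 \<Rightarrow> int ell2" where
  "sobolev_mult \<sigma> x y = kernel_op (conv_kernel \<sigma> (of_ell2 \<sigma> x)) y"

lemma of_ell2_kernel_op:
  assumes "kernel_bound C (\<lambda>k l. norm (sobolev_kernel \<sigma> M k l))"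
  shows "of_ell2 \<sigma> (kernel_op (sobolev_kernel \<sigma> M) y) k
     = (\<Sum>\<^sub>\<infinity>l. M k l * of_ell2 \<sigma> y l)"
    and "(\<lambda>l. norm (M k l * of_ell2 \<sigma> y l)) summable_on UNIV"
proof -
  have eq: "of_real (jap k powr \<sigma>) * M k l * of_real (jap l powr (- \<sigma>)) * coef y l
      = of_real (jap k powr \<sigma>) * (M k l * of_ell2 \<sigma> y l)" for l
    by (simp add: of_ell2_def weighted_def)
  show "of_ell2 \<sigma> (kernel_op (sobolev_kernel \<sigma> M) y) k
     = (\<Sum>\<^sub>\<infinity>l. M k l * of_ell2 \<sigma> y l)"
    unfolding of_ell2_def[of \<sigma> "kernel_op _ _"] weighted_def coef_kernel_op[OF assms] eq infsum_cmult_right'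
    by (simp add: mult.assoc[symmetric] of_real_mult[symmetric] del: of_real_mult)
  have "(\<lambda>l. norm (of_real (jap k powr \<sigma>) * (M k l * of_ell2 \<sigma> y l))) summable_on UNIV"
    using kernel_op_abs_summable[OF assms, of k y] unfolding eq .
  then show "(\<lambda>l. norm (M k l * of_ell2 \<sigma> y l)) summable_on UNIV"
    by (simp add: norm_mult summable_on_cmult_right')
qed

lemma of_ell2_sobolev_mult:
  assumes \<sigma>: "\<sigma> > 1 / 2"
  shows "of_ell2 \<sigma> (sobolev_mult \<sigma> x y) = dist_mult (of_ell2 \<sigma> x) (of_ell2 \<sigma> y)"
  using of_ell2_kernel_op(1)[of _ \<sigma> "\<lambda>k l. of_ell2 \<sigma> x (k - l)", OF conv_kernel_bound[OF \<sigma>, of x, unfolded conv_kernel_def]]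
  by (auto simp: sobolev_mult_def conv_kernel_def[abs_def] dist_mult_def)

lemma of_ell2_inject: "of_ell2 \<sigma> x = of_ell2 \<sigma> y \<Longrightarrow> x = y"
  by (metis to_of_ell2)

lemma bounded_bilinear_sobolev_mult:
  assumes \<sigma>: "\<sigma> > 1 / 2"
  shows "bounded_bilinear (sobolev_mult \<sigma>)"
proof
  have L: "bounded_linear (sobolev_mult \<sigma> x)" for x
    unfolding sobolev_mult_def[abs_def] by (rule bounded_linear_kernel_op[OF conv_kernel_bound[OF \<sigma>]])
  show "sobolev_mult \<sigma> x (y + z) = sobolev_mult \<sigma> x y + sobolev_mult \<sigma> x z" for x y z
    using L[of x] by (simp add: linear_simps)
  show "sobolev_mult \<sigma> x (r *\<^sub>R y) = r *\<^sub>R sobolev_mult \<sigma> x y" for x r y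
    using L[of x] by (simp add: linear_simps)
  have summ: "(\<lambda>l. of_ell2 \<sigma> x (k - l) * of_ell2 \<sigma> y l) summable_on UNIV" for x y k
    using of_ell2_kernel_op(2)[of _ \<sigma> "\<lambda>k l. of_ell2 \<sigma> x (k - l)", OF conv_kernel_bound[OF \<sigma>, of x, unfolded conv_kernel_def]]
    by (rule abs_summable_summable)
  show "sobolev_mult \<sigma> (x + y) z = sobolev_mult \<sigma> x z + sobolev_mult \<sigma> y z" for x y z
    by (rule of_ell2_inject[of \<sigma>], rule ext)
      (simp add: of_ell2_sobolev_mult[OF \<sigma>] of_ell2_add dist_mult_def distrib_right infsum_add summ)
  show "sobolev_mult \<sigma> (r *\<^sub>R x) y = r *\<^sub>R sobolev_mult \<sigma> x y" for r x y
    by (rule of_ell2_inject[of \<sigma>], rule ext)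
      (simp add: of_ell2_sobolev_mult[OF \<sigma>] of_ell2_scaleR dist_mult_def infsum_scaleR_right)
  show "\<exists>K. \<forall>x y. norm (sobolev_mult \<sigma> x y) \<le> norm x * norm y * K"
    using norm_kernel_op_le[OF conv_kernel_bound[OF \<sigma>]]
    by (intro exI[of _ "2 powr \<sigma> * 2 * embedding_const \<sigma>"]) (simp add: sobolev_mult_def mult_ac)
qed

section \<open>The cubic nonlinearity\<close>

lemma convolution_abs_summable:
  fixes f g :: torus_dist
  assumes f: "(\<lambda>k. norm (f k)) summable_on UNIV" and g: "(\<lambda>k. norm (g k)) summable_on UNIV"
  shows "(\<lambda>(l, k). norm (f (k - l) * g l)) summable_on UNIV \<times> UNIV"
proof -
  have shift: "(\<lambda>k. norm (f (k - l))) summable_on UNIV" "(\<Sum>\<^sub>\<infinity>k. norm (f (k - l))) = (\<Sum>\<^sub>\<infinity>k. norm (f k))" for l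
  proof -
    have "bij (\<lambda>k. k - l)" by (rule bij_betw_byWitness[of _ "\<lambda>k. k + l"]) auto
    then show "(\<lambda>k. norm (f (k - l))) summable_on UNIV" "(\<Sum>\<^sub>\<infinity>k. norm (f (k - l))) = (\<Sum>\<^sub>\<infinity>k. norm (f k))"
      using f summable_on_reindex_bij_betw[of "\<lambda>k. k - l" UNIV UNIV "\<lambda>k. norm (f k)"]
        infsum_reindex_bij_betw[of "\<lambda>k. k - l" UNIV UNIV "\<lambda>k. norm (f k)"] by simp_all
  qed
  have "(\<lambda>x. norm ((\<lambda>(l, k). f (k - l) * g l) x)) summable_on UNIV \<times> UNIV"
    by (subst Infinite_Sum.abs_summable_on_Sigma_iff)
      (auto simp: norm_mult infsum_cmult_left' shift abs_mult infsum_nonneg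
        intro!: summable_on_cmult_left summable_on_cmult_right g shift)
  then show ?thesis by (simp add: case_prod_unfold)
qed

lemma dist_mult_abs_summable:
  assumes f: "(\<lambda>k. norm (f k)) summable_on UNIV" and g: "(\<lambda>k. norm (g k)) summable_on UNIV"
  shows "(\<lambda>k. norm (dist_mult f g k)) summable_on UNIV"
proof -
  have "(\<lambda>(k, l). norm (f (k - l) * g l)) summable_on UNIV \<times> UNIV"
    using summable_on_swap[THEN iffD1, OF convolution_abs_summable[OF f g]] by (simp add: case_prod_unfold)
  then have 1: "(\<lambda>k. \<Sum>\<^sub>\<infinity>l. norm (f (k - l) * g l)) summable_on UNIV"
    and 2: "\<And>k. (\<lambda>l. norm (f (k - l) * g l)) summable_on UNIV"
    using summable_on_Sigma_banach[of "\<lambda>k l. norm (f (k - l) * g l)" UNIV "\<lambda>_. UNIV"]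
      summable_on_SigmaD1[of "\<lambda>k l. norm (f (k - l) * g l)" UNIV "\<lambda>_. UNIV"] by (auto simp: case_prod_unfold)
  show ?thesis
    by (rule summable_on_comparison_test[OF 1]) (auto simp: dist_mult_def intro!: norm_infsum_bound 2)
qed

lemma torus_fun_mult:
  assumes f: "(\<lambda>k. norm (f k)) summable_on UNIV" and g: "(\<lambda>k. norm (g k)) summable_on UNIV"
  shows "torus_fun (dist_mult f g) x = torus_fun f x * torus_fun g x"
proof -
  let ?e = "\<lambda>k. cis (real_of_int k * x)"
  have shift: "(\<Sum>\<^sub>\<infinity>k. f (k - l) * ?e (k - l)) = torus_fun f x" for l
  proof -
    have "bij (\<lambda>k. k - l)" by (rule bij_betw_byWitness[of _ "\<lambda>k. k + l"]) auto
    then show ?thesis unfolding torus_fun_def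
      by (rule infsum_reindex_bij_betw[where f = "\<lambda>k. f k * ?e k"])
  qed
  have "(\<lambda>(l, k). f (k - l) * g l * ?e k) summable_on UNIV \<times> UNIV"
    by (rule abs_summable_summable)
      (use convolution_abs_summable[OF f g] in \<open>simp add: case_prod_unfold norm_mult\<close>)
  then have "(\<Sum>\<^sub>\<infinity>l. \<Sum>\<^sub>\<infinity>k. f (k - l) * g l * ?e k) = (\<Sum>\<^sub>\<infinity>k. \<Sum>\<^sub>\<infinity>l. f (k - l) * g l * ?e k)"
    by (rule infsum_swap_banach)
  also have "\<dots> = torus_fun (dist_mult f g) x"
    by (simp add: torus_fun_def dist_mult_def infsum_cmult_left')
  finally have "torus_fun (dist_mult f g) x = (\<Sum>\<^sub>\<infinity>l. \<Sum>\<^sub>\<infinity>k. f (k - l) * g l * ?e k)" by simp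
  also have "\<dots> = (\<Sum>\<^sub>\<infinity>l. \<Sum>\<^sub>\<infinity>k. (f (k - l) * ?e (k - l)) * (g l * ?e l))"
    by (intro infsum_cong) (simp add: cis_mult algebra_simps)
  also have "\<dots> = torus_fun f x * torus_fun g x"
    unfolding infsum_cmult_left' shift infsum_cmult_right' torus_fun_def[of g] ..
  finally show ?thesis .
qed

lemma norm_conj_dist: "norm (conj_dist f k) = norm (f (- k))"
  by (simp add: conj_dist_def)

lemma bij_uminus_int: "bij (uminus :: int \<Rightarrow> int)"
  by (rule bij_betw_byWitness[of _ uminus]) auto

lemma conj_dist_abs_summable:
  "(\<lambda>k. norm (f k)) summable_on UNIV \<Longrightarrow> (\<lambda>k. norm (conj_dist f k)) summable_on UNIV"
  using summable_on_reindex_bij_betw[OF bij_uminus_int, of "\<lambda>k. norm (f k)"]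
  by (simp add: norm_conj_dist)

lemma torus_fun_conj: "torus_fun (conj_dist f) x = cnj (torus_fun f x)"
proof -
  have "torus_fun (conj_dist f) x = (\<Sum>\<^sub>\<infinity>k. cnj (f (- k) * cis (real_of_int (- k) * x)))"
    by (simp add: torus_fun_def conj_dist_def cis_cnj)
  also have "\<dots> = (\<Sum>\<^sub>\<infinity>k. cnj (f k * cis (real_of_int k * x)))"
    by (rule infsum_reindex_bij_betw[OF bij_uminus_int, of "\<lambda>k. cnj (f k * cis (real_of_int k * x))"])
  also have "\<dots> = cnj (torus_fun f x)"
    unfolding torus_fun_def infsum_cnj ..
  finally show ?thesis .
qed

lemma has_integral_cis:
  fixes m :: int
  shows "((\<lambda>x. cis (real_of_int m * x)) has_integral (if m = 0 then 2 * pi else 0)) {-pi..pi}"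
proof (cases "m = 0")
  case True
  then show ?thesis using has_integral_const_real[of "1 :: complex" "-pi" pi]
    by (simp add: scaleR_conv_of_real)
next
  case False
  have "((\<lambda>x. cis (real_of_int m * x)) has_integral
      (cis (real_of_int m * pi) / (\<i> * of_int m) - cis (real_of_int m * (- pi)) / (\<i> * of_int m))) {-pi..pi}"
  proof (rule fundamental_theorem_of_calculus)
    fix x :: real assume "x \<in> {-pi..pi}"
    show "((\<lambda>x. cis (real_of_int m * x) / (\<i> * of_int m)) has_vector_derivative cis (real_of_int m * x))
        (at x within {-pi..pi})"
      using False unfolding has_vector_derivative_def
      by (auto intro!: derivative_eq_intros ext simp: scaleR_conv_of_real field_simps)
  qed simp
  moreover have "cis (real_of_int m * pi) = cis (real_of_int m * (- pi))"
    using sin_zero_iff_int2[of "real_of_int m * pi"] by (auto simp: complex_eq_iff)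
  ultimately show ?thesis using False by simp
qed

text \<open>Absolute summability makes the series converge uniformly, which permits integration term
  by term.\<close>

lemma fourier_coeff_torus_fun:
  assumes h: "(\<lambda>k. norm (h k)) summable_on UNIV"
  shows "fourier_coeff (torus_fun h) = h"
proof
  fix j
  let ?t = "\<lambda>k x. h k * cis (real_of_int k * x) * cis (- real_of_int j * x)"
  have u: "uniform_limit {-pi..pi} (\<lambda>K x. \<Sum>k\<in>K. ?t k x) (\<lambda>x. \<Sum>\<^sub>\<infinity>k. ?t k x) (finite_subsets_at_top UNIV)"
    by (rule Weierstrass_m_test_general[OF _ h]) (simp add: norm_mult)
  obtain I J where I: "\<And>K. ((\<lambda>x. \<Sum>k\<in>K. ?t k x) has_integral I K) {-pi..pi}"
    and J: "((\<lambda>x. \<Sum>\<^sub>\<infinity>k. ?t k x) has_integral J) {-pi..pi}" and lim: "(I \<longlongrightarrow> J) (finite_subsets_at_top UNIV)"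
    by (rule uniform_limit_integral[OF u]) (auto intro!: continuous_intros)
  have t: "(?t k has_integral (h k * (if k = j then 2 * pi else 0))) {-pi..pi}" for k
    using has_integral_mult_right[OF has_integral_cis[of "k - j"], of "h k"]
    by (simp add: mult.assoc cis_mult algebra_simps)
  have "I K = 2 * pi * h j" if "finite K" "j \<in> K" for K
  proof -
    have "((\<lambda>x. \<Sum>k\<in>K. ?t k x) has_integral (\<Sum>k\<in>K. h k * (if k = j then 2 * pi else 0))) {-pi..pi}"
      by (intro has_integral_sum that(1) t)
    then have "I K = (\<Sum>k\<in>K. h k * (if k = j then 2 * pi else 0))"
      using I has_integral_unique by blast
    also have "\<dots> = (\<Sum>k\<in>K. if k = j then 2 * pi * h j else 0)"
      by (intro sum.cong) auto
    finally show ?thesis using that by simp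
  qed
  then have "\<forall>\<^sub>F K in finite_subsets_at_top UNIV. I K = 2 * pi * h j"
    unfolding eventually_finite_subsets_at_top by (intro exI[of _ "{j}"]) auto
  then have "(I \<longlongrightarrow> 2 * pi * h j) (finite_subsets_at_top UNIV)"
    by (rule tendsto_eventually)
  then have "J = 2 * pi * h j"
    using lim by (intro tendsto_unique) auto
  moreover have "integral {-pi..pi} (\<lambda>x. torus_fun h x * cis (- real_of_int j * x)) = J"
    using J by (intro integral_unique) (simp add: torus_fun_def infsum_cmult_left')
  ultimately show "fourier_coeff (torus_fun h) j = h j"
    by (simp add: fourier_coeff_def)
qed

text \<open>Pointwise |u|^2 u is u u times the conjugate of u. For absolutely summable coefficients
  products become convolutions and Fourier inversion is exact, so the algebra property applies to
  the cubic term.\<close>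

lemma cubic_eq:
  assumes f: "(\<lambda>k. norm (f k)) summable_on UNIV"
  shows "cubic f = dist_mult (dist_mult f f) (conj_dist f)"
proof -
  note ff = dist_mult_abs_summable[OF f f] and cf = conj_dist_abs_summable[OF f]
  have "(\<lambda>x. (norm (torus_fun f x))\<^sup>2 *\<^sub>R torus_fun f x) = torus_fun (dist_mult (dist_mult f f) (conj_dist f))"
  proof
    fix x
    have "(norm (torus_fun f x))\<^sup>2 *\<^sub>R torus_fun f x = torus_fun f x * torus_fun f x * cnj (torus_fun f x)"
      by (simp only: scaleR_conv_of_real complex_norm_square mult_ac)
    then show "(norm (torus_fun f x))\<^sup>2 *\<^sub>R torus_fun f x = torus_fun (dist_mult (dist_mult f f) (conj_dist f)) x"
      by (simp add: torus_fun_mult[OF ff cf] torus_fun_mult[OF f f] torus_fun_conj)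
  qed
  then show ?thesis
    by (simp add: cubic_def fourier_coeff_torus_fun dist_mult_abs_summable ff cf)
qed

definition ell2_conj :: "int ell2 \<Rightarrow> int ell2" where
  "ell2_conj x = Ell2 (conj_dist (coef x))"

lemma square_summable_conj_dist: "square_summable f \<Longrightarrow> square_summable (conj_dist f)"
  using summable_on_reindex_bij_betw[OF bij_uminus_int, of "\<lambda>k. (norm (f k))\<^sup>2"]
  by (simp add: square_summable_def norm_conj_dist)

lemma coef_ell2_conj: "coef (ell2_conj x) = conj_dist (coef x)"
  by (simp add: ell2_conj_def coef_Ell2 square_summable_conj_dist)

lemma of_ell2_conj: "of_ell2 \<sigma> (ell2_conj x) = conj_dist (of_ell2 \<sigma> x)"
  by (auto simp: of_ell2_def weighted_def coef_ell2_conj conj_dist_def)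

lemma norm_ell2_conj: "norm (ell2_conj x) = norm x"
  using infsum_reindex_bij_betw[OF bij_uminus_int, of "\<lambda>k. (norm (coef x k))\<^sup>2"]
  by (simp add: norm_ell2_def coef_ell2_conj l2_norm_def norm_conj_dist)

lemma ell2_conj_diff: "ell2_conj (x - y) = ell2_conj x - ell2_conj y"
  by (rule ell2_eqI) (simp add: coef_ell2_conj conj_dist_def)

definition ell2_cubic :: "real \<Rightarrow> int ell2 \<Rightarrow> int ell2" where
  "ell2_cubic \<sigma> x = sobolev_mult \<sigma> (sobolev_mult \<sigma> x x) (ell2_conj x)"

lemma of_ell2_cubic:
  assumes \<sigma>: "\<sigma> > 1 / 2"
  shows "of_ell2 \<sigma> (ell2_cubic \<sigma> x) = cubic (of_ell2 \<sigma> x)"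
  by (simp add: ell2_cubic_def of_ell2_sobolev_mult[OF \<sigma>] of_ell2_conj cubic_eq sobolev_abs_summable[OF \<sigma>])

lemma ell2_cubic_0: "\<sigma> > 1 / 2 \<Longrightarrow> ell2_cubic \<sigma> 0 = 0"
  by (simp add: ell2_cubic_def bounded_bilinear.zero_left[OF bounded_bilinear_sobolev_mult])

lemma ell2_cubic_lipschitz:
  assumes \<sigma>: "\<sigma> > 1 / 2"
  shows "\<exists>K>0. \<forall>x y. norm x \<le> M \<longrightarrow> norm y \<le> M \<longrightarrow>
    norm (ell2_cubic \<sigma> x - ell2_cubic \<sigma> y) \<le> K * norm (x - y)"
proof -
  interpret m: bounded_bilinear "sobolev_mult \<sigma>" by (rule bounded_bilinear_sobolev_mult[OF \<sigma>])
  obtain C where C: "C > 0" "\<And>x y. norm (sobolev_mult \<sigma> x y) \<le> norm x * norm y * C"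
    using m.pos_bounded by blast
  \<comment> \<open>The maximum with 1 keeps the final Lipschitz constant positive even for M <=
    0.\<close>
  define B where "B = max M 1"
  have b: "norm (sobolev_mult \<sigma> (sobolev_mult \<sigma> u v) w) \<le> C\<^sup>2 * B\<^sup>2 * n"
    if "norm u * norm v * norm w \<le> B\<^sup>2 * n" for u v w n
  proof -
    have "norm (sobolev_mult \<sigma> (sobolev_mult \<sigma> u v) w) \<le> norm (sobolev_mult \<sigma> u v) * norm w * C" by (rule C)
    also have "\<dots> \<le> (norm u * norm v * C) * norm w * C"
      using C by (intro mult_right_mono) auto
    also have "\<dots> = C\<^sup>2 * (norm u * norm v * norm w)" by (simp add: power2_eq_square)
    also have "\<dots> \<le> C\<^sup>2 * (B\<^sup>2 * n)" using that by (intro mult_left_mono) auto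
    finally show ?thesis by (simp add: mult.assoc)
  qed
  have "norm (ell2_cubic \<sigma> x - ell2_cubic \<sigma> y) \<le> 3 * C\<^sup>2 * B\<^sup>2 * norm (x - y)"
    if "norm x \<le> M" "norm y \<le> M" for x y
  proof -
    have xy: "norm x \<le> B" "norm y \<le> B" "0 \<le> B" using that by (auto simp: B_def)
    have p: "norm a * norm b \<le> B\<^sup>2" if "norm a \<le> B" "norm b \<le> B" for a b :: "int ell2"
      unfolding power2_eq_square using that xy by (intro mult_mono) auto
    let ?m = "sobolev_mult \<sigma>"
    have "ell2_cubic \<sigma> x - ell2_cubic \<sigma> y
      = ?m (?m (x - y) x) (ell2_conj x) + ?m (?m y (x - y)) (ell2_conj x) + ?m (?m y y) (ell2_conj (x - y))"
      by (simp add: ell2_cubic_def m.diff_left m.diff_right ell2_conj_diff)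
    also have "norm \<dots> \<le> C\<^sup>2 * B\<^sup>2 * norm (x - y) + C\<^sup>2 * B\<^sup>2 * norm (x - y) + C\<^sup>2 * B\<^sup>2 * norm (x - y)"
      using mult_right_mono[OF p[of x x], of "norm (x - y)"] mult_right_mono[OF p[of y x], of "norm (x - y)"]
        mult_right_mono[OF p[of y y], of "norm (x - y)"] xy
      by (intro norm_triangle_mono b) (auto simp: norm_ell2_conj mult_ac)
    finally show ?thesis by (simp add: mult_ac)
  qed
  moreover have "3 * C\<^sup>2 * B\<^sup>2 > 0" using C by (simp add: B_def)
  ultimately show ?thesis by blast
qed

section \<open>Conjugation by the nonresonant part of the potential\<close>

text \<open>The excluded low block |k|, |l| < N is finite and harmless in the resonant kernel; on
  the remaining pairs |k| + |l| >= N makes the reciprocal divisor small.\<close>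

definition nonresonant :: "nat \<Rightarrow> int \<Rightarrow> int \<Rightarrow> bool" where
  "nonresonant N k l \<longleftrightarrow> \<bar>k\<bar> \<noteq> \<bar>l\<bar> \<and> (int N \<le> \<bar>k\<bar> \<or> int N \<le> \<bar>l\<bar>)"

definition divisor :: "nat \<Rightarrow> int \<Rightarrow> int \<Rightarrow> real" where
  "divisor N k l = (if nonresonant N k l then 1 / (real_of_int k ^ 2 - real_of_int l ^ 2) else 0)"

lemma abs_divisor_commute: "\<bar>divisor N k l\<bar> = \<bar>divisor N l k\<bar>"
  by (auto simp: divisor_def nonresonant_def abs_minus_commute)

text \<open>The power 5/4 is the one left over in \<open>divisor_bound\<close>: since a <= b there,
  a^(-1) b^(-1/4) <= a^(-5/4).\<close>

definition jap_sum :: real where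
  "jap_sum = (\<Sum>\<^sub>\<infinity>k. jap k powr (- 5 / 4))"

lemma jap_54_summable: "(\<lambda>k. jap k powr (- 5 / 4)) summable_on UNIV"
  using summable_jap[of "5 / 4"] by simp

lemma jap_sum_finite: "finite K \<Longrightarrow> (\<Sum>k\<in>K. jap k powr (- 5 / 4)) \<le> jap_sum"
  unfolding jap_sum_def by (rule finite_sum_le_infsum) (use jap_54_summable in auto)

lemma jap_sum_nonneg: "0 \<le> jap_sum"
  by (simp add: jap_sum_def infsum_nonneg)

lemma jap_le_double: "k \<noteq> 0 \<Longrightarrow> jap k / 2 \<le> \<bar>real_of_int k\<bar>"
  using jap_le[of k] by linarith

text \<open>For integers with \<open>\<bar>k\<bar> \<noteq> \<bar>l\<bar>\<close> put \<open>a = \<bar>\<bar>k\<bar> - \<bar>l\<bar>\<bar> \<ge> 1\<close> and \<open>b = \<bar>k\<bar> + \<bar>l\<bar>\<close>, so that the small divisor is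
  \<open>a b\<close>. Splitting \<open>1 / b = b\<^bsup>-1/4\<^esup> b\<^bsup>-1/2\<^esup> b\<^bsup>-1/4\<^esup>\<close> gains a negative power of the threshold \<open>N\<close>,
  half a power of \<open>k\<close>, and summability of the remaining factor.\<close>

lemma divisor_bound:
  assumes N: "1 \<le> N"
  shows "\<bar>divisor N k l\<bar> \<le> 4 * real N powr (- 1 / 4) * jap k powr (- 1 / 2) *
    (jap (k - l) powr (- 5 / 4) + jap (k + l) powr (- 5 / 4))"
proof (cases "nonresonant N k l")
  case False
  then show ?thesis by (simp add: divisor_def)
next
  case True
  define a b where "a = \<bar>\<bar>real_of_int k\<bar> - \<bar>real_of_int l\<bar>\<bar>" and "b = \<bar>real_of_int k\<bar> + \<bar>real_of_int l\<bar>"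
  have kl: "\<bar>k\<bar> \<noteq> \<bar>l\<bar>" "int N \<le> \<bar>k\<bar> \<or> int N \<le> \<bar>l\<bar>" using True by (auto simp: nonresonant_def)
  have bN: "real N \<le> b"
  proof -
    have "int N \<le> \<bar>k\<bar> + \<bar>l\<bar>" using kl by auto
    then have "real_of_int (int N) \<le> real_of_int (\<bar>k\<bar> + \<bar>l\<bar>)" by (simp only: of_int_le_iff)
    then show ?thesis by (simp add: b_def)
  qed
  have a1: "1 \<le> a"
  proof -
    have "1 \<le> \<bar>\<bar>k\<bar> - \<bar>l\<bar>\<bar>" using kl by linarith
    then have "real_of_int 1 \<le> real_of_int \<bar>\<bar>k\<bar> - \<bar>l\<bar>\<bar>" by (simp only: of_int_le_iff)
    then show ?thesis by (simp add: a_def)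
  qed
  have b1: "1 \<le> b" using bN N by simp
  have ba: "a \<le> b" by (auto simp: a_def b_def)
  have bk: "jap k / 2 \<le> b" using jap_le[of k] b1 by (auto simp: b_def)
  have eq: "\<bar>real_of_int k ^ 2 - real_of_int l ^ 2\<bar> = a * b"
  proof -
    have "a * b = \<bar>(\<bar>real_of_int k\<bar> - \<bar>real_of_int l\<bar>) * (\<bar>real_of_int k\<bar> + \<bar>real_of_int l\<bar>)\<bar>"
      by (simp add: a_def b_def abs_mult)
    also have "(\<bar>real_of_int k\<bar> - \<bar>real_of_int l\<bar>) * (\<bar>real_of_int k\<bar> + \<bar>real_of_int l\<bar>)
        = real_of_int k ^ 2 - real_of_int l ^ 2"
      by (simp add: power2_eq_square algebra_simps abs_mult_self_eq)
    finally show ?thesis ..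
  qed
  \<comment> \<open>The two factors come from b >= <k>/2 in the power -1/2 and from a >= <m>/2 in
    the power -5/4.\<close>
  have two: "2 powr (1 / 2) * 2 powr (5 / 4) \<le> (4 :: real)"
  proof -
    have "2 powr (1 / 2) * 2 powr (5 / 4) = (2 :: real) powr (7 / 4)" by (simp add: powr_add[symmetric])
    also have "\<dots> \<le> 2 powr 2" by (intro powr_mono) auto
    finally show ?thesis by simp
  qed
  have inva: "a powr (- 5 / 4) \<le> 2 powr (5 / 4) * (jap (k - l) powr (- 5 / 4) + jap (k + l) powr (- 5 / 4))"
  proof -
    have half: "a powr (- 5 / 4) \<le> 2 powr (5 / 4) * jap m powr (- 5 / 4)"
      if "a = \<bar>real_of_int m\<bar>" for m
    proof -
      have "jap m / 2 \<le> a" using that a1 jap_le_double[of m] by (cases "m = 0") auto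
      then have "a powr (- 5 / 4) \<le> (jap m / 2) powr (- 5 / 4)" by (intro powr_mono2') auto
      also have "\<dots> = 2 powr (5 / 4) * jap m powr (- 5 / 4)"
        by (simp add: powr_divide powr_minus_divide)
      finally show ?thesis .
    qed
    \<comment> \<open>Which of the two cases occurs depends on the signs of k and l; the sum of both
      profiles covers either.\<close>
    have "a = \<bar>real_of_int (k - l)\<bar> \<or> a = \<bar>real_of_int (k + l)\<bar>" unfolding a_def by auto
    then show ?thesis
    proof
      assume "a = \<bar>real_of_int (k - l)\<bar>"
      from half[OF this] show ?thesis
        by (simp add: distrib_left add_increasing2)
    next
      assume "a = \<bar>real_of_int (k + l)\<bar>"
      from half[OF this] show ?thesis
        by (simp add: distrib_left add_increasing)
    qed
  qed
  have "\<bar>divisor N k l\<bar> = inverse a * inverse b"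
    using True eq by (simp add: divisor_def divide_inverse abs_inverse)
  also have "inverse b = b powr (- 1 / 4) * b powr (- 1 / 2) * b powr (- 1 / 4)"
  proof -
    have "b powr (- 1 / 4) * b powr (- 1 / 2) * b powr (- 1 / 4) = b powr (- 1)"
      by (simp only: powr_add[symmetric]) simp
    then show ?thesis using b1 by (simp add: powr_minus)
  qed
  also have "inverse a * (b powr (- 1 / 4) * b powr (- 1 / 2) * b powr (- 1 / 4))
    \<le> inverse a * (real N powr (- 1 / 4) * (jap k / 2) powr (- 1 / 2) * a powr (- 1 / 4))"
    using a1 bN ba bk N by (intro mult_left_mono mult_mono powr_mono2') auto
  also have "\<dots> = real N powr (- 1 / 4) * (jap k / 2) powr (- 1 / 2) * (a powr (- 1) * a powr (- 1 / 4))"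
    using a1 by (simp add: powr_minus)
  also have "a powr (- 1) * a powr (- 1 / 4) = a powr (- 5 / 4)"
    by (simp only: powr_add[symmetric]) simp
  also have "(jap k / 2) powr (- 1 / 2) = 2 powr (1 / 2) * jap k powr (- 1 / 2)"
    by (simp add: powr_divide powr_minus_divide)
  also have "real N powr (- 1 / 4) * (2 powr (1 / 2) * jap k powr (- 1 / 2)) * a powr (- 5 / 4)
     \<le> real N powr (- 1 / 4) * (2 powr (1 / 2) * jap k powr (- 1 / 2)) *
       (2 powr (5 / 4) * (jap (k - l) powr (- 5 / 4) + jap (k + l) powr (- 5 / 4)))"
    by (intro mult_left_mono inva) auto
  also have "\<dots> = (2 powr (1 / 2) * 2 powr (5 / 4)) * (real N powr (- 1 / 4) * jap k powr (- 1 / 2) *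
       (jap (k - l) powr (- 5 / 4) + jap (k + l) powr (- 5 / 4)))"
    by (simp only: mult_ac)
  also have "\<dots> \<le> 4 * (real N powr (- 1 / 4) * jap k powr (- 1 / 2) *
       (jap (k - l) powr (- 5 / 4) + jap (k + l) powr (- 5 / 4)))"
    by (intro mult_right_mono two) auto
  finally show ?thesis by (simp only: mult.assoc)
qed

text \<open>A uniform bound for the row sums of \<open>divisor\<close>: 8 is the constant 4 of
  \<open>divisor_bound\<close>, taken once for the sum over <k-l> and once for that over
  <k+l>.\<close>

definition smallness :: "nat \<Rightarrow> real" where
  "smallness N = 8 * jap_sum * real N powr (- 1 / 4)"

lemma smallness_nonneg [simp]: "0 \<le> smallness N"
  by (simp add: smallness_def jap_sum_nonneg)

lemma smallness_tendsto_0: "smallness \<longlonglongrightarrow> 0"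
proof -
  have "(\<lambda>N. real N powr (- 1 / 4)) \<longlonglongrightarrow> 0"
    by (rule tendsto_neg_powr) (auto intro: filterlim_real_sequentially)
  from tendsto_mult_left[OF this, of "8 * jap_sum"] show ?thesis by (simp add: smallness_def[abs_def])
qed

lemma divisor_row_sum:
  assumes N: "1 \<le> N" and L: "finite L"
  shows "(\<Sum>l\<in>L. \<bar>divisor N k l\<bar>) \<le> smallness N * jap k powr (- 1 / 2)"
proof -
  have 1: "(\<Sum>l\<in>L. jap (k - l) powr (- 5 / 4)) \<le> jap_sum"
    using jap_sum_finite[of "(\<lambda>l. k - l) ` L"] L
    by (simp add: sum.reindex inj_on_def)
  have 2: "(\<Sum>l\<in>L. jap (k + l) powr (- 5 / 4)) \<le> jap_sum"
    using jap_sum_finite[of "(\<lambda>l. k + l) ` L"] L by (simp add: sum.reindex)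
  have "(\<Sum>l\<in>L. \<bar>divisor N k l\<bar>) \<le> (\<Sum>l\<in>L. 4 * real N powr (- 1 / 4) * jap k powr (- 1 / 2) *
    (jap (k - l) powr (- 5 / 4) + jap (k + l) powr (- 5 / 4)))"
    by (intro sum_mono divisor_bound N)
  also have "\<dots> = 4 * real N powr (- 1 / 4) * jap k powr (- 1 / 2) *
    ((\<Sum>l\<in>L. jap (k - l) powr (- 5 / 4)) + (\<Sum>l\<in>L. jap (k + l) powr (- 5 / 4)))"
    by (simp add: sum_distrib_left[symmetric] sum.distrib)
  also have "\<dots> \<le> 4 * real N powr (- 1 / 4) * jap k powr (- 1 / 2) * (jap_sum + jap_sum)"
    using 1 2 by (intro mult_left_mono add_mono) auto
  finally show ?thesis by (simp add: smallness_def mult_ac)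
qed

lemma divisor_row_sum_le:
  assumes N: "1 \<le> N" and L: "finite L"
  shows "(\<Sum>l\<in>L. \<bar>divisor N k l\<bar>) \<le> smallness N"
proof -
  have "jap k powr (- 1 / 2) \<le> 1" using powr_mono2'[of "-1/2" 1 "jap k"] jap_ge_1[of k] by simp
  then have "smallness N * jap k powr (- 1 / 2) \<le> smallness N" by (simp add: mult_left_le)
  then show ?thesis using divisor_row_sum[OF assms, of k] by linarith
qed

lemma divisor_summable: "1 \<le> N \<Longrightarrow> (\<lambda>l. \<bar>divisor N k l\<bar>) summable_on UNIV"
  using divisor_row_sum_le by (intro nonneg_bdd_above_summable_on bdd_aboveI2) auto

lemma divisor_infsum: "1 \<le> N \<Longrightarrow> (\<Sum>\<^sub>\<infinity>l. \<bar>divisor N k l\<bar>) \<le> smallness N * jap k powr (- 1 / 2)"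
  using divisor_row_sum divisor_summable by (intro infsum_le_finite_sums) auto

lemma jap_powr_comparable:
  assumes "jap k \<le> 2 * jap m" "jap m \<le> 2 * jap k"
  shows "jap k powr t \<le> 2 powr \<bar>t\<bar> * jap m powr t"
proof (cases "t \<ge> 0")
  case True
  then have "jap k powr t \<le> (2 * jap m) powr t" using assms by (intro powr_mono2) auto
  then show ?thesis using True by (simp add: powr_mult)
next
  case False
  then have "jap k powr t \<le> (jap m / 2) powr t" using assms by (intro powr_mono2') auto
  also have "\<dots> = 2 powr \<bar>t\<bar> * jap m powr t" using False by (simp add: powr_divide powr_minus_divide)
  finally show ?thesis .
qed

text \<open>The larger of <k-m> and <m-l> controls <k-l>, so one negative power is cancelled and the
  other is at most 1. Hence a weighted supremum norm survives a convolution with \<xi> as soon as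
  the divisor provides summability.\<close>

lemma jap_conv_weight:
  assumes "0 \<le> s"
  shows "jap (k - l) powr s * (jap (k - m) powr (- s) * jap (m - l) powr (- s)) \<le> 2 powr (s + 1)"
proof -
  have "jap (k - l) powr s \<le> 2 powr s * (jap (k - m) powr s + jap (m - l) powr s)"
    using jap_triangle[of "k - m" "m - l"] assms by (intro powr_triangle) auto
  then have "jap (k - l) powr s * (jap (k - m) powr (- s) * jap (m - l) powr (- s))
    \<le> 2 powr s * (jap (k - m) powr s + jap (m - l) powr s) * (jap (k - m) powr (- s) * jap (m - l) powr (- s))"
    by (intro mult_right_mono) auto
  also have "\<dots> = 2 powr s * ((jap (k - m) powr s * jap (k - m) powr (- s)) * jap (m - l) powr (- s)
     + (jap (m - l) powr s * jap (m - l) powr (- s)) * jap (k - m) powr (- s))"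
    by (simp only: algebra_simps)
  also have "\<dots> = 2 powr s * (jap (m - l) powr (- s) + jap (k - m) powr (- s))"
    by (simp only: jap_powr_cancel mult_1_left)
  also have "\<dots> \<le> 2 powr s * (1 + 1)"
    using assms powr_mono2'[of "- s" 1] jap_ge_1 by (intro mult_left_mono add_mono) auto
  finally show ?thesis by (simp add: powr_add)
qed

lemma infsum_diff:
  fixes f g :: "'a \<Rightarrow> 'b::real_normed_vector"
  assumes "f summable_on A" "g summable_on A"
  shows "(\<Sum>\<^sub>\<infinity>x\<in>A. f x - g x) = infsum f A - infsum g A"
  using infsum_add[OF assms(1) summable_on_uminus[THEN iffD2, OF assms(2)]] by (simp add: infsum_uminus)

text \<open>Contraction with factor 1/2 in the supremum norm over an index set without topology. It
  is demanded for bounded functions only, because the row series is known to converge only for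
  these; the iterates stay in the ball of radius 2 D.\<close>

lemma bounded_function_fixpoint:
  fixes T :: "('a \<Rightarrow> 'b::banach) \<Rightarrow> 'a \<Rightarrow> 'b"
  assumes T0: "\<And>x. norm (T (\<lambda>_. 0) x) \<le> D"
    and contr: "\<And>b c B x. bounded (range b) \<Longrightarrow> bounded (range c) \<Longrightarrow> (\<And>y. norm (b y - c y) \<le> B) \<Longrightarrow>
      norm (T b x - T c x) \<le> B / 2"
  obtains c where "\<And>x. T c x = c x" "\<And>x. norm (c x) \<le> 2 * D"
proof -
  define f where "f n = (T ^^ n) (\<lambda>_. 0)" for n
  have f_Suc: "f (Suc n) = T (f n)" for n by (simp add: f_def)
  have bdd: "bounded (range b)" if "\<And>x. norm (b x) \<le> 2 * D" for b :: "'a \<Rightarrow> 'b"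
    using that by (auto simp: bounded_iff)
  have D: "0 \<le> D" using T0 norm_ge_zero order_trans by blast
  have fD: "norm (f n x) \<le> 2 * D" for n x
  proof (induction n arbitrary: x)
    case 0 then show ?case using D by (simp add: f_def)
  next
    case (Suc n)
    have "norm (T (f n) x - T (\<lambda>_. 0) x) \<le> 2 * D / 2"
      by (rule contr) (use Suc bdd D in auto)
    then show ?case using T0[of x] norm_triangle_sub[of "T (f n) x" "T (\<lambda>_. 0) x"] by (simp add: f_Suc)
  qed
  have diff: "norm (f (n + k) x - f n x) \<le> 2 * D * (1 / 2) ^ n" for n k x
  proof (induction n arbitrary: x)
    case 0 then show ?case using fD[of k] by (simp add: f_def)
  next
    case (Suc n)
    have "norm (T (f (n + k)) x - T (f n) x) \<le> 2 * D * (1 / 2) ^ n / 2"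
      by (rule contr) (use Suc bdd fD in auto)
    then show ?case by (simp add: f_Suc)
  qed
  have lim0: "(\<lambda>n. 2 * D * (1 / 2) ^ n) \<longlonglongrightarrow> 0"
    by (rule tendsto_mult_right_zero) (rule LIMSEQ_power_zero, simp)
  have "Cauchy (\<lambda>n. f n x)" for x
  proof (rule CauchyI')
    fix e :: real assume "e > 0"
    then have "\<forall>\<^sub>F n in sequentially. 2 * D * (1 / 2) ^ n < e" by (rule order_tendstoD(2)[OF lim0])
    then obtain M where M: "\<And>n. n \<ge> M \<Longrightarrow> 2 * D * (1 / 2) ^ n < e" by (auto simp: eventually_sequentially)
    have "norm (f m x - f n x) < e" if "m \<ge> M" "n > m" for m n
      using diff[of m "n - m" x] M[OF that(1)] that(2) by (simp add: norm_minus_commute)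
    then show "\<exists>M. \<forall>m\<ge>M. \<forall>n>m. dist (f m x) (f n x) < e" by (auto simp: dist_norm)
  qed
  then have "\<exists>l. (\<lambda>n. f n x) \<longlonglongrightarrow> l" for x by (simp add: Cauchy_convergent_iff convergent_def)
  then obtain c where c: "\<And>x. (\<lambda>n. f n x) \<longlonglongrightarrow> c x" by metis
  have cD: "norm (c x) \<le> 2 * D" for x
    by (rule LIMSEQ_le_const2[OF tendsto_norm[OF c]]) (use fD in auto)
  have cf: "norm (c x - f n x) \<le> 2 * D * (1 / 2) ^ n" for x n
  proof (rule LIMSEQ_le_const2)
    show "(\<lambda>k. norm (f (n + k) x - f n x)) \<longlonglongrightarrow> norm (c x - f n x)"
      using LIMSEQ_ignore_initial_segment[OF c[of x], of n] by (intro tendsto_intros) (simp add: add.commute)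
  qed (use diff in auto)
  have "T c x = c x" for x
  proof (rule LIMSEQ_unique[OF _ LIMSEQ_Suc[OF c]])
    have *: "norm (f (Suc n) x - T c x) \<le> 2 * D * (1 / 2) ^ n / 2" for n
      unfolding f_Suc by (rule contr) (use cf bdd fD cD in \<open>auto simp: norm_minus_commute\<close>)
    have "(\<lambda>n. 2 * D * (1 / 2) ^ n / 2) \<longlonglongrightarrow> 0"
      using tendsto_divide[OF lim0 tendsto_const[of 2]] by simp
    then have "(\<lambda>n. f (Suc n) x - T c x) \<longlonglongrightarrow> 0"
      by (rule Lim_null_comparison[OF always_eventually[OF allI[OF *]]])
    then show "(\<lambda>n. f (Suc n) x) \<longlonglongrightarrow> T c x" by (simp add: LIM_zero_iff)
  qed
  then show ?thesis using cD that by blast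
qed

section \<open>Solving the homological equation row by row, from pointwise decay of the
  potential\<close>

locale rough_potential =
  fixes \<xi> :: torus_dist and s C :: real
  assumes s: "0 \<le> s" and C: "0 < C" and xi_bound: "\<And>k. norm (\<xi> k) \<le> C * jap k powr (- s)"
begin

lemma xi_le: "norm (\<xi> k) \<le> C"
proof -
  have "jap k powr (- s) \<le> 1" using powr_mono2'[of "- s" 1 "jap k"] s jap_ge_1[of k] by simp
  then have "C * jap k powr (- s) \<le> C" using C by (simp add: mult_left_le)
  then show ?thesis using xi_bound[of k] by linarith
qed

text \<open>Row \<open>k\<close> of the conjugating kernel is \<open>- divisor k l * a l\<close>, where \<open>a\<close> solves a linear fixed point
  equation. In terms of \<open>a l = jap (k - l) powr (- s) * c l\<close> this is a contraction in the supremum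
  norm of \<open>c\<close>.\<close>

definition row_op :: "nat \<Rightarrow> int \<Rightarrow> (int \<Rightarrow> complex) \<Rightarrow> int \<Rightarrow> complex" where
  "row_op N k c l = (\<Sum>\<^sub>\<infinity>m. of_real (divisor N k m) * (of_real (jap (k - m) powr (- s)) * c m) * \<xi> (m - l))"

lemma row_op_term:
  assumes c: "\<And>m. norm (c m) \<le> B"
  shows "jap (k - l) powr s * norm (of_real (divisor N k m) * (of_real (jap (k - m) powr (- s)) * c m) * \<xi> (m - l))
     \<le> 2 powr (s + 1) * C * B * \<bar>divisor N k m\<bar>"
proof -
  have B: "0 \<le> B" using c[of 0] norm_ge_zero order_trans by blast
  have "jap (k - l) powr s * norm (of_real (divisor N k m) * (of_real (jap (k - m) powr (- s)) * c m) * \<xi> (m - l))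
    = \<bar>divisor N k m\<bar> * (jap (k - l) powr s * (jap (k - m) powr (- s) * (norm (c m) * norm (\<xi> (m - l)))))"
    by (simp add: norm_mult)
  also have "\<dots> \<le> \<bar>divisor N k m\<bar> * (jap (k - l) powr s * (jap (k - m) powr (- s) * (B * (C * jap (m - l) powr (- s)))))"
    using B by (intro mult_left_mono mult_mono c xi_bound) auto
  also have "\<dots> = \<bar>divisor N k m\<bar> * B * C * (jap (k - l) powr s * (jap (k - m) powr (- s) * jap (m - l) powr (- s)))"
    by (simp only: mult_ac)
  also have "\<dots> \<le> \<bar>divisor N k m\<bar> * B * C * 2 powr (s + 1)"
    using B C by (intro mult_left_mono jap_conv_weight s) auto
  finally show ?thesis by (simp only: mult_ac)
qed

lemma row_op_summable:
  assumes N: "1 \<le> N" and c: "\<And>m. norm (c m) \<le> B"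
  shows "(\<lambda>m. of_real (divisor N k m) * (of_real (jap (k - m) powr (- s)) * c m) * \<xi> (m - l)) summable_on UNIV"
proof -
  have "(\<lambda>m. jap (k - l) powr s * norm (of_real (divisor N k m) * (of_real (jap (k - m) powr (- s)) * c m) * \<xi> (m - l)))
    summable_on UNIV"
    by (rule summable_on_comparison_test[OF summable_on_cmult_right[OF divisor_summable[OF N]]])
      (auto intro: row_op_term[OF c])
  then have "(\<lambda>m. norm (of_real (divisor N k m) * (of_real (jap (k - m) powr (- s)) * c m) * \<xi> (m - l)))
    summable_on UNIV"
    by (simp add: summable_on_cmult_right')
  then show ?thesis by (rule abs_summable_summable)
qed

text \<open>The factor <k>^(-1/2) of the divisor row sum is retained beyond what the contraction
  asks for: it is the gain that reappears in \<open>row_diff\<close>.\<close>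

lemma row_op_bound:
  assumes N: "1 \<le> N" and c: "\<And>m. norm (c m) \<le> B"
  shows "jap (k - l) powr s * norm (row_op N k c l)
    \<le> 2 powr (s + 1) * C * B * (smallness N * jap k powr (- 1 / 2))"
proof -
  have B: "0 \<le> B" using c[of 0] norm_ge_zero order_trans by blast
  let ?t = "\<lambda>m. of_real (jap (k - l) powr s) * (of_real (divisor N k m) * (of_real (jap (k - m) powr (- s)) * c m) * \<xi> (m - l))"
  have "jap (k - l) powr s * norm (row_op N k c l) = norm (\<Sum>\<^sub>\<infinity>m. ?t m)"
    by (simp only: row_op_def infsum_cmult_right' norm_mult norm_of_real abs_of_nonneg[OF powr_ge_zero])
  also have "\<dots> \<le> (\<Sum>\<^sub>\<infinity>m. 2 powr (s + 1) * C * B * \<bar>divisor N k m\<bar>)"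
  proof (rule norm_infsum_le)
    show "(?t has_sum (\<Sum>\<^sub>\<infinity>m. ?t m)) UNIV"
      by (intro has_sum_infsum summable_on_cmult_right row_op_summable[OF N c])
    show "((\<lambda>m. 2 powr (s + 1) * C * B * \<bar>divisor N k m\<bar>) has_sum
        (\<Sum>\<^sub>\<infinity>m. 2 powr (s + 1) * C * B * \<bar>divisor N k m\<bar>)) UNIV"
      by (intro has_sum_infsum summable_on_cmult_right divisor_summable N)
    show "norm (?t m) \<le> 2 powr (s + 1) * C * B * \<bar>divisor N k m\<bar>" for m
      using row_op_term[OF c, of k l N m] by (simp add: norm_mult)
  qed
  also have "\<dots> \<le> 2 powr (s + 1) * C * B * (smallness N * jap k powr (- 1 / 2))"
    unfolding infsum_cmult_right'
    using B C by (intro mult_left_mono divisor_infsum N) auto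
  finally show ?thesis .
qed

text \<open>The unknown \<open>a\<close> is the numerator of the kernel, defined at resonant and
  nonresonant entries alike; the sum sees only the nonresonant ones through \<open>divisor\<close>.
  The last bound says that the correction to \<xi> is better by half a power of <k>, so that for it
  a pointwise bound will replace l^2 summability.\<close>

lemma row_exists:
  assumes N: "1 \<le> N" and small: "2 powr (s + 1) * C * smallness N \<le> 1 / 2"
  shows "\<exists>a. (\<forall>l. a l = \<xi> (k - l) - (\<Sum>\<^sub>\<infinity>m. of_real (divisor N k m) * a m * \<xi> (m - l))) \<and>
    (\<forall>l. norm (a l) \<le> 2 * C * jap (k - l) powr (- s)) \<and>
    (\<forall>l. norm (a l - \<xi> (k - l)) \<le> C * jap k powr (- 1 / 2) * jap (k - l) powr (- s))"
proof -
  define T where "T c l = of_real (jap (k - l) powr s) * (\<xi> (k - l) - row_op N k c l)" for c l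
  have xi: "norm (of_real (jap (k - l) powr s) * \<xi> (k - l)) \<le> C" for l
  proof -
    have "norm (of_real (jap (k - l) powr s) * \<xi> (k - l)) = jap (k - l) powr s * norm (\<xi> (k - l))"
      by (simp add: norm_mult)
    also have "\<dots> \<le> jap (k - l) powr s * (C * jap (k - l) powr (- s))"
      by (intro mult_left_mono xi_bound) auto
    also have "\<dots> = C * (jap (k - l) powr s * jap (k - l) powr (- s))" by (simp only: mult_ac)
    finally show ?thesis by simp
  qed
  have jk: "jap k powr (- 1 / 2) \<le> 1" using powr_mono2'[of "-1/2" 1 "jap k"] jap_ge_1[of k] by simp
  have row: "jap (k - l) powr s * norm (row_op N k c l) \<le> B / 2 * jap k powr (- 1 / 2)"
    if "\<And>m. norm (c m) \<le> B" for c B l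
  proof -
    have B: "0 \<le> B" using that[of 0] norm_ge_zero order_trans by blast
    have "jap (k - l) powr s * norm (row_op N k c l)
      \<le> (2 powr (s + 1) * C * smallness N) * (B * jap k powr (- 1 / 2))"
      using row_op_bound[where c = c and B = B and k = k and l = l, OF N that] by (simp only: mult_ac)
    also have "\<dots> \<le> 1 / 2 * (B * jap k powr (- 1 / 2))"
      using B by (intro mult_right_mono small) auto
    finally show ?thesis by simp
  qed
  have row': "jap (k - l) powr s * norm (row_op N k c l) \<le> B / 2"
    if "\<And>m. norm (c m) \<le> B" for c B l
  proof -
    have B: "0 \<le> B" using that[of 0] norm_ge_zero order_trans by blast
    then have "B / 2 * jap k powr (- 1 / 2) \<le> B / 2" using jk by (intro mult_left_le) auto
    with row[OF that] show ?thesis by (meson order_trans)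
  qed
  have Tdiff: "norm (T b l - T c l) \<le> B / 2" if b: "bounded (range b)" and c: "bounded (range c)"
    and d: "\<And>m. norm (b m - c m) \<le> B" for b c B l
  proof -
    obtain Bb Bc where Bb: "\<And>m. norm (b m) \<le> Bb" and Bc: "\<And>m. norm (c m) \<le> Bc"
      using b c by (auto simp: bounded_iff)
    have "row_op N k c l - row_op N k b l = row_op N k (\<lambda>m. c m - b m) l"
      unfolding row_op_def
      by (subst infsum_diff[symmetric, OF row_op_summable[OF N Bc] row_op_summable[OF N Bb]])
        (simp only: left_diff_distrib right_diff_distrib)
    then have "T b l - T c l = of_real (jap (k - l) powr s) * row_op N k (\<lambda>m. c m - b m) l"
      unfolding T_def by (simp only: right_diff_distrib[symmetric]) (simp add: algebra_simps)
    then have "norm (T b l - T c l) = jap (k - l) powr s * norm (row_op N k (\<lambda>m. c m - b m) l)"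
      by (simp add: norm_mult)
    also have "\<dots> \<le> B / 2" using d by (intro row') (simp add: norm_minus_commute)
    finally show ?thesis .
  qed
  have "norm (T (\<lambda>_. 0) l) \<le> C" for l
    using xi[of l] by (simp add: T_def row_op_def)
  from bounded_function_fixpoint[of T, OF this Tdiff]
  obtain c where c: "\<And>l. c l = T c l" and cB: "\<And>l. norm (c l) \<le> 2 * C"
    by metis
  define a where "a l = of_real (jap (k - l) powr (- s)) * c l" for l
  have a_eq: "a l = \<xi> (k - l) - row_op N k c l" for l
    using c[of l] unfolding a_def T_def
    by (simp add: mult.assoc[symmetric] of_real_mult[symmetric] del: of_real_mult)
  have "a l = \<xi> (k - l) - (\<Sum>\<^sub>\<infinity>m. of_real (divisor N k m) * a m * \<xi> (m - l))" for l
    using a_eq[of l] by (simp add: row_op_def a_def)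
  moreover have "norm (a l) \<le> 2 * C * jap (k - l) powr (- s)" for l
    using mult_left_mono[OF cB[of l], of "jap (k - l) powr (- s)"]
    by (simp add: a_def norm_mult mult_ac)
  moreover have "norm (a l - \<xi> (k - l)) \<le> C * jap k powr (- 1 / 2) * jap (k - l) powr (- s)" for l
  proof -
    have "norm (a l - \<xi> (k - l)) = norm (row_op N k c l) * (jap (k - l) powr s * jap (k - l) powr (- s))"
      by (simp add: a_eq)
    also have "\<dots> = (jap (k - l) powr s * norm (row_op N k c l)) * jap (k - l) powr (- s)"
      by (simp only: mult_ac)
    also have "\<dots> \<le> (2 * C / 2 * jap k powr (- 1 / 2)) * jap (k - l) powr (- s)"
      by (intro mult_right_mono row cB) auto
    finally show ?thesis by simp
  qed
  ultimately show ?thesis by blast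
qed

definition row :: "nat \<Rightarrow> int \<Rightarrow> int \<Rightarrow> complex" where
  "row N k = (SOME a. (\<forall>l. a l = \<xi> (k - l) - (\<Sum>\<^sub>\<infinity>m. of_real (divisor N k m) * a m * \<xi> (m - l))) \<and>
    (\<forall>l. norm (a l) \<le> 2 * C * jap (k - l) powr (- s)) \<and>
    (\<forall>l. norm (a l - \<xi> (k - l)) \<le> C * jap k powr (- 1 / 2) * jap (k - l) powr (- s)))"

definition conj_kernel :: "nat \<Rightarrow> int \<Rightarrow> int \<Rightarrow> complex" where
  "conj_kernel N k l = - of_real (divisor N k l) * row N k l"

text \<open>The entries that cannot be divided away, moved to the right-hand side of the homological
  equation.\<close>

definition resonant_kernel :: "nat \<Rightarrow> int \<Rightarrow> int \<Rightarrow> complex" where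
  "resonant_kernel N k l = (if nonresonant N k l then 0 else - row N k l)"

end

section \<open>Estimates for the conjugating and the resonant kernel\<close>

locale conjugation = rough_potential +
  fixes N :: nat
  assumes N: "1 \<le> N" and small: "2 powr (s + 1) * C * smallness N \<le> 1 / 2"
begin

lemma row_eq: "row N k l = \<xi> (k - l) - (\<Sum>\<^sub>\<infinity>m. of_real (divisor N k m) * row N k m * \<xi> (m - l))"
  and row_bound: "norm (row N k l) \<le> 2 * C * jap (k - l) powr (- s)"
  and row_diff: "norm (row N k l - \<xi> (k - l)) \<le> C * jap k powr (- 1 / 2) * jap (k - l) powr (- s)"
  using someI_ex[OF row_exists[OF N small, of k], folded row_def] by blast+

lemma row_le: "norm (row N k l) \<le> 2 * C"
proof -
  have "jap (k - l) powr (- s) \<le> 1" using powr_mono2'[of "- s" 1 "jap (k - l)"] s jap_ge_1[of "k - l"] by simp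
  then have "2 * C * jap (k - l) powr (- s) \<le> 2 * C" using C by (simp add: mult_left_le)
  then show ?thesis using row_bound[of k l] by linarith
qed

text \<open>This is the (k,l) entry of the conjugation identity. The fixed point equation reads row
  = \<xi> + Y \<xi>; both sides therefore equal the row entry at nonresonant pairs and vanish at the
  others.\<close>

lemma conj_kernel_equation:
  "conj_kernel N k l * of_real (real_of_int l ^ 2 - real_of_int k ^ 2)
     = \<xi> (k - l) + (\<Sum>\<^sub>\<infinity>m. conj_kernel N k m * \<xi> (m - l)) + resonant_kernel N k l"
proof -
  have "(\<Sum>\<^sub>\<infinity>m. conj_kernel N k m * \<xi> (m - l)) = row N k l - \<xi> (k - l)"
    unfolding row_eq[of k l] by (simp add: conj_kernel_def infsum_uminus)
  moreover have "conj_kernel N k l * of_real (real_of_int l ^ 2 - real_of_int k ^ 2)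
    = (if nonresonant N k l then row N k l else 0)"
  proof (cases "nonresonant N k l")
    case True
    have "\<bar>k\<bar> \<noteq> \<bar>l\<bar>" using True by (simp add: nonresonant_def)
    then have "k ^ 2 \<noteq> l ^ 2" by (simp add: power2_eq_iff abs_eq_iff)
    then have "real_of_int k ^ 2 - real_of_int l ^ 2 \<noteq> 0"
      by (simp flip: of_int_power)
    then have "divisor N k l * (real_of_int l ^ 2 - real_of_int k ^ 2) = - 1"
      using True by (simp add: divisor_def field_simps)
    then have "of_real (divisor N k l) * of_real (real_of_int l ^ 2 - real_of_int k ^ 2) = (- 1 :: complex)"
      by (metis of_real_mult of_real_1 of_real_minus)
    then have "- (of_real (divisor N k l) * of_real (real_of_int l ^ 2 - real_of_int k ^ 2)) * row N k l = row N k l"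
      by simp
    moreover have "conj_kernel N k l * of_real (real_of_int l ^ 2 - real_of_int k ^ 2)
      = - (of_real (divisor N k l) * of_real (real_of_int l ^ 2 - real_of_int k ^ 2)) * row N k l"
      unfolding conj_kernel_def by algebra
    ultimately show ?thesis using True by (simp only: if_True)
  qed (simp add: conj_kernel_def divisor_def)
  ultimately show ?thesis by (simp add: resonant_kernel_def)
qed

lemma norm_conj_kernel: "norm (conj_kernel N k l) = \<bar>divisor N k l\<bar> * norm (row N k l)"
  by (simp add: conj_kernel_def norm_mult)

lemma norm_conj_kernel_le: "norm (conj_kernel N k l) \<le> 2 * C * \<bar>divisor N k l\<bar>"
  using mult_left_mono[OF row_le[of k l], of "\<bar>divisor N k l\<bar>"] by (simp add: norm_conj_kernel mult.commute)

text \<open>From |l| <= |k|/2 follows k^2 - l^2 >= (3/4) k^2, and 3 k^2 >= 1 + k^2 since k is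
  nonzero. As |k| is the larger frequency, it is the one that reaches N.\<close>

lemma divisor_far:
  assumes "2 * \<bar>l\<bar> \<le> \<bar>k\<bar>" "nonresonant N k l"
  shows "\<bar>divisor N k l\<bar> \<le> 4 * jap k powr (- 2)" "\<bar>divisor N k l\<bar> * (real_of_int k)\<^sup>2 \<le> 4 / 3" "int N \<le> \<bar>k\<bar>"
proof -
  show kN: "int N \<le> \<bar>k\<bar>" using assms by (auto simp: nonresonant_def)
  have k1: "1 \<le> (real_of_int k)\<^sup>2"
  proof -
    have "1 \<le> \<bar>k\<bar>" using kN N by linarith
    then have "1 \<le> \<bar>real_of_int k\<bar>" by (simp add: of_int_abs[symmetric] del: of_int_abs)
    then show ?thesis by (metis abs_le_square_iff abs_1 one_power2)
  qed
  have "2 * \<bar>real_of_int l\<bar> \<le> \<bar>real_of_int k\<bar>" using assms(1) by linarith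
  then have "(2 * \<bar>real_of_int l\<bar>)\<^sup>2 \<le> \<bar>real_of_int k\<bar>\<^sup>2" by (intro power_mono) auto
  then have l: "4 * (real_of_int l)\<^sup>2 \<le> (real_of_int k)\<^sup>2" by (simp add: power_mult_distrib)
  have d: "\<bar>divisor N k l\<bar> = 1 / ((real_of_int k)\<^sup>2 - (real_of_int l)\<^sup>2)"
  proof -
    have "0 \<le> (real_of_int k)\<^sup>2 - (real_of_int l)\<^sup>2" using l zero_le_power2[of "real_of_int l"] by linarith
    then show ?thesis using assms(2) by (simp add: divisor_def)
  qed
  have "\<bar>divisor N k l\<bar> \<le> 1 / (3 / 4 * (real_of_int k)\<^sup>2)"
    unfolding d using l k1 by (intro divide_left_mono mult_pos_pos) auto
  also have "\<dots> = 4 / (3 * (real_of_int k)\<^sup>2)" by simp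
  finally have *: "\<bar>divisor N k l\<bar> \<le> 4 / (3 * (real_of_int k)\<^sup>2)" .
  then have "\<bar>divisor N k l\<bar> * (real_of_int k)\<^sup>2 \<le> 4 / (3 * (real_of_int k)\<^sup>2) * (real_of_int k)\<^sup>2"
    by (intro mult_right_mono) auto
  also have "4 / (3 * (real_of_int k)\<^sup>2) * (real_of_int k)\<^sup>2 = 4 / 3" using k1 by (auto simp: field_simps)
  finally show "\<bar>divisor N k l\<bar> * (real_of_int k)\<^sup>2 \<le> 4 / 3" .
  have "4 / (3 * (real_of_int k)\<^sup>2) \<le> 4 / (jap k)\<^sup>2"
    unfolding jap_power2 by (intro divide_left_mono mult_pos_pos) (use k1 in linarith)+
  also have "\<dots> = 4 * jap k powr (- 2)" by (simp add: powr_minus_divide)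
  finally show "\<bar>divisor N k l\<bar> \<le> 4 * jap k powr (- 2)" using * by linarith
qed

text \<open>Weight of the l^1 space for the residual: it absorbs the factor k^2 of the Laplacian,
  and being summable it admits the merely bounded coefficients of \<open>\<xi> u\<close>. With N^2
  in place of 1 its total mass is at most \<open>smallness N\<close>, as the column estimate
  requires.\<close>

definition inv_weight :: "int \<Rightarrow> real" where
  "inv_weight k = 1 / ((real N)\<^sup>2 + (real_of_int k)\<^sup>2)"

lemma inv_weight_pos: "0 < inv_weight k"
  using N by (auto simp: inv_weight_def intro!: divide_pos_pos add_pos_nonneg)

lemma inv_weight_nonneg [simp]: "0 \<le> inv_weight k"
  using inv_weight_pos[of k] by simp

lemma inv_weight_le_jap: "inv_weight k \<le> real N powr (- 1 / 4) * jap k powr (- 5 / 4)"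
proof -
  define X where "X = (real N)\<^sup>2 + (real_of_int k)\<^sup>2"
  have N1: "1 \<le> (real N)\<^sup>2" using N by simp
  have X1: "1 \<le> X" "(real N)\<^sup>2 \<le> X" "(jap k)\<^sup>2 \<le> X"
    using N1 zero_le_power2[of "real_of_int k"] unfolding X_def jap_power2 by linarith+
  have "inv_weight k = X powr (- 1)" using X1 by (simp add: inv_weight_def X_def[symmetric] powr_minus_divide)
  \<comment> \<open>The split 3/8 + 5/8 produces N^(-3/4) <k>^(-5/4); the power of N is then relaxed
    to the -1/4 of \<open>smallness\<close>.\<close>
  also have "\<dots> = X powr (- 3 / 8) * X powr (- 5 / 8)" by (simp only: powr_add[symmetric]) simp
  also have "\<dots> \<le> ((real N)\<^sup>2) powr (- 3 / 8) * ((jap k)\<^sup>2) powr (- 5 / 8)"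
    using X1 N by (intro mult_mono powr_mono2') auto
  also have "((jap k)\<^sup>2) powr (- 5 / 8) = jap k powr (- 5 / 4)"
    using powr_powr[of "jap k" 2 "- 5 / 8"] by simp
  also have "((real N)\<^sup>2) powr (- 3 / 8) = real N powr (- 3 / 4)"
    using powr_powr[of "real N" 2 "- 3 / 8"] N by simp
  also have "real N powr (- 3 / 4) * jap k powr (- 5 / 4) \<le> real N powr (- 1 / 4) * jap k powr (- 5 / 4)"
    using N by (intro mult_right_mono powr_mono) auto
  finally show ?thesis .
qed

lemma inv_weight_sum: "finite K \<Longrightarrow> (\<Sum>k\<in>K. inv_weight k) \<le> smallness N"
proof -
  assume K: "finite K"
  have "(\<Sum>k\<in>K. inv_weight k) \<le> (\<Sum>k\<in>K. real N powr (- 1 / 4) * jap k powr (- 5 / 4))"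
    by (intro sum_mono inv_weight_le_jap)
  also have "\<dots> \<le> real N powr (- 1 / 4) * jap_sum"
    unfolding sum_distrib_left[symmetric] by (intro mult_left_mono jap_sum_finite K) auto
  also have "\<dots> \<le> smallness N" using jap_sum_nonneg by (simp add: smallness_def)
  finally show ?thesis .
qed

text \<open>For |l| <= 2 |k| the weights satisfy w_k <= 4 w_l and the divisor remains to be summed
  over k. For |k| < |l|/2 the divisor itself is at most 4 w_l and w_k remains to be summed. Either
  remainder sums to at most \<open>smallness N\<close>.\<close>

lemma divisor_weighted_column:
  "\<bar>divisor N k l\<bar> * inv_weight k \<le> 4 * inv_weight l * (\<bar>divisor N l k\<bar> + inv_weight k)"
proof (cases "2 * \<bar>k\<bar> \<ge> \<bar>l\<bar>")
  case True
  then have "\<bar>real_of_int l\<bar> \<le> 2 * \<bar>real_of_int k\<bar>" by linarith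
  then have "\<bar>real_of_int l\<bar>\<^sup>2 \<le> (2 * \<bar>real_of_int k\<bar>)\<^sup>2" by (intro power_mono) auto
  then have "(real_of_int l)\<^sup>2 \<le> 4 * (real_of_int k)\<^sup>2" by (simp add: power_mult_distrib)
  then have *: "(real N)\<^sup>2 + (real_of_int l)\<^sup>2 \<le> 4 * ((real N)\<^sup>2 + (real_of_int k)\<^sup>2)"
    using zero_le_power2[of "real N"] unfolding distrib_left by linarith
  have "0 < (real N)\<^sup>2 + (real_of_int l)\<^sup>2" "0 < (real N)\<^sup>2 + (real_of_int k)\<^sup>2"
    using N by (auto intro: add_pos_nonneg)
  then have "inv_weight k \<le> 4 * inv_weight l"
    unfolding inv_weight_def using * by (simp add: field_simps)
  then have "\<bar>divisor N k l\<bar> * inv_weight k \<le> \<bar>divisor N k l\<bar> * (4 * inv_weight l)"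
    by (intro mult_left_mono) auto
  also have "\<dots> \<le> 4 * inv_weight l * (\<bar>divisor N l k\<bar> + inv_weight k)"
    using inv_weight_pos[of k] inv_weight_pos[of l] by (simp add: abs_divisor_commute[of N k l] algebra_simps)
  finally show ?thesis .
next
  case False
  show ?thesis
  proof (cases "nonresonant N k l")
    case nr: True
    then have nr': "nonresonant N l k" by (auto simp: nonresonant_def)
    note far = divisor_far(2,3)[OF _ nr']
    have "int N \<le> \<bar>l\<bar>" using False by (intro far) auto
    then have "real N \<le> \<bar>real_of_int l\<bar>" by linarith
    then have "(real N)\<^sup>2 \<le> \<bar>real_of_int l\<bar>\<^sup>2" by (intro power_mono) auto
    then have le: "(real N)\<^sup>2 + (real_of_int l)\<^sup>2 \<le> 2 * (real_of_int l)\<^sup>2" by simp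
    have pos: "0 < (real N)\<^sup>2 + (real_of_int l)\<^sup>2" using N by (auto intro: add_pos_nonneg)
    have "\<bar>divisor N l k\<bar> * ((real N)\<^sup>2 + (real_of_int l)\<^sup>2) \<le> \<bar>divisor N l k\<bar> * (2 * (real_of_int l)\<^sup>2)"
      using le by (intro mult_left_mono) auto
    also have "\<dots> \<le> 4" using far(1) False by simp
    finally have "\<bar>divisor N l k\<bar> \<le> 4 * inv_weight l"
      using pos by (simp add: inv_weight_def field_simps)
    then have "\<bar>divisor N k l\<bar> * inv_weight k \<le> 4 * inv_weight l * inv_weight k"
      using inv_weight_pos[of k] by (simp add: abs_divisor_commute[of N k l] mult_right_mono)
    also have "\<dots> \<le> 4 * inv_weight l * (\<bar>divisor N l k\<bar> + inv_weight k)"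
      using inv_weight_pos[of l] by (intro mult_left_mono) auto
    finally show ?thesis .
  next
    case nr: False
    then show ?thesis using inv_weight_pos[of k] inv_weight_pos[of l] by (simp add: divisor_def)
  qed
qed

text \<open>Columns rather than rows, since these decide boundedness on l^1. The constant 16 is 2
  from the bound 2 C of the rows, 4 from \<open>divisor_weighted_column\<close>, and 2 for the two
  sums.\<close>

lemma conj_kernel_weighted_column:
  assumes "16 * C * smallness N \<le> 1 / 2" and K: "finite K"
  shows "(\<Sum>k\<in>K. inv_weight k * norm (conj_kernel N k l)) \<le> inv_weight l / 2"
proof -
  have "(\<Sum>k\<in>K. inv_weight k * norm (conj_kernel N k l))
    \<le> (\<Sum>k\<in>K. 2 * C * (4 * inv_weight l * (\<bar>divisor N l k\<bar> + inv_weight k)))"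
  proof (rule sum_mono)
    fix k
    have "inv_weight k * norm (conj_kernel N k l) \<le> inv_weight k * (2 * C * \<bar>divisor N k l\<bar>)"
      using inv_weight_pos[of k] by (intro mult_left_mono norm_conj_kernel_le) auto
    also have "\<dots> = 2 * C * (\<bar>divisor N k l\<bar> * inv_weight k)" by simp
    also have "\<dots> \<le> 2 * C * (4 * inv_weight l * (\<bar>divisor N l k\<bar> + inv_weight k))"
      using C by (intro mult_left_mono divisor_weighted_column) auto
    finally show "inv_weight k * norm (conj_kernel N k l)
       \<le> 2 * C * (4 * inv_weight l * (\<bar>divisor N l k\<bar> + inv_weight k))" .
  qed
  also have "\<dots> = 8 * C * inv_weight l * ((\<Sum>k\<in>K. \<bar>divisor N l k\<bar>) + (\<Sum>k\<in>K. inv_weight k))"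
    by (simp add: sum_distrib_left[symmetric] sum.distrib)
  also have "\<dots> \<le> 8 * C * inv_weight l * (smallness N + smallness N)"
    using C inv_weight_pos[of l] K
    by (intro mult_left_mono add_mono divisor_row_sum_le inv_weight_sum N) auto
  also have "\<dots> = (16 * C * smallness N) * inv_weight l" by simp
  also have "\<dots> \<le> 1 / 2 * inv_weight l"
    using inv_weight_pos[of l] by (intro mult_right_mono assms) auto
  finally show ?thesis by simp
qed

text \<open>The kernel lives on the two diagonals |k| = |l|, where the weights cancel, and on a
  finite block, where they are at most <N>^\<sigma>. Rows and columns thus have boundedly many
  bounded entries, and Schur's test applies.\<close>

lemma resonant_kernel_bound:
  assumes \<sigma>: "0 \<le> \<sigma>"
  shows "\<exists>B. kernel_bound B (\<lambda>k l. norm (sobolev_kernel \<sigma> (resonant_kernel N) k l))"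
proof -
  define D where "D = jap (int N) powr \<sigma> * (2 * C)"
  define A where "A k l = (if \<bar>k\<bar> = \<bar>l\<bar> \<or> \<bar>k\<bar> < int N \<and> \<bar>l\<bar> < int N then D else 0)" for k l :: int
  have D: "0 \<le> D" using C by (simp add: D_def)
  have sub: "{l \<in> L. A k l \<noteq> 0} \<subseteq> {k, - k} \<union> {- int N..int N}" for k L
    by (auto simp: A_def split: if_splits)
  define R where "R = D * card ({- int N..int N}) + D * 2"
  have row: "(\<Sum>l\<in>L. A k l) \<le> R" if L: "finite L" for k L
  proof -
    have "(\<Sum>l\<in>L. A k l) = (\<Sum>l\<in>{l \<in> L. A k l \<noteq> 0}. A k l)"
      by (rule sum.mono_neutral_right[OF L]) auto
    also have "\<dots> \<le> (\<Sum>l\<in>{k, - k} \<union> {- int N..int N}. D)"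
      by (rule order_trans[OF sum_mono sum_mono2[OF _ sub]]) (use D in \<open>auto simp: A_def\<close>)
    also have "\<dots> = D * card ({k, - k} \<union> {- int N..int N})" by simp
    also have "\<dots> \<le> D * real (card {- int N..int N} + 2)"
    proof (intro mult_left_mono D)
      have "card ({k, - k} \<union> {- int N..int N}) \<le> card {k, - k} + card {- int N..int N}" by (rule card_Un_le)
      also have "card {k, - k} \<le> 2" by (simp add: card_insert_if)
      finally show "real (card ({k, - k} \<union> {- int N..int N})) \<le> real (card {- int N..int N} + 2)" by simp
    qed
    finally show ?thesis by (simp add: R_def algebra_simps)
  qed
  have sym: "A k l = A l k" for k l by (auto simp: A_def)
  have KB: "kernel_bound R A"
  proof (rule kernel_bound_Schur)
    show "0 \<le> A k l" for k l using D by (simp add: A_def)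
    show "(\<Sum>k\<in>K. A k l) \<le> R" if "finite K" for K l using row[OF that, of l] by (simp add: sym[of _ l])
  qed (rule row)
  have le: "norm (sobolev_kernel \<sigma> (resonant_kernel N) k l) \<le> A k l" for k l
  proof (cases "nonresonant N k l")
    case True then show ?thesis using D by (simp add: resonant_kernel_def A_def)
  next
    case False
    then have kl: "\<bar>k\<bar> = \<bar>l\<bar> \<or> \<bar>k\<bar> < int N \<and> \<bar>l\<bar> < int N" by (auto simp: nonresonant_def)
    have "jap k powr \<sigma> * jap l powr (- \<sigma>) \<le> jap (int N) powr \<sigma>"
    proof (cases "\<bar>k\<bar> = \<bar>l\<bar>")
      case True
      then have "jap k = jap l" by (auto simp: abs_eq_iff)
      then show ?thesis using \<sigma> jap_ge_1[of "int N"] by (simp add: ge_one_powr_ge_zero)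
    next
      case False
      then have "jap k powr \<sigma> \<le> jap (int N) powr \<sigma>" using kl \<sigma> by (intro powr_mono2 jap_mono) auto
      moreover have "jap l powr (- \<sigma>) \<le> 1" using powr_mono2'[of "- \<sigma>" 1 "jap l"] \<sigma> jap_ge_1[of l] by simp
      ultimately have "jap k powr \<sigma> * jap l powr (- \<sigma>) \<le> jap (int N) powr \<sigma> * 1" by (intro mult_mono) auto
      then show ?thesis by simp
    qed
    then have "(jap k powr \<sigma> * jap l powr (- \<sigma>)) * norm (row N k l) \<le> D"
      unfolding D_def by (intro mult_mono row_le) auto
    then show ?thesis using False kl by (simp add: A_def resonant_kernel_def norm_mult mult_ac)
  qed
  have "kernel_bound R (\<lambda>k l. norm (sobolev_kernel \<sigma> (resonant_kernel N) k l))"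
    by (rule kernel_bound_mono[OF KB order_refl]) (intro conjI le norm_ge_zero)
  then show ?thesis by blast
qed

text \<open>Far from the diagonal (\<open>2\<bar>l\<bar> \<le> \<bar>k\<bar>\<close>) the divisor gains two derivatives, which the potential
  needs to be square summable with weight \<open>\<sigma>\<close>; elsewhere the weights are comparable and the Schur
  test applies.\<close>

definition far_profile :: "real \<Rightarrow> int \<Rightarrow> real" where
  "far_profile \<sigma> m = jap m powr (\<sigma> - 2) * (norm (\<xi> m) + C * jap m powr (- s - 1 / 2))"

text \<open>In the far region |k| and |k-l| are comparable, so powers of <k> move to the difference
  and the kernel takes convolution form. Nonresonance forces |k| >= N there, whence the cut-off N <=
  2 |k-l| that will leave only an l^2 tail. The 8 is 4 from \<open>divisor_far\<close> times 2 from
  the row bound; the near region costs 2^\<sigma> for the weights.\<close>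

lemma conj_kernel_split:
  assumes \<sigma>: "0 \<le> \<sigma>"
  shows "norm (sobolev_kernel \<sigma> (conj_kernel N) k l)
    \<le> 8 * 2 powr \<bar>\<sigma> - 2\<bar> * ((if int N \<le> 2 * \<bar>k - l\<bar> then far_profile \<sigma> (k - l) else 0) * jap l powr (- \<sigma>))
      + 2 * C * 2 powr \<sigma> * \<bar>divisor N k l\<bar>" (is "_ \<le> ?far + ?near")
proof -
  have fp: "0 \<le> far_profile \<sigma> m" for m using C by (auto simp: far_profile_def intro!: mult_nonneg_nonneg add_nonneg_nonneg)
  have far0: "0 \<le> ?far" using fp by simp
  have near0: "0 \<le> ?near" using C by simp
  have nrm: "norm (sobolev_kernel \<sigma> (conj_kernel N) k l)
      = jap k powr \<sigma> * \<bar>divisor N k l\<bar> * norm (row N k l) * jap l powr (- \<sigma>)"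
    by (simp add: norm_mult norm_conj_kernel)
  consider "\<not> nonresonant N k l" | "nonresonant N k l" "2 * \<bar>l\<bar> \<le> \<bar>k\<bar>" | "\<bar>k\<bar> < 2 * \<bar>l\<bar>" by linarith
  then show ?thesis
  proof cases
    case 1
    then have "norm (sobolev_kernel \<sigma> (conj_kernel N) k l) = 0" unfolding nrm by (simp add: divisor_def)
    then show ?thesis using far0 near0 by linarith
  next
    case 2
    note far = divisor_far[OF 2(2,1)]
    have kl: "\<bar>k\<bar> \<le> 2 * \<bar>k - l\<bar>" "\<bar>k - l\<bar> \<le> 2 * \<bar>k\<bar>" using 2(2) by arith+
    have dbl: "jap a \<le> 2 * jap b" if "\<bar>a\<bar> \<le> 2 * \<bar>b\<bar>" for a b
    proof -
      have "jap a \<le> jap (b + b)" using that by (intro jap_mono) auto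
      also have "\<dots> \<le> jap b + jap b" by (rule jap_triangle)
      finally show ?thesis by simp
    qed
    note cmp = jap_powr_comparable[OF dbl[OF kl(1)] dbl[OF kl(2)]]
    have row: "norm (row N k l) \<le> 2 * (norm (\<xi> (k - l)) + C * jap (k - l) powr (- s - 1 / 2))"
    proof -
      have "jap k powr (- 1 / 2) \<le> 2 powr (1 / 2) * jap (k - l) powr (- 1 / 2)"
        using cmp[of "- 1 / 2"] by simp
      also have "\<dots> \<le> 2 * jap (k - l) powr (- 1 / 2)"
        using powr_mono[of "1 / 2" 1 "2::real"] by (intro mult_right_mono) auto
      finally have j: "jap k powr (- 1 / 2) \<le> 2 * jap (k - l) powr (- 1 / 2)" .
      have "norm (row N k l) \<le> norm (\<xi> (k - l)) + norm (row N k l - \<xi> (k - l))"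
        by (rule norm_triangle_sub)
      also have "norm (row N k l - \<xi> (k - l)) \<le> C * jap k powr (- 1 / 2) * jap (k - l) powr (- s)"
        by (rule row_diff)
      also have "\<dots> \<le> C * (2 * jap (k - l) powr (- 1 / 2)) * jap (k - l) powr (- s)"
        using C j by (intro mult_right_mono mult_left_mono) auto
      also have "\<dots> = 2 * (C * jap (k - l) powr (- s - 1 / 2))"
        by (simp add: powr_add[symmetric] powr_diff powr_minus field_simps)
      finally have "norm (row N k l) \<le> norm (\<xi> (k - l)) + 2 * (C * jap (k - l) powr (- s - 1 / 2))" by simp
      also have "\<dots> \<le> 2 * (norm (\<xi> (k - l)) + C * jap (k - l) powr (- s - 1 / 2))"
        unfolding distrib_left by simp
      finally show ?thesis .
    qed
    have "jap k powr \<sigma> * \<bar>divisor N k l\<bar> \<le> jap k powr \<sigma> * (4 * jap k powr (- 2))"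
      by (intro mult_left_mono far) auto
    also have "\<dots> = 4 * jap k powr (\<sigma> - 2)" by (simp add: powr_diff powr_minus_divide)
    also have "\<dots> \<le> 4 * (2 powr \<bar>\<sigma> - 2\<bar> * jap (k - l) powr (\<sigma> - 2))"
      by (intro mult_left_mono cmp) auto
    finally have kd: "jap k powr \<sigma> * \<bar>divisor N k l\<bar> \<le> 4 * (2 powr \<bar>\<sigma> - 2\<bar> * jap (k - l) powr (\<sigma> - 2))" .
    have "jap k powr \<sigma> * \<bar>divisor N k l\<bar> * norm (row N k l)
      \<le> 4 * (2 powr \<bar>\<sigma> - 2\<bar> * jap (k - l) powr (\<sigma> - 2)) * (2 * (norm (\<xi> (k - l)) + C * jap (k - l) powr (- s - 1 / 2)))"
      by (rule mult_mono[OF kd row]) auto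
    also have "\<dots> = 8 * 2 powr \<bar>\<sigma> - 2\<bar> * far_profile \<sigma> (k - l)"
      by (simp add: far_profile_def)
    finally have "norm (sobolev_kernel \<sigma> (conj_kernel N) k l)
        \<le> 8 * 2 powr \<bar>\<sigma> - 2\<bar> * far_profile \<sigma> (k - l) * jap l powr (- \<sigma>)"
      unfolding nrm by (intro mult_right_mono) auto
    also have "\<dots> = ?far" using far(3) kl by simp
    finally show ?thesis using near0 by linarith
  next
    case 3
    have "jap k \<le> jap (l + l)" using 3 by (intro jap_mono) auto
    also have "\<dots> \<le> jap l + jap l" by (rule jap_triangle)
    finally have "jap k powr \<sigma> \<le> (2 * jap l) powr \<sigma>" using \<sigma> by (intro powr_mono2) auto
    then have "jap k powr \<sigma> * jap l powr (- \<sigma>) \<le> (2 powr \<sigma> * jap l powr \<sigma>) * jap l powr (- \<sigma>)"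
      by (intro mult_right_mono) (auto simp: powr_mult)
    then have "jap k powr \<sigma> * jap l powr (- \<sigma>) \<le> 2 powr \<sigma>" by (simp only: mult.assoc jap_powr_cancel mult_1_right)
    then have "(jap k powr \<sigma> * jap l powr (- \<sigma>)) * (norm (row N k l) * \<bar>divisor N k l\<bar>)
      \<le> 2 powr \<sigma> * (2 * C * \<bar>divisor N k l\<bar>)"
      by (intro mult_mono mult_right_mono row_le) auto
    then have "norm (sobolev_kernel \<sigma> (conj_kernel N) k l) \<le> ?near"
      unfolding nrm by (simp only: mult_ac)
    then show ?thesis using far0 by linarith
  qed
qed

text \<open>The far part is Hilbert-Schmidt, with the tail of the profile against <l>^(-\<sigma>);
  the near part obeys Schur's test because the modulus of the divisor is symmetric.\<close>

lemma conj_kernel_bound: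
  assumes \<sigma>: "1 / 2 < \<sigma>"
    and far: "\<And>K. finite K \<Longrightarrow> L2_set (\<lambda>m. if int N \<le> 2 * \<bar>m\<bar> then far_profile \<sigma> m else 0) K \<le> e"
    and e: "8 * 2 powr \<bar>\<sigma> - 2\<bar> * (e * embedding_const \<sigma>) + 2 * C * 2 powr \<sigma> * smallness N \<le> 1 / 2"
  shows "kernel_bound (1 / 2) (\<lambda>k l. norm (sobolev_kernel \<sigma> (conj_kernel N) k l))"
proof -
  have HS: "kernel_bound (e * embedding_const \<sigma>)
      (\<lambda>k l. (if int N \<le> 2 * \<bar>k - l\<bar> then far_profile \<sigma> (k - l) else 0) * jap l powr (- \<sigma>))"
    using kernel_bound_convolution_HS[OF far jap_L2_set_le[OF \<sigma>]] by simp
  have Sch: "kernel_bound (smallness N) (\<lambda>k l. \<bar>divisor N k l\<bar>)"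
  proof (rule kernel_bound_Schur)
    show "(\<Sum>k\<in>K. \<bar>divisor N k l\<bar>) \<le> smallness N" if "finite K" for K l
      using divisor_row_sum_le[OF N that, of l] by (simp add: abs_divisor_commute[of N _ l])
  qed (use divisor_row_sum_le[OF N] in auto)
  have "kernel_bound (8 * 2 powr \<bar>\<sigma> - 2\<bar> * (e * embedding_const \<sigma>) + 2 * C * 2 powr \<sigma> * smallness N)
    (\<lambda>k l. 8 * 2 powr \<bar>\<sigma> - 2\<bar> * ((if int N \<le> 2 * \<bar>k - l\<bar> then far_profile \<sigma> (k - l) else 0) * jap l powr (- \<sigma>))
      + 2 * C * 2 powr \<sigma> * \<bar>divisor N k l\<bar>)"
    using C by (intro kernel_bound_add kernel_bound_cmult[OF HS] kernel_bound_cmult[OF Sch]) auto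
  then show ?thesis
    by (rule kernel_bound_mono[OF _ e]) (use \<sigma> in \<open>intro conjI conj_kernel_split norm_ge_zero, simp\<close>)
qed

end

section \<open>Choice of the threshold N\<close>

lemma square_summable_tail:
  fixes f :: "int \<Rightarrow> complex"
  assumes f: "square_summable f" and e: "0 < e"
  obtains N where "\<And>M K. N \<le> M \<Longrightarrow> finite K \<Longrightarrow> L2_set (\<lambda>m. if int M \<le> 2 * \<bar>m\<bar> then norm (f m) else 0) K \<le> e"
proof -
  have summ: "(\<lambda>m. (norm (f m))\<^sup>2) summable_on UNIV" using f by (simp add: square_summable_def)
  obtain F where F: "finite F" "dist (\<Sum>m\<in>F. (norm (f m))\<^sup>2) (\<Sum>\<^sub>\<infinity>m. (norm (f m))\<^sup>2) \<le> e\<^sup>2"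
    using infsum_finite_approximation[OF summ, of "e\<^sup>2"] e by auto
  obtain B where B: "\<And>m. m \<in> F \<Longrightarrow> \<bar>m\<bar> < B"
  proof (rule that[of "Max (insert 0 (abs ` F)) + 1"])
    fix m assume "m \<in> F"
    then have "\<bar>m\<bar> \<le> Max (insert 0 (abs ` F))" using F(1) by (intro Max_ge) auto
    then show "\<bar>m\<bar> < Max (insert 0 (abs ` F)) + 1" by simp
  qed
  show ?thesis
  proof (rule that[of "nat (2 * B)"])
    fix M :: nat and K :: "int set" assume M: "nat (2 * B) \<le> M" and K: "finite K"
    let ?K = "{m \<in> K. int M \<le> 2 * \<bar>m\<bar>}"
    have disj: "F \<inter> ?K = {}" using B M by force
    have "(\<Sum>m\<in>F. (norm (f m))\<^sup>2) + (\<Sum>m\<in>?K. (norm (f m))\<^sup>2) = (\<Sum>m\<in>F \<union> ?K. (norm (f m))\<^sup>2)"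
      using F K disj by (intro sum.union_disjoint[symmetric]) auto
    also have "\<dots> \<le> (\<Sum>\<^sub>\<infinity>m. (norm (f m))\<^sup>2)"
      using F K summ by (intro finite_sum_le_infsum) auto
    finally have "(\<Sum>m\<in>?K. (norm (f m))\<^sup>2) \<le> e\<^sup>2" using F(2) by (auto simp: dist_real_def)
    also have "(\<Sum>m\<in>?K. (norm (f m))\<^sup>2) = (\<Sum>m\<in>K. (if int M \<le> 2 * \<bar>m\<bar> then norm (f m) else 0)\<^sup>2)"
      using K by (intro sum.mono_neutral_cong_left) auto
    finally show "L2_set (\<lambda>m. if int M \<le> 2 * \<bar>m\<bar> then norm (f m) else 0) K \<le> e"
      unfolding L2_set_def using e by (intro real_le_lsqrt) (auto intro: sum_nonneg)
  qed
qed

lemma (in rough_potential) conjugation_exists: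
  assumes \<sigma>: "1 / 2 < \<sigma>" "\<sigma> < s + 2" and xi_l2: "square_summable (weighted (\<sigma> - 2) \<xi>)"
  shows "\<exists>N. conjugation \<xi> s C N \<and> 16 * C * smallness N \<le> 1 / 2 \<and>
    kernel_bound (1 / 2) (\<lambda>k l. norm (sobolev_kernel \<sigma> (conj_kernel N) k l))"
proof -
  define far where "far m = jap m powr (\<sigma> - 2) * (norm (\<xi> m) + C * jap m powr (- s - 1 / 2))" for m
  have far_ss: "square_summable (\<lambda>m. of_real (far m))"
  proof -
    have 1: "square_summable (\<lambda>m. of_real (norm (weighted (\<sigma> - 2) \<xi> m)))"
      using xi_l2 by (simp add: square_summable_def)
    \<comment> \<open>Summability requires 2 (s + 5/2 - \<sigma>) > 1, that is \<sigma> < s + 2: the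
      half power gained in \<open>row_diff\<close> compensates for the merely pointwise bound on the
      correction.\<close>
    have "square_summable (\<lambda>m. of_real (jap m powr (\<sigma> - s - 5 / 2)))"
      using summable_jap[of "- (2 * (\<sigma> - s - 5 / 2))"] \<sigma> by (simp add: square_summable_def jap_powr_power2)
    then have 2: "square_summable (\<lambda>m. of_real C * of_real (jap m powr (\<sigma> - s - 5 / 2)))"
      by (rule square_summable_cmult)
    have "far m = norm (weighted (\<sigma> - 2) \<xi> m) + C * jap m powr (\<sigma> - s - 5 / 2)" for m
    proof -
      have "jap m powr (\<sigma> - 2) * jap m powr (- s - 1 / 2) = jap m powr (\<sigma> - s - 5 / 2)"
        by (simp only: powr_add[symmetric]) (simp add: algebra_simps)
      then show ?thesis by (simp add: far_def norm_weighted algebra_simps)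
    qed
    then show ?thesis using square_summable_add[OF 1 2] by simp
  qed
  have far_nonneg: "0 \<le> far m" for m
    using C by (auto simp: far_def intro!: mult_nonneg_nonneg add_nonneg_nonneg)
  \<comment> \<open>Chosen so that the far part contributes at most 1/4, leaving 1/4 for the near
    part; the summand 1 keeps the denominator positive.\<close>
  define e where "e = 1 / (32 * 2 powr \<bar>\<sigma> - 2\<bar> * (embedding_const \<sigma> + 1))"
  have ec: "0 < embedding_const \<sigma> + 1" using embedding_const_nonneg[of \<sigma>] by linarith
  have e: "0 < e" unfolding e_def using ec by (intro divide_pos_pos mult_pos_pos) auto
  have e2: "8 * 2 powr \<bar>\<sigma> - 2\<bar> * (e * embedding_const \<sigma>) \<le> 1 / 4"
  proof -
    have "8 * 2 powr \<bar>\<sigma> - 2\<bar> * (e * embedding_const \<sigma>) \<le> 8 * 2 powr \<bar>\<sigma> - 2\<bar> * (e * (embedding_const \<sigma> + 1))"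
      using e by (intro mult_left_mono) auto
    also have "\<dots> = 1 / 4"
    proof -
      have "8 * a * (1 / (32 * a * b) * b) = 1 / 4" if "a \<noteq> 0" "b \<noteq> 0" for a b :: real using that by simp
      then show ?thesis unfolding e_def using ec by simp
    qed
    finally show ?thesis .
  qed
  obtain N0 where N0: "\<And>M K. N0 \<le> M \<Longrightarrow> finite K \<Longrightarrow>
      L2_set (\<lambda>m. if int M \<le> 2 * \<bar>m\<bar> then norm (of_real (far m) :: complex) else 0) K \<le> e"
    using square_summable_tail[OF far_ss e] by blast
  have ev: "\<forall>\<^sub>F N in sequentially. c * smallness N < d" if "0 < d" for c d :: real
    using order_tendstoD(2)[OF tendsto_mult_right_zero[OF smallness_tendsto_0, of c] that] .
  have "\<forall>\<^sub>F N in sequentially. 1 \<le> N \<and> N0 \<le> N \<and> 2 powr (s + 1) * C * smallness N < 1 / 2 \<and>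
      16 * C * smallness N < 1 / 2 \<and> 2 * C * 2 powr \<sigma> * smallness N < 1 / 4"
    by (intro eventually_conj ev eventually_ge_at_top) auto
  then obtain N where hN: "1 \<le> N" "N0 \<le> N" "2 powr (s + 1) * C * smallness N \<le> 1 / 2"
      "16 * C * smallness N \<le> 1 / 2" "2 * C * 2 powr \<sigma> * smallness N \<le> 1 / 4"
    by (auto simp: eventually_sequentially)
  interpret conjugation \<xi> s C N by unfold_locales (use hN in auto)
  have "kernel_bound (1 / 2) (\<lambda>k l. norm (sobolev_kernel \<sigma> (conj_kernel N) k l))"
  proof (rule conj_kernel_bound[OF \<sigma>(1)])
    show "L2_set (\<lambda>m. if int N \<le> 2 * \<bar>m\<bar> then far_profile \<sigma> m else 0) K \<le> e" if "finite K" for K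
      using N0[OF hN(2) that] far_nonneg by (simp add: far_profile_def far_def[symmetric] cong: if_cong)
    show "8 * 2 powr \<bar>\<sigma> - 2\<bar> * (e * embedding_const \<sigma>) + 2 * C * 2 powr \<sigma> * smallness N \<le> 1 / 2"
      using e2 hN(5) by linarith
  qed
  then show ?thesis using hN(4) conjugation_axioms by blast
qed

section \<open>Phase multipliers\<close>

definition phase_op :: "('a \<Rightarrow> real) \<Rightarrow> 'a ell2 \<Rightarrow> 'a ell2" where
  "phase_op \<theta> x = Ell2 (\<lambda>k. cis (\<theta> k) * coef x k)"

lemma coef_phase_op [simp]: "coef (phase_op \<theta> x) k = cis (\<theta> k) * coef x k"
proof -
  have "square_summable (\<lambda>k. cis (\<theta> k) * coef x k)"
    using square_summable_coef[of x] by (simp add: square_summable_def norm_mult)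
  then show ?thesis by (simp add: phase_op_def coef_Ell2)
qed

lemma norm_phase_op [simp]: "norm (phase_op \<theta> x) = norm x"
  by (simp add: norm_ell2_def l2_norm_def norm_mult)

lemma phase_op_diff: "phase_op \<theta> (x - y) = phase_op \<theta> x - phase_op \<theta> y"
  by (rule ell2_eqI) (simp add: algebra_simps)

lemma phase_op_0 [simp]: "phase_op \<theta> 0 = 0"
  by (rule ell2_eqI) simp

lemma phase_op_phase_op: "phase_op \<theta> (phase_op \<eta> x) = phase_op (\<lambda>k. \<theta> k + \<eta> k) x"
  by (rule ell2_eqI) (simp add: cis_mult mult.assoc[symmetric])

lemma phase_op_id [simp]: "phase_op (\<lambda>_. 0) x = x"
  by (rule ell2_eqI) simp

text \<open>For unbounded frequencies the phases are not continuous in operator norm. For a fixed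
  vector each term is dominated by 4 |x_k|^2, and the Weierstrass test makes the sum continuous in
  time.\<close>

lemma phase_op_strongly_continuous:
  fixes a b :: "'a \<Rightarrow> real"
  shows "((\<lambda>r. phase_op (\<lambda>k. r * a k + b k) x) \<longlongrightarrow> phase_op (\<lambda>k. t * a k + b k) x) (at t within I)"
proof -
  let ?d = "\<lambda>k r. (norm (cis (r * a k + b k) * coef x k - cis (t * a k + b k) * coef x k))\<^sup>2"
  have summ: "(\<lambda>k. 4 * (norm (coef x k))\<^sup>2) summable_on UNIV"
    using square_summable_coef[of x] by (intro summable_on_cmult_right) (simp add: square_summable_def)
  have le: "norm (?d k r) \<le> 4 * (norm (coef x k))\<^sup>2" for k r
  proof -
    have "norm (cis (r * a k + b k) * coef x k - cis (t * a k + b k) * coef x k)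
      \<le> norm (coef x k) + norm (coef x k)"
      by (rule order_trans[OF norm_triangle_ineq4]) (simp add: norm_mult)
    then have "?d k r \<le> (2 * norm (coef x k))\<^sup>2" by (intro power_mono) auto
    then show ?thesis by (simp add: power_mult_distrib)
  qed
  have "uniform_limit UNIV (\<lambda>K r. \<Sum>k\<in>K. ?d k r) (\<lambda>r. \<Sum>\<^sub>\<infinity>k. ?d k r) (finite_subsets_at_top UNIV)"
    by (rule Weierstrass_m_test_general[OF le summ])
  then have "continuous_on UNIV (\<lambda>r. \<Sum>\<^sub>\<infinity>k. ?d k r)"
    by (rule uniform_limit_theorem[rotated]) (auto intro!: always_eventually continuous_intros)
  then have "((\<lambda>r. \<Sum>\<^sub>\<infinity>k. ?d k r) \<longlongrightarrow> (\<Sum>\<^sub>\<infinity>k. ?d k t)) (at t within I)"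
    using tendsto_within_subset[OF bspec[OF iffD1[OF continuous_on_def] UNIV_I] subset_UNIV] by blast
  then have "((\<lambda>r. sqrt (\<Sum>\<^sub>\<infinity>k. ?d k r)) \<longlongrightarrow> sqrt (\<Sum>\<^sub>\<infinity>k. ?d k t)) (at t within I)"
    by (rule tendsto_real_sqrt)
  then have "((\<lambda>r. norm (phase_op (\<lambda>k. r * a k + b k) x - phase_op (\<lambda>k. t * a k + b k) x)) \<longlongrightarrow> 0) (at t within I)"
    by (simp add: norm_ell2_def l2_norm_def)
  then show ?thesis by (simp only: tendsto_norm_zero_iff LIM_zero_iff)
qed

lemma continuous_on_phase_op:
  fixes a b :: "'a \<Rightarrow> real"
  assumes y: "continuous_on I y"
  shows "continuous_on I (\<lambda>r. phase_op (\<lambda>k. r * a k + b k) (y r))"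
  unfolding continuous_on_def
proof
  fix t assume t: "t \<in> I"
  have "((\<lambda>r. norm (y r - y t)) \<longlongrightarrow> 0) (at t within I)"
    using y t by (auto simp: continuous_on_def tendsto_norm_zero_iff LIM_zero_iff)
  then have "((\<lambda>r. norm (phase_op (\<lambda>k. r * a k + b k) (y r) - phase_op (\<lambda>k. r * a k + b k) (y t))) \<longlongrightarrow> 0) (at t within I)"
    by (simp only: phase_op_diff[symmetric] norm_phase_op)
  then have "((\<lambda>r. phase_op (\<lambda>k. r * a k + b k) (y r) - phase_op (\<lambda>k. r * a k + b k) (y t)) \<longlongrightarrow> 0) (at t within I)"
    by (rule tendsto_norm_zero_cancel)
  from tendsto_add[OF this phase_op_strongly_continuous[of a b "y t" t I]]
  show "((\<lambda>r. phase_op (\<lambda>k. r * a k + b k) (y r)) \<longlongrightarrow> phase_op (\<lambda>k. t * a k + b k) (y t)) (at t within I)"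
    by simp
qed

section \<open>The conjugated equation\<close>

locale nls = conjugation +
  fixes lam \<sigma> :: real
  assumes sigma: "1 / 2 < \<sigma>"
    and weighted_small: "16 * C * smallness N \<le> 1 / 2"
    and kernel_half: "kernel_bound (1 / 2) (\<lambda>k l. norm (sobolev_kernel \<sigma> (conj_kernel N) k l))"
begin

definition conj_op :: "int ell2 \<Rightarrow> int ell2" where
  "conj_op x = kernel_op (sobolev_kernel \<sigma> (conj_kernel N)) x"

definition res_op :: "int ell2 \<Rightarrow> int ell2" where
  "res_op x = kernel_op (sobolev_kernel \<sigma> (resonant_kernel N)) x"

definition gauge :: "int ell2 \<Rightarrow> int ell2" where
  "gauge x = x + conj_op x"

lemma bounded_linear_conj_op: "bounded_linear conj_op"
  unfolding conj_op_def[abs_def] by (rule bounded_linear_kernel_op[OF kernel_half])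

lemma of_ell2_conj_op: "of_ell2 \<sigma> (conj_op x) k = (\<Sum>\<^sub>\<infinity>l. conj_kernel N k l * of_ell2 \<sigma> x l)"
  unfolding conj_op_def by (rule of_ell2_kernel_op(1)[OF kernel_half])

lemma conj_kernel_abs_summable: "(\<lambda>l. norm (conj_kernel N k l * of_ell2 \<sigma> x l)) summable_on UNIV"
  by (rule of_ell2_kernel_op(2)[OF kernel_half])

lemma bounded_linear_res_op: "bounded_linear res_op"
  and of_ell2_res_op: "of_ell2 \<sigma> (res_op x) k = (\<Sum>\<^sub>\<infinity>l. resonant_kernel N k l * of_ell2 \<sigma> x l)"
  and res_kernel_abs_summable: "(\<lambda>l. norm (resonant_kernel N k l * of_ell2 \<sigma> x l)) summable_on UNIV"
proof -
  obtain B where B: "kernel_bound B (\<lambda>k l. norm (sobolev_kernel \<sigma> (resonant_kernel N) k l))"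
    using resonant_kernel_bound[of \<sigma>] sigma by auto
  show "bounded_linear res_op"
    unfolding res_op_def[abs_def] by (rule bounded_linear_kernel_op[OF B])
  show "of_ell2 \<sigma> (res_op x) k = (\<Sum>\<^sub>\<infinity>l. resonant_kernel N k l * of_ell2 \<sigma> x l)"
    unfolding res_op_def by (rule of_ell2_kernel_op(1)[OF B])
  show "(\<lambda>l. norm (resonant_kernel N k l * of_ell2 \<sigma> x l)) summable_on UNIV"
    by (rule of_ell2_kernel_op(2)[OF B])
qed

lemma norm_conj_op_le: "norm (conj_op x) \<le> norm x / 2"
  unfolding conj_op_def using norm_kernel_op_le[OF kernel_half, of x] by simp

lemma bij_gauge: "bij gauge"
  and gauge_lower: "norm (x - y) \<le> 2 * norm (gauge x - gauge y)"
  and gauge_upper: "norm (gauge x - gauge y) \<le> 2 * norm (x - y)"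
  using perturbed_identity_bij[OF bounded_linear_conj_op norm_conj_op_le]
  unfolding gauge_def[abs_def] by blast+

lemma bounded_linear_gauge: "bounded_linear gauge"
  unfolding gauge_def[abs_def] by (intro bounded_linear_add bounded_linear_ident bounded_linear_conj_op)

definition ungauge :: "int ell2 \<Rightarrow> int ell2" where
  "ungauge = inv gauge"

lemma gauge_ungauge [simp]: "gauge (ungauge v) = v"
  unfolding ungauge_def by (rule surj_f_inv_f[OF bij_is_surj[OF bij_gauge]])

lemma ungauge_gauge [simp]: "ungauge (gauge x) = x"
  unfolding ungauge_def by (rule inv_f_f[OF bij_is_inj[OF bij_gauge]])

lemma gauge_0 [simp]: "gauge 0 = 0"
  by (rule linear_0[OF bounded_linear.linear[OF bounded_linear_gauge]])

lemma ungauge_0 [simp]: "ungauge 0 = 0"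
  using ungauge_gauge[of 0] by simp

lemma ungauge_lipschitz: "norm (ungauge v - ungauge w) \<le> 2 * norm (v - w)"
  using gauge_lower[of "ungauge v" "ungauge w"] by simp

text \<open>The part of the equation for v = (1 + Y) u that remains besides the Laplacian, i v' = -
  \<partial>^2 v + \<open>reduced u\<close>; it is bounded on bounded sets of
  \<open>H^\<sigma>\<close>.\<close>

definition reduced :: "int ell2 \<Rightarrow> int ell2" where
  "reduced x = res_op x + lam *\<^sub>R gauge (ell2_cubic \<sigma> x)"

lemma reduced_0: "reduced 0 = 0"
  using linear_0[OF bounded_linear.linear[OF bounded_linear_res_op]]
  by (simp add: reduced_def ell2_cubic_0[OF sigma])

lemma reduced_lipschitz:
  "\<exists>K>0. \<forall>x y. norm x \<le> M \<longrightarrow> norm y \<le> M \<longrightarrow> norm (reduced x - reduced y) \<le> K * norm (x - y)"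
proof -
  obtain B where B: "B > 0" "\<And>x. norm (res_op x) \<le> norm x * B"
    using bounded_linear.pos_bounded[OF bounded_linear_res_op] by blast
  obtain L where L: "L > 0" "\<And>x y. norm x \<le> M \<Longrightarrow> norm y \<le> M \<Longrightarrow>
      norm (ell2_cubic \<sigma> x - ell2_cubic \<sigma> y) \<le> L * norm (x - y)"
    using ell2_cubic_lipschitz[OF sigma, of M] by blast
  interpret R: bounded_linear res_op by (rule bounded_linear_res_op)
  have "norm (reduced x - reduced y) \<le> (B + \<bar>lam\<bar> * (2 * L)) * norm (x - y)"
    if "norm x \<le> M" "norm y \<le> M" for x y
  proof -
    have "reduced x - reduced y = res_op (x - y) + lam *\<^sub>R (gauge (ell2_cubic \<sigma> x) - gauge (ell2_cubic \<sigma> y))"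
      by (simp add: reduced_def R.diff algebra_simps)
    then have "norm (reduced x - reduced y)
      \<le> norm (res_op (x - y)) + \<bar>lam\<bar> * norm (gauge (ell2_cubic \<sigma> x) - gauge (ell2_cubic \<sigma> y))"
      by (metis norm_triangle_ineq norm_scaleR)
    moreover have "norm (gauge (ell2_cubic \<sigma> x) - gauge (ell2_cubic \<sigma> y)) \<le> 2 * (L * norm (x - y))"
      using gauge_upper[of "ell2_cubic \<sigma> x" "ell2_cubic \<sigma> y"] L(2)[OF that] by linarith
    then have "\<bar>lam\<bar> * norm (gauge (ell2_cubic \<sigma> x) - gauge (ell2_cubic \<sigma> y)) \<le> \<bar>lam\<bar> * (2 * (L * norm (x - y)))"
      by (rule mult_left_mono) simp
    moreover have "(B + \<bar>lam\<bar> * (2 * L)) * norm (x - y) = norm (x - y) * B + \<bar>lam\<bar> * (2 * (L * norm (x - y)))"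
      by algebra
    ultimately show ?thesis using B(2)[of "x - y"] by linarith
  qed
  moreover have "B + \<bar>lam\<bar> * (2 * L) > 0" using B L by (intro add_pos_nonneg) auto
  ultimately show ?thesis by blast
qed

lemma continuous_on_reduced:
  assumes x: "continuous_on I x"
  shows "continuous_on I (\<lambda>t. reduced (x t))"
proof -
  have "isCont reduced y" for y
  proof -
    obtain K where K: "K > 0" "\<And>x' y'. norm x' \<le> norm y + 1 \<Longrightarrow> norm y' \<le> norm y + 1 \<Longrightarrow>
        norm (reduced x' - reduced y') \<le> K * norm (x' - y')"
      using reduced_lipschitz[of "norm y + 1"] by blast
    show ?thesis unfolding isCont_def
    proof (rule LIM_zero_cancel, rule Lim_null_comparison)
      have "\<forall>\<^sub>F z in at y. dist z y < 1" by (auto simp: eventually_at intro!: exI[of _ 1])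
      then show "\<forall>\<^sub>F z in at y. norm (reduced z - reduced y) \<le> K * norm (z - y)"
      proof eventually_elim
        case (elim z)
        then show ?case using norm_triangle_ineq2[of z y] by (intro K(2)) (auto simp: dist_norm)
      qed
      have "((\<lambda>z. K * norm (z - y)) \<longlongrightarrow> K * norm (y - y)) (at y)" by (intro tendsto_intros)
      then show "((\<lambda>z. K * norm (z - y)) \<longlongrightarrow> 0) (at y)" by simp
    qed
  qed
  then show ?thesis
    using continuous_on_compose2[OF continuous_at_imp_continuous_on x, of UNIV reduced] by simp
qed

definition freq :: "int \<Rightarrow> real" where
  "freq k = (real_of_int k)\<^sup>2"

text \<open>The interaction picture of \<open>reduced\<close>. The phase - pi/2 is the factor - i,
  and the summand 0 keeps the affine form of the phases for which continuity in time was
  shown.\<close>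

definition vector_field :: "real \<Rightarrow> int ell2 \<Rightarrow> int ell2" where
  "vector_field t z = phase_op (\<lambda>k. t * freq k + (- pi / 2))
     (reduced (ungauge (phase_op (\<lambda>k. t * - freq k + 0) z)))"

lemma continuous_on_ungauge:
  assumes "continuous_on I v"
  shows "continuous_on I (\<lambda>t. ungauge (v t))"
proof (rule continuous_on_compose2[OF _ assms])
  show "continuous_on UNIV ungauge"
  proof (rule continuous_onI)
    fix v :: "int ell2" and e :: real
    assume e: "e > 0"
    have "dist (ungauge v') (ungauge v) \<le> e" if "dist v' v < e / 2" for v'
      using ungauge_lipschitz[of v' v] that by (simp add: dist_norm)
    then show "\<exists>d>0. \<forall>x'\<in>UNIV. dist x' v < d \<longrightarrow> dist (ungauge x') (ungauge v) \<le> e"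
      using e by (intro exI[of _ "e / 2"]) simp
  qed
qed auto

sublocale banach_ode vector_field
proof
  show "continuous_on {0..} (\<lambda>t. vector_field t x)" for x
    unfolding vector_field_def
    by (intro continuous_on_phase_op continuous_on_reduced continuous_on_ungauge continuous_on_const)
  show "vector_field t 0 = 0" for t by (simp add: vector_field_def reduced_0)
  show "\<exists>K>0. \<forall>t\<ge>0. \<forall>x y. norm x \<le> M \<longrightarrow> norm y \<le> M \<longrightarrow>
      norm (vector_field t x - vector_field t y) \<le> K * norm (x - y)" for M
  proof -
    \<comment> \<open>The radius is 2 M because \<open>ungauge\<close> may double the norm.\<close>
    obtain K where K: "K > 0" "\<And>x y. norm x \<le> 2 * M \<Longrightarrow> norm y \<le> 2 * M \<Longrightarrow>
        norm (reduced x - reduced y) \<le> K * norm (x - y)"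
      using reduced_lipschitz[of "2 * M"] by blast
    have "norm (vector_field t x - vector_field t y) \<le> K * 2 * norm (x - y)"
      if "norm x \<le> M" "norm y \<le> M" for t x y
    proof -
      let ?P = "phase_op (\<lambda>k. t * - freq k + 0)"
      have U: "norm (ungauge (?P x)) \<le> 2 * M" if "norm x \<le> M" for x
      proof -
        have "norm (ungauge (?P x)) \<le> 2 * norm (?P x)"
          using ungauge_lipschitz[of "?P x" 0] by (simp only: ungauge_0 diff_zero)
        also have "norm (?P x) = norm x" by (rule norm_phase_op)
        finally show ?thesis using that by linarith
      qed
      have "norm (vector_field t x - vector_field t y)
        = norm (reduced (ungauge (?P x)) - reduced (ungauge (?P y)))"
        by (simp only: vector_field_def phase_op_diff[symmetric] norm_phase_op)
      also have "\<dots> \<le> K * norm (ungauge (?P x) - ungauge (?P y))"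
        by (rule K(2)[OF U[OF that(1)] U[OF that(2)]])
      also have "\<dots> \<le> K * (2 * norm (?P x - ?P y))"
        using K(1) by (intro mult_left_mono ungauge_lipschitz) auto
      also have "norm (?P x - ?P y) = norm (x - y)"
        by (simp only: phase_op_diff[symmetric] norm_phase_op)
      finally show ?thesis by simp
    qed
    then show ?thesis using K(1) by (intro exI[of _ "K * 2"]) auto
  qed
qed

end

section \<open>Equivalence with the conjugated equation\<close>

text \<open>Integrating factor: both sides say that \<open>y' = \<i> g - \<i> \<omega> y\<close> with \<open>y 0 = c\<close>.\<close>

lemma duhamel_iff:
  fixes y g :: "real \<Rightarrow> complex" and \<omega> :: real
  assumes y: "continuous_on {0..T} y" and g: "continuous_on {0..T} g"
  shows "(\<forall>t\<in>{0..T}. y t = cis (- t * \<omega>) * c + \<i> * integral {0..t} (\<lambda>r. cis (- (t - r) * \<omega>) * g r)) \<longleftrightarrow>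
    (\<forall>t\<in>{0..T}. y t = c + integral {0..t} (\<lambda>r. \<i> * g r - \<i> * of_real \<omega> * y r))" (is "?L \<longleftrightarrow> ?R")
proof -
  define P where "P t = integral {0..t} (\<lambda>r. cis (r * \<omega>) * g r)" for t
  have cg: "continuous_on {0..T} (\<lambda>r. cis (r * \<omega>) * g r)" by (intro continuous_intros g)
  have dP: "(P has_vector_derivative cis (r * \<omega>) * g r) (at r within {0..T})" if "r \<in> {0..T}" for r
    unfolding P_def by (rule integral_has_vector_derivative[OF cg that])
  have dcis: "((\<lambda>r. cis (a * r)) has_vector_derivative (\<i> * of_real a * cis (a * r))) (at r within S)" for a r S
    unfolding has_vector_derivative_def by (auto intro!: derivative_eq_intros ext simp: scaleR_conv_of_real)
  have split: "integral {0..t} (\<lambda>r. cis (- (t - r) * \<omega>) * g r) = cis (- t * \<omega>) * P t" for t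
  proof -
    have "cis (- (t - r) * \<omega>) * g r = cis (- t * \<omega>) * (cis (r * \<omega>) * g r)" for r
      by (simp add: cis_mult mult.assoc[symmetric]) (simp add: algebra_simps)
    then show ?thesis unfolding P_def by (simp only: integral_mult_right)
  qed
  have L: "?L \<longleftrightarrow> (\<forall>t\<in>{0..T}. y t = cis (- t * \<omega>) * (c + \<i> * P t))"
    unfolding split by (simp add: algebra_simps)
  show ?thesis
  proof
    assume ?L
    then have yP: "y t = cis (- \<omega> * t) * (c + \<i> * P t)" if "t \<in> {0..T}" for t
      using that L by (simp add: mult.commute)
    show ?R
    proof
      fix t assume t: "t \<in> {0..T}"
      have "((\<lambda>r. \<i> * g r - \<i> * of_real \<omega> * y r) has_integral (y t - y 0)) {0..t}"
      proof (rule fundamental_theorem_of_calculus)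
        fix r assume r: "r \<in> {0..t}"
        then have rT: "r \<in> {0..T}" using t by auto
        have "((\<lambda>r. cis (- \<omega> * r) * (c + \<i> * P r)) has_vector_derivative
          cis (- \<omega> * r) * (\<i> * (cis (r * \<omega>) * g r)) + \<i> * of_real (- \<omega>) * cis (- \<omega> * r) * (c + \<i> * P r)) (at r within {0..T})"
          by (intro has_vector_derivative_mult dcis) (auto intro!: derivative_eq_intros dP[OF rT])
        moreover have "cis (- \<omega> * r) * (\<i> * (cis (r * \<omega>) * g r)) + \<i> * of_real (- \<omega>) * cis (- \<omega> * r) * (c + \<i> * P r)
          = \<i> * g r - \<i> * of_real \<omega> * y r"
        proof -
          have "cis (- \<omega> * r) * cis (r * \<omega>) = 1" by (simp add: cis_mult)
          then have "cis (- \<omega> * r) * (\<i> * (cis (r * \<omega>) * g r)) = \<i> * g r"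
            by (simp add: mult.left_commute mult.assoc[symmetric])
          then show ?thesis by (simp add: yP[OF rT])
        qed
        ultimately have "((\<lambda>r. cis (- \<omega> * r) * (c + \<i> * P r)) has_vector_derivative
            \<i> * g r - \<i> * of_real \<omega> * y r) (at r within {0..T})" by simp
        then have "(y has_vector_derivative \<i> * g r - \<i> * of_real \<omega> * y r) (at r within {0..T})"
          by (rule has_vector_derivative_transform[OF rT _, rotated]) (use yP in auto)
        then show "(y has_vector_derivative \<i> * g r - \<i> * of_real \<omega> * y r) (at r within {0..t})"
          by (rule has_vector_derivative_within_subset) (use t in auto)
      qed (use t in auto)
      moreover have "y 0 = c" using yP[of 0] t by (simp add: P_def)
      ultimately show "y t = c + integral {0..t} (\<lambda>r. \<i> * g r - \<i> * of_real \<omega> * y r)"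
        by (simp add: integral_unique)
    qed
  next
    assume R: ?R
    have dy: "(y has_vector_derivative \<i> * g r - \<i> * of_real \<omega> * y r) (at r within {0..T})" if r: "r \<in> {0..T}" for r
    proof -
      have "continuous_on {0..T} (\<lambda>r. \<i> * g r - \<i> * of_real \<omega> * y r)" by (intro continuous_intros g y)
      from integral_has_vector_derivative[OF this r]
      have "((\<lambda>t. c + integral {0..t} (\<lambda>r. \<i> * g r - \<i> * of_real \<omega> * y r)) has_vector_derivative
          \<i> * g r - \<i> * of_real \<omega> * y r) (at r within {0..T})"
        by (auto intro!: derivative_eq_intros)
      then show ?thesis by (rule has_vector_derivative_transform[OF r _, rotated]) (use R in auto)
    qed
    have "y t = cis (- t * \<omega>) * (c + \<i> * P t)" if t: "t \<in> {0..T}" for t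
    proof -
      have "((\<lambda>r. \<i> * (cis (r * \<omega>) * g r)) has_integral (cis (\<omega> * t) * y t - cis (\<omega> * 0) * y 0)) {0..t}"
      proof (rule fundamental_theorem_of_calculus)
        fix r assume r: "r \<in> {0..t}"
        then have rT: "r \<in> {0..T}" using t by auto
        have "((\<lambda>r. cis (\<omega> * r) * y r) has_vector_derivative
          cis (\<omega> * r) * (\<i> * g r - \<i> * of_real \<omega> * y r) + \<i> * of_real \<omega> * cis (\<omega> * r) * y r) (at r within {0..T})"
          by (intro has_vector_derivative_mult dcis dy rT)
        then have "((\<lambda>r. cis (\<omega> * r) * y r) has_vector_derivative \<i> * (cis (r * \<omega>) * g r)) (at r within {0..T})"
          by (simp add: algebra_simps)
        then show "((\<lambda>r. cis (\<omega> * r) * y r) has_vector_derivative \<i> * (cis (r * \<omega>) * g r)) (at r within {0..t})"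
          by (rule has_vector_derivative_within_subset) (use t in auto)
      qed (use t in auto)
      moreover have "y 0 = c" using R t by auto
      ultimately have "\<i> * P t = cis (\<omega> * t) * y t - c"
        unfolding P_def by (simp add: integral_unique flip: integral_mult_right)
      then have "cis (- t * \<omega>) * (c + \<i> * P t) = (cis (- t * \<omega>) * cis (\<omega> * t)) * y t" by simp
      also have "cis (- t * \<omega>) * cis (\<omega> * t) = 1" by (simp add: cis_mult)
      finally show ?thesis by simp
    qed
    then show ?L by (intro iffD2[OF L] ballI)
  qed
qed

lemma abs_summable_product_UNIV:
  fixes f :: "'a \<Rightarrow> complex" and g :: "'b \<Rightarrow> complex"
  assumes f: "(\<lambda>l. norm (f l)) summable_on UNIV" and g: "(\<lambda>m. norm (g m)) summable_on UNIV"
  shows "(\<lambda>x. norm (f (fst x) * g (snd x))) summable_on UNIV \<times> UNIV"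
proof -
  have "(\<lambda>x. norm ((\<lambda>(l, m). f l * g m) x)) summable_on UNIV \<times> UNIV"
    by (subst Infinite_Sum.abs_summable_on_Sigma_iff)
      (auto simp: norm_mult infsum_cmult_right' abs_mult infsum_nonneg
        intro!: summable_on_cmult_left summable_on_cmult_right f g)
  then show ?thesis by (simp add: case_prod_unfold)
qed

lemma has_sum_finite_sum:
  fixes f :: "'a \<Rightarrow> 'b \<Rightarrow> real"
  assumes "finite K" "\<And>k. k \<in> K \<Longrightarrow> (f k has_sum s k) A"
  shows "((\<lambda>l. \<Sum>k\<in>K. f k l) has_sum (\<Sum>k\<in>K. s k)) A"
  using assms
proof (induction K rule: finite_induct)
  case (insert k K)
  have "((\<lambda>l. f k l + (\<Sum>k\<in>K. f k l)) has_sum (s k + (\<Sum>k\<in>K. s k))) A"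
    by (rule has_sum_add) (use insert in auto)
  then show ?case using insert.hyps by simp
qed simp

lemma
  fixes f :: "real \<Rightarrow> 'a::banach"
  assumes h: "bounded_linear h" and f: "continuous_on {0..T} f" and t: "t \<in> {0..T}"
  shows integral_bounded_linear: "h (integral {0..t} f) = integral {0..t} (\<lambda>r. h (f r))"
    "(\<lambda>r. h (f r)) integrable_on {0..t}"
proof -
  have "continuous_on {0..t} f" by (rule continuous_on_subset[OF f]) (use t in auto)
  then have i: "f integrable_on {0..t}" by (rule integrable_continuous_real)
  from integral_linear[OF i h] show "h (integral {0..t} f) = integral {0..t} (\<lambda>r. h (f r))"
    by (simp add: o_def)
  from integrable_linear[OF i h] show "(\<lambda>r. h (f r)) integrable_on {0..t}" by (simp add: o_def)
qed

section \<open>The residual of Duhamel's formula in a weighted l^1 space\<close>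

context nls
begin

text \<open>In general \<open>\<xi> u\<close> is no element of \<open>H^\<sigma>\<close>. It is
  handled one coefficient at a time, as a bounded functional of u, which suffices to exchange it
  with time integrals.\<close>

definition potential_term :: "int \<Rightarrow> int ell2 \<Rightarrow> complex" where
  "potential_term k x = dist_mult \<xi> (of_ell2 \<sigma> x) k"

lemma potential_abs_summable: "(\<lambda>l. norm (\<xi> (k - l) * of_ell2 \<sigma> x l)) summable_on UNIV"
  by (rule summable_on_comparison_test[OF summable_on_cmult_right[OF sobolev_abs_summable[OF sigma], of C]])
    (auto simp: norm_mult intro!: mult_right_mono xi_le)

lemma norm_potential_term: "norm (potential_term k x) \<le> norm x * (C * embedding_const \<sigma>)"
proof -
  have "norm (potential_term k x) \<le> (\<Sum>\<^sub>\<infinity>l. norm (\<xi> (k - l) * of_ell2 \<sigma> x l))"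
    unfolding potential_term_def dist_mult_def by (rule norm_infsum_bound[OF potential_abs_summable])
  also have "\<dots> \<le> C * (embedding_const \<sigma> * norm x)"
  proof (rule infsum_le_finite_sums[OF potential_abs_summable])
    fix K :: "int set" assume K: "finite K"
    have "(\<Sum>l\<in>K. norm (\<xi> (k - l) * of_ell2 \<sigma> x l)) \<le> (\<Sum>l\<in>K. C * norm (of_ell2 \<sigma> x l))"
      by (intro sum_mono) (auto simp: norm_mult intro!: mult_right_mono xi_le)
    also have "\<dots> \<le> C * (embedding_const \<sigma> * norm x)"
      unfolding sum_distrib_left[symmetric] using C by (intro mult_left_mono sobolev_finite_sum[OF sigma K]) auto
    finally show "(\<Sum>l\<in>K. norm (\<xi> (k - l) * of_ell2 \<sigma> x l)) \<le> C * (embedding_const \<sigma> * norm x)" .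
  qed
  finally show ?thesis by (simp add: mult_ac)
qed

lemma bounded_linear_potential_term: "bounded_linear (potential_term k)"
proof (rule bounded_linear_intro[of _ "C * embedding_const \<sigma>"])
  note summ = abs_summable_summable[OF potential_abs_summable]
  show "potential_term k (x + y) = potential_term k x + potential_term k y" for x y
    by (simp add: potential_term_def dist_mult_def of_ell2_add distrib_left infsum_add summ)
  show "potential_term k (r *\<^sub>R x) = r *\<^sub>R potential_term k x" for r x
    by (simp add: potential_term_def dist_mult_def of_ell2_scaleR infsum_scaleR_right)
qed (rule norm_potential_term)

definition weighted_summable :: "(int \<Rightarrow> complex) \<Rightarrow> bool" where
  "weighted_summable \<rho> \<longleftrightarrow> (\<lambda>l. inv_weight l * norm (\<rho> l)) summable_on UNIV"

text \<open>The operator 1 + Y on bare sequences; it extends \<open>gauge\<close> to the weighted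
  l^1 space.\<close>

definition raw_gauge :: "(int \<Rightarrow> complex) \<Rightarrow> int \<Rightarrow> complex" where
  "raw_gauge \<rho> k = \<rho> k + (\<Sum>\<^sub>\<infinity>l. conj_kernel N k l * \<rho> l)"

lemma of_ell2_gauge: "of_ell2 \<sigma> (gauge x) k = raw_gauge (of_ell2 \<sigma> x) k"
  by (simp add: gauge_def of_ell2_add of_ell2_conj_op raw_gauge_def)

text \<open>The one-entry case of the column estimate; read along a row, it makes the row sums
  against weighted l^1 sequences converge.\<close>

lemma conj_kernel_le_inv_weight: "norm (conj_kernel N k l) \<le> 1 / (2 * inv_weight k) * inv_weight l"
  using conj_kernel_weighted_column[OF weighted_small, of "{k}" l] inv_weight_pos[of k]
  by (simp add: field_simps)

lemma weighted_summable_kernel: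
  assumes "weighted_summable \<rho>"
  shows "(\<lambda>l. norm (conj_kernel N k l * \<rho> l)) summable_on UNIV"
proof (rule summable_on_comparison_test)
  show "(\<lambda>l. 1 / (2 * inv_weight k) * (inv_weight l * norm (\<rho> l))) summable_on UNIV"
    using assms by (intro summable_on_cmult_right) (simp add: weighted_summable_def)
  show "norm (conj_kernel N k l * \<rho> l) \<le> 1 / (2 * inv_weight k) * (inv_weight l * norm (\<rho> l))" for l
    using mult_right_mono[OF conj_kernel_le_inv_weight[of k l], of "norm (\<rho> l)"] by (simp add: norm_mult mult.assoc)
qed auto

lemma weighted_summable_add:
  assumes "weighted_summable f" "weighted_summable g"
  shows "weighted_summable (\<lambda>l. f l + g l)"
  unfolding weighted_summable_def
proof (rule summable_on_comparison_test)
  show "(\<lambda>l. inv_weight l * norm (f l) + inv_weight l * norm (g l)) summable_on UNIV"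
    using assms by (intro summable_on_add) (auto simp: weighted_summable_def)
  show "inv_weight l * norm (f l + g l) \<le> inv_weight l * norm (f l) + inv_weight l * norm (g l)" for l
    unfolding distrib_left[symmetric]
    using inv_weight_pos[of l] by (intro mult_left_mono norm_triangle_ineq) auto
qed auto

lemma weighted_summable_cmult: "weighted_summable f \<Longrightarrow> weighted_summable (\<lambda>l. c * f l)"
  unfolding weighted_summable_def norm_mult
  using summable_on_cmult_right[of "\<lambda>l. inv_weight l * norm (f l)" UNIV "norm c"] by (simp add: mult_ac)

lemma raw_gauge_add:
  assumes "weighted_summable f" "weighted_summable g"
  shows "raw_gauge (\<lambda>l. f l + g l) k = raw_gauge f k + raw_gauge g k"
  using abs_summable_summable[OF weighted_summable_kernel[OF assms(1)]]
    abs_summable_summable[OF weighted_summable_kernel[OF assms(2)]]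
  by (simp add: raw_gauge_def distrib_left infsum_add)

lemma raw_gauge_cmult: "raw_gauge (\<lambda>l. c * f l) k = c * raw_gauge f k"
proof -
  have "(\<Sum>\<^sub>\<infinity>l. conj_kernel N k l * (c * f l)) = (\<Sum>\<^sub>\<infinity>l. c * (conj_kernel N k l * f l))"
    by (simp only: mult.left_commute)
  then show ?thesis by (simp add: raw_gauge_def infsum_cmult_right' distrib_left)
qed

text \<open>The kernel contracts the \<open>inv_weight\<close>-weighted \<open>l\<^sup>1\<close> norm, so \<open>raw_gauge\<close> is injective on sequences
  of at most quadratic growth relative to \<open>l\<^sup>1\<close>; the residual of Duhamel's formula is of this kind.\<close>

lemma raw_gauge_inj:
  assumes \<rho>: "weighted_summable \<rho>" and 0: "\<And>k. raw_gauge \<rho> k = 0"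
  shows "\<rho> k = 0"
proof -
  let ?S = "\<Sum>\<^sub>\<infinity>l. inv_weight l * norm (\<rho> l)"
  have summ: "(\<lambda>l. inv_weight l * norm (\<rho> l)) summable_on UNIV" using \<rho> by (simp add: weighted_summable_def)
  have w0: "0 \<le> inv_weight l" for l using inv_weight_pos[of l] by simp
  have "?S \<le> 1 / 2 * ?S"
  proof (rule infsum_le_finite_sums[OF summ])
    fix K :: "int set" assume K: "finite K"
    have col: "((\<lambda>l. \<Sum>k\<in>K. inv_weight k * norm (conj_kernel N k l * \<rho> l)) has_sum
        (\<Sum>k\<in>K. \<Sum>\<^sub>\<infinity>l. inv_weight k * norm (conj_kernel N k l * \<rho> l))) UNIV"
      by (intro has_sum_finite_sum K has_sum_infsum summable_on_cmult_right weighted_summable_kernel \<rho>)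
    have "(\<Sum>k\<in>K. inv_weight k * norm (\<rho> k)) \<le> (\<Sum>k\<in>K. \<Sum>\<^sub>\<infinity>l. inv_weight k * norm (conj_kernel N k l * \<rho> l))"
    proof (rule sum_mono)
      fix k
      have "\<rho> k = - (\<Sum>\<^sub>\<infinity>l. conj_kernel N k l * \<rho> l)"
        using 0[of k] by (simp add: raw_gauge_def eq_neg_iff_add_eq_0)
      then have "norm (\<rho> k) \<le> (\<Sum>\<^sub>\<infinity>l. norm (conj_kernel N k l * \<rho> l))"
        using norm_infsum_bound[OF weighted_summable_kernel[OF \<rho>], of k] by simp
      then show "inv_weight k * norm (\<rho> k) \<le> (\<Sum>\<^sub>\<infinity>l. inv_weight k * norm (conj_kernel N k l * \<rho> l))"
        unfolding infsum_cmult_right' using w0 by (intro mult_left_mono) auto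
    qed
    also have "\<dots> = (\<Sum>\<^sub>\<infinity>l. \<Sum>k\<in>K. inv_weight k * norm (conj_kernel N k l * \<rho> l))"
      using col by (simp add: infsumI)
    also have "\<dots> \<le> (\<Sum>\<^sub>\<infinity>l. 1 / 2 * (inv_weight l * norm (\<rho> l)))"
    proof (rule infsum_mono)
      show "(\<lambda>l. \<Sum>k\<in>K. inv_weight k * norm (conj_kernel N k l * \<rho> l)) summable_on UNIV"
        by (rule has_sum_imp_summable[OF col])
      show "(\<lambda>l. 1 / 2 * (inv_weight l * norm (\<rho> l))) summable_on UNIV"
        by (intro summable_on_cmult_right summ)
      fix l
      have "(\<Sum>k\<in>K. inv_weight k * norm (conj_kernel N k l * \<rho> l))
        = (\<Sum>k\<in>K. inv_weight k * norm (conj_kernel N k l)) * norm (\<rho> l)"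
        by (simp add: sum_distrib_right norm_mult mult.assoc)
      also have "\<dots> \<le> inv_weight l / 2 * norm (\<rho> l)"
        by (intro mult_right_mono conj_kernel_weighted_column weighted_small K) auto
      finally show "(\<Sum>k\<in>K. inv_weight k * norm (conj_kernel N k l * \<rho> l)) \<le> 1 / 2 * (inv_weight l * norm (\<rho> l))"
        by simp
    qed
    also have "\<dots> = 1 / 2 * ?S" by (rule infsum_cmult_right')
    finally show "(\<Sum>k\<in>K. inv_weight k * norm (\<rho> k)) \<le> 1 / 2 * ?S" .
  qed
  then have "?S \<le> 0" by simp
  then have "inv_weight k * norm (\<rho> k) = 0"
    by (rule nonneg_infsum_le_0D[OF _ summ]) (use w0 in auto)
  then show ?thesis using inv_weight_pos[of k] by simp
qed

lemma weighted_summable_of_ell2: "weighted_summable (of_ell2 \<sigma> x)"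
  unfolding weighted_summable_def
proof (rule summable_on_comparison_test[OF sobolev_abs_summable[OF sigma]])
  have "1 \<le> (real N)\<^sup>2" using N by simp
  then have "inv_weight k \<le> 1" for k
    unfolding inv_weight_def using zero_le_power2[of "real_of_int k"] by (subst divide_le_eq_1_pos) linarith+
  then show "inv_weight k * norm (of_ell2 \<sigma> x k) \<le> norm (of_ell2 \<sigma> x k)" for k
    by (simp add: mult_left_le_one_le inv_weight_pos less_imp_le)
qed auto

lemma weighted_summable_freq: "weighted_summable (\<lambda>l. of_real (freq l) * of_ell2 \<sigma> x l)"
  unfolding weighted_summable_def
proof (rule summable_on_comparison_test[OF sobolev_abs_summable[OF sigma]])
  fix k
  have pos: "0 < (real N)\<^sup>2 + (real_of_int k)\<^sup>2" using N by (auto intro: add_pos_nonneg)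
  have "inv_weight k * freq k \<le> 1"
    using pos by (simp add: inv_weight_def freq_def)
  then have "(inv_weight k * freq k) * norm (of_ell2 \<sigma> x k) \<le> 1 * norm (of_ell2 \<sigma> x k)"
    by (rule mult_right_mono) simp
  then show "inv_weight k * norm (of_real (freq k) * of_ell2 \<sigma> x k) \<le> norm (of_ell2 \<sigma> x k)"
    by (simp add: norm_mult norm_power freq_def mult.assoc)
qed auto

text \<open>The coefficients of \<open>\<xi> u\<close> are controlled only in supremum norm;
  summability comes from the weight.\<close>

lemma weighted_summable_potential: "weighted_summable (\<lambda>l. potential_term l x)"
  unfolding weighted_summable_def
proof (rule summable_on_comparison_test)
  have "inv_weight summable_on UNIV"
  proof (rule nonneg_bdd_above_summable_on)
    show "bdd_above (sum inv_weight ` {K. K \<subseteq> UNIV \<and> finite K})"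
      by (rule bdd_aboveI2[of _ _ "smallness N"]) (use inv_weight_sum in auto)
  qed auto
  then show "(\<lambda>l. inv_weight l * (norm x * (C * embedding_const \<sigma>))) summable_on UNIV"
    by (rule summable_on_cmult_left)
  show "inv_weight l * norm (potential_term l x) \<le> inv_weight l * (norm x * (C * embedding_const \<sigma>))" for l
    using inv_weight_pos[of l] by (intro mult_left_mono norm_potential_term) auto
qed auto

lemma conj_kernel_row_summable: "(\<lambda>l. norm (conj_kernel N k l)) summable_on UNIV"
  by (rule summable_on_comparison_test[OF summable_on_cmult_right[OF divisor_summable[OF N], of "2 * C"]])
    (auto intro: norm_conj_kernel_le)

text \<open>The operator identity \<open>(1 + Y) (- \<partial>\<^sub>x\<^sup>2 - \<xi>) = - \<partial>\<^sub>x\<^sup>2 (1 + Y) + R\<close>, applied to an element of \<open>H\<^sup>\<sigma>\<close>.\<close>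

lemma gauge_intertwines:
  "raw_gauge (\<lambda>l. of_real (freq l) * of_ell2 \<sigma> x l - potential_term l x) k
    = of_real (freq k) * of_ell2 \<sigma> (gauge x) k + of_ell2 \<sigma> (res_op x) k"
proof -
  let ?u = "of_ell2 \<sigma> x" and ?Y = "conj_kernel N k" and ?R = "resonant_kernel N k"
  have s1: "(\<lambda>m. ?Y m * ?u m) summable_on UNIV"
    by (rule abs_summable_summable[OF conj_kernel_abs_summable])
  have s2: "(\<lambda>m. ?Y m * (of_real (freq m) * ?u m)) summable_on UNIV"
    by (rule abs_summable_summable[OF weighted_summable_kernel[OF weighted_summable_freq]])
  have s3: "(\<lambda>m. ?Y m * potential_term m x) summable_on UNIV"
    by (rule abs_summable_summable[OF weighted_summable_kernel[OF weighted_summable_potential]])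
  have s4: "(\<lambda>m. ?R m * ?u m) summable_on UNIV"
    by (rule abs_summable_summable[OF res_kernel_abs_summable])
  have s5: "(\<lambda>m. \<xi> (k - m) * ?u m) summable_on UNIV"
    by (rule abs_summable_summable[OF potential_abs_summable])
  \<comment> \<open>Fubini for Y \<xi> u: the row of Y and the coefficients of u are in l^1, and
    \<xi> is bounded.\<close>
  have "(\<lambda>x. norm (case x of (l, m) \<Rightarrow> ?Y l * (\<xi> (l - m) * ?u m))) summable_on UNIV \<times> UNIV"
  proof (rule summable_on_comparison_test)
    show "(\<lambda>x. C * norm (?Y (fst x) * ?u (snd x))) summable_on UNIV \<times> UNIV"
      by (intro summable_on_cmult_right abs_summable_product_UNIV conj_kernel_row_summable sobolev_abs_summable sigma)
    fix x :: "int \<times> int"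
    obtain l m where [simp]: "x = (l, m)" by (cases x)
    have "norm (?Y l) * (norm (\<xi> (l - m)) * norm (?u m)) \<le> norm (?Y l) * (C * norm (?u m))"
      by (intro mult_left_mono mult_right_mono xi_le) auto
    then show "norm (case x of (l, m) \<Rightarrow> ?Y l * (\<xi> (l - m) * ?u m)) \<le> C * norm (?Y (fst x) * ?u (snd x))"
      by (simp add: norm_mult mult_ac)
  qed auto
  then have "(\<lambda>(l, m). ?Y l * (\<xi> (l - m) * ?u m)) summable_on UNIV \<times> UNIV"
    by (rule abs_summable_summable)
  then have "(\<Sum>\<^sub>\<infinity>l. \<Sum>\<^sub>\<infinity>m. ?Y l * (\<xi> (l - m) * ?u m)) = (\<Sum>\<^sub>\<infinity>m. \<Sum>\<^sub>\<infinity>l. ?Y l * (\<xi> (l - m) * ?u m))"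
    by (rule infsum_swap_banach)
  also have "(\<Sum>\<^sub>\<infinity>l. \<Sum>\<^sub>\<infinity>m. ?Y l * (\<xi> (l - m) * ?u m)) = (\<Sum>\<^sub>\<infinity>l. ?Y l * potential_term l x)"
    by (simp add: potential_term_def dist_mult_def infsum_cmult_right')
  also have "(\<Sum>\<^sub>\<infinity>m. \<Sum>\<^sub>\<infinity>l. ?Y l * (\<xi> (l - m) * ?u m))
    = (\<Sum>\<^sub>\<infinity>m. ?Y m * (of_real (freq m) * ?u m) - of_real (freq k) * (?Y m * ?u m) - \<xi> (k - m) * ?u m - ?R m * ?u m)"
  proof (rule infsum_cong)
    fix m
    have "(\<Sum>\<^sub>\<infinity>l. ?Y l * (\<xi> (l - m) * ?u m)) = (\<Sum>\<^sub>\<infinity>l. ?Y l * \<xi> (l - m)) * ?u m"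
      by (simp add: mult.assoc flip: infsum_cmult_left')
    \<comment> \<open>After the exchange the inner sum is an entry of Y \<xi>, where the homological
      equation can be inserted.\<close>
    also have "(\<Sum>\<^sub>\<infinity>l. ?Y l * \<xi> (l - m)) = ?Y m * (of_real (freq m) - of_real (freq k)) - \<xi> (k - m) - ?R m"
      using conj_kernel_equation[of k m] by (simp add: freq_def algebra_simps)
    finally show "(\<Sum>\<^sub>\<infinity>l. ?Y l * (\<xi> (l - m) * ?u m))
      = ?Y m * (of_real (freq m) * ?u m) - of_real (freq k) * (?Y m * ?u m) - \<xi> (k - m) * ?u m - ?R m * ?u m"
      by (simp add: algebra_simps)
  qed
  also have "\<dots> = (\<Sum>\<^sub>\<infinity>m. ?Y m * (of_real (freq m) * ?u m)) - of_real (freq k) * (\<Sum>\<^sub>\<infinity>m. ?Y m * ?u m)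
      - potential_term k x - (\<Sum>\<^sub>\<infinity>m. ?R m * ?u m)"
    unfolding potential_term_def dist_mult_def infsum_cmult_right'[symmetric]
  proof -
    have diff: "(\<lambda>m. f m - g m) summable_on UNIV" if "f summable_on UNIV" "g summable_on UNIV" for f g :: "int \<Rightarrow> complex"
      using summable_on_add[OF that(1) summable_on_uminus[THEN iffD2, OF that(2)]] by simp
    note s1' = summable_on_cmult_right[OF s1, of "of_real (freq k)"]
    show "(\<Sum>\<^sub>\<infinity>m. ?Y m * (of_real (freq m) * ?u m) - of_real (freq k) * (?Y m * ?u m) - \<xi> (k - m) * ?u m - ?R m * ?u m)
      = (\<Sum>\<^sub>\<infinity>m. ?Y m * (of_real (freq m) * ?u m)) - (\<Sum>\<^sub>\<infinity>m. of_real (freq k) * (?Y m * ?u m))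
        - (\<Sum>\<^sub>\<infinity>m. \<xi> (k - m) * ?u m) - (\<Sum>\<^sub>\<infinity>m. ?R m * ?u m)"
      by (simp only: infsum_diff[OF diff[OF diff[OF s2 s1'] s5] s4] infsum_diff[OF diff[OF s2 s1'] s5] infsum_diff[OF s2 s1'])
  qed
  finally have *: "(\<Sum>\<^sub>\<infinity>l. ?Y l * potential_term l x) = (\<Sum>\<^sub>\<infinity>m. ?Y m * (of_real (freq m) * ?u m))
      - of_real (freq k) * (\<Sum>\<^sub>\<infinity>m. ?Y m * ?u m) - potential_term k x - (\<Sum>\<^sub>\<infinity>m. ?R m * ?u m)" .
  have "raw_gauge (\<lambda>l. of_real (freq l) * ?u l - potential_term l x) k
    = of_real (freq k) * ?u k - potential_term k x
      + ((\<Sum>\<^sub>\<infinity>m. ?Y m * (of_real (freq m) * ?u m)) - (\<Sum>\<^sub>\<infinity>l. ?Y l * potential_term l x))"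
    unfolding raw_gauge_def right_diff_distrib by (subst infsum_diff[OF s2 s3]) simp
  then show ?thesis unfolding * of_ell2_gauge of_ell2_res_op raw_gauge_def by (simp add: algebra_simps)
qed

lemma of_ell2_phase_op: "of_ell2 \<sigma> (phase_op \<theta> x) k = cis (\<theta> k) * of_ell2 \<sigma> x k"
  by (simp add: of_ell2_def weighted_def)

lemma continuous_on_gauge: "continuous_on I x \<Longrightarrow> continuous_on I (\<lambda>t. gauge (x t))"
  by (rule bounded_linear.continuous_on[OF bounded_linear_gauge])

lemma continuous_on_cubic:
  assumes x: "continuous_on I x"
  shows "continuous_on I (\<lambda>t. ell2_cubic \<sigma> (x t))"
proof -
  have "continuous_on I (\<lambda>t. ell2_conj (x t))"
  proof (rule continuous_on_compose2[OF _ x, of UNIV])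
    show "continuous_on UNIV ell2_conj"
      by (rule continuous_onI) (metis dist_norm ell2_conj_diff norm_ell2_conj less_imp_le)
  qed auto
  then show ?thesis unfolding ell2_cubic_def
    by (intro bounded_bilinear.continuous_on[OF bounded_bilinear_sobolev_mult[OF sigma]] x)
qed

text \<open>Integrating in time before conjugating keeps the rough operator on
  \<open>H^\<sigma>\<close>: the residual is \<rho>(t) = u(t) - u0 + i (- \<partial>^2 - \<xi>) X(t)
  + i lam Z(t), with X and Z the time integrals of u and of the cubic term. Duhamel's formula says
  that \<rho> vanishes, the conjugated equation that (1 + Y) \<rho> vanishes, by
  \<open>gauge_intertwines\<close> at the single element \<open>X t\<close>. Injectivity of
  \<open>raw_gauge\<close> identifies the two.\<close>

lemma conjugated_duhamel_iff:
  assumes x: "continuous_on {0..T} x"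
  shows "(\<forall>t\<in>{0..T}. \<forall>k. of_ell2 \<sigma> (x t) k = schroedinger t (of_ell2 \<sigma> x0) k
      + \<i> * integral {0..t} (\<lambda>r. schroedinger (t - r) (nls_forcing \<xi> lam (of_ell2 \<sigma> (x r))) k)) \<longleftrightarrow>
    (\<forall>t\<in>{0..T}. phase_op (\<lambda>k. t * freq k) (gauge (x t))
      = gauge x0 + integral {0..t} (\<lambda>r. vector_field r (phase_op (\<lambda>k. r * freq k) (gauge (x r)))))"
proof -
  let ?E = "\<lambda>t. phase_op (\<lambda>k. t * freq k) (gauge (x t))"
  let ?V = "\<lambda>t. integral {0..t} (\<lambda>r. vector_field r (?E r))"
  define X where "X t = integral {0..t} x" for t
  define Z where "Z t = integral {0..t} (\<lambda>r. ell2_cubic \<sigma> (x r))" for t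
  define \<rho>' where "\<rho>' t l = of_real (freq l) * of_ell2 \<sigma> (X t) l - potential_term l (X t)" for t l
  define \<rho> where "\<rho> t l = (of_ell2 \<sigma> (x t) l + (- 1) * of_ell2 \<sigma> x0 l)
    + (\<i> * \<rho>' t l + (\<i> * of_real lam) * of_ell2 \<sigma> (Z t) l)" for t l
  have cz: "continuous_on {0..T} (\<lambda>r. ell2_cubic \<sigma> (x r))" by (rule continuous_on_cubic[OF x])
  note int = integral_bounded_linear
  note bl = bounded_linear_of_ell2 bounded_linear_potential_term
  have ws': "weighted_summable (\<rho>' t)" for t
    unfolding \<rho>'_def[abs_def]
    using weighted_summable_add[OF weighted_summable_freq weighted_summable_cmult[OF weighted_summable_potential, of "-1"]]
    by simp
  have lhs: "(\<forall>t\<in>{0..T}. of_ell2 \<sigma> (x t) k = schroedinger t (of_ell2 \<sigma> x0) k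
      + \<i> * integral {0..t} (\<lambda>r. schroedinger (t - r) (nls_forcing \<xi> lam (of_ell2 \<sigma> (x r))) k))
    \<longleftrightarrow> (\<forall>t\<in>{0..T}. \<rho> t k = 0)" for k
  proof -
    define g where "g r = potential_term k (x r) - of_real lam * of_ell2 \<sigma> (ell2_cubic \<sigma> (x r)) k" for r
    have forcing: "nls_forcing \<xi> lam (of_ell2 \<sigma> (x r)) k = g r" for r
      by (simp add: nls_forcing_def g_def potential_term_def of_ell2_cubic[OF sigma])
    have cg: "continuous_on {0..T} g" unfolding g_def
      by (intro continuous_intros bounded_linear.continuous_on[OF bl(1)] bounded_linear.continuous_on[OF bl(2)] x cz)
    have "(\<forall>t\<in>{0..T}. of_ell2 \<sigma> (x t) k = cis (- t * freq k) * of_ell2 \<sigma> x0 k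
        + \<i> * integral {0..t} (\<lambda>r. cis (- (t - r) * freq k) * g r)) \<longleftrightarrow>
      (\<forall>t\<in>{0..T}. of_ell2 \<sigma> (x t) k = of_ell2 \<sigma> x0 k
        + integral {0..t} (\<lambda>r. \<i> * g r - \<i> * of_real (freq k) * of_ell2 \<sigma> (x r) k))"
      by (rule duhamel_iff[OF bounded_linear.continuous_on[OF bl(1) x] cg])
    also have "\<dots> \<longleftrightarrow> (\<forall>t\<in>{0..T}. \<rho> t k = 0)"
    proof (rule ball_cong[OF refl])
      fix t assume t: "t \<in> {0..T}"
      note i1 = int[OF bounded_linear_of_ell2[of \<sigma> k] x t] and i2 = int[OF bl(2) x t, of k]
        and i3 = int[OF bounded_linear_of_ell2[of \<sigma> k] cz t]
      have "((\<lambda>r. \<i> * g r - \<i> * of_real (freq k) * of_ell2 \<sigma> (x r) k) has_integral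
        (\<i> * (potential_term k (X t) - of_real lam * of_ell2 \<sigma> (Z t) k) - \<i> * of_real (freq k) * of_ell2 \<sigma> (X t) k)) {0..t}"
        unfolding g_def X_def Z_def i1(1) i2(1) i3(1)
        by (intro has_integral_diff has_integral_mult_right integrable_integral i1(2) i2(2) i3(2))
      then have I: "integral {0..t} (\<lambda>r. \<i> * g r - \<i> * of_real (freq k) * of_ell2 \<sigma> (x r) k)
        = \<i> * (potential_term k (X t) - of_real lam * of_ell2 \<sigma> (Z t) k) - \<i> * of_real (freq k) * of_ell2 \<sigma> (X t) k"
        by (rule integral_unique)
      show "(of_ell2 \<sigma> (x t) k = of_ell2 \<sigma> x0 k
        + integral {0..t} (\<lambda>r. \<i> * g r - \<i> * of_real (freq k) * of_ell2 \<sigma> (x r) k)) \<longleftrightarrow> \<rho> t k = 0"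
        unfolding \<rho>_def \<rho>'_def I by (auto simp: algebra_simps)
    qed
    finally show ?thesis by (simp add: schroedinger_def forcing freq_def)
  qed
  have rhs: "(\<forall>t\<in>{0..T}. of_ell2 \<sigma> (?E t) k
      = of_ell2 \<sigma> (gauge x0 + ?V t) k)
    \<longleftrightarrow> (\<forall>t\<in>{0..T}. raw_gauge (\<rho> t) k = 0)" for k
  proof -
    define h where "h t = of_ell2 \<sigma> (gauge (x t)) k" for t
    define \<phi> where "\<phi> t = of_ell2 \<sigma> (reduced (x t)) k" for t
    let ?I = "\<lambda>t. integral {0..t} (\<lambda>r. cis (- (t - r) * freq k) * - \<phi> r)"
    have ch: "continuous_on {0..T} h" unfolding h_def
      by (intro bounded_linear.continuous_on[OF bl(1)] continuous_on_gauge x)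
    have c\<phi>: "continuous_on {0..T} (\<lambda>t. - \<phi> t)" unfolding \<phi>_def
      by (intro continuous_on_minus bounded_linear.continuous_on[OF bl(1)] continuous_on_reduced x)
    have vf: "vector_field r (phase_op (\<lambda>k. r * freq k) (gauge (x r)))
        = phase_op (\<lambda>k. r * freq k + (- pi / 2)) (reduced (x r))" for r
      by (simp add: vector_field_def phase_op_phase_op)
    have cvf: "continuous_on {0..T} (\<lambda>r. phase_op (\<lambda>k. r * freq k + (- pi / 2)) (reduced (x r)))"
      by (intro continuous_on_phase_op continuous_on_reduced x)
    have "(\<forall>t\<in>{0..T}. of_ell2 \<sigma> (?E t) k
      = of_ell2 \<sigma> (gauge x0 + ?V t) k)
      \<longleftrightarrow> (\<forall>t\<in>{0..T}. h t = cis (- t * freq k) * of_ell2 \<sigma> (gauge x0) k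
        + \<i> * ?I t)"
    proof (rule ball_cong[OF refl])
      fix t assume t: "t \<in> {0..T}"
      have 1: "of_ell2 \<sigma> (gauge x0 + ?V t) k
        = of_ell2 \<sigma> (gauge x0) k + integral {0..t} (\<lambda>r. cis (r * freq k + (- pi / 2)) * \<phi> r)"
        unfolding vf of_ell2_add int(1)[OF bl(1) cvf t] of_ell2_phase_op \<phi>_def ..
      have "cis (- t * freq k) * (cis (r * freq k + (- pi / 2)) * \<phi> r) = \<i> * (cis (- (t - r) * freq k) * - \<phi> r)" for r
      proof -
        have "cis (- t * freq k) * cis (r * freq k + (- pi / 2)) = cis (- t * freq k + (r * freq k + (- pi / 2)))"
          by (rule cis_mult)
        also have "- t * freq k + (r * freq k + (- pi / 2)) = - (t - r) * freq k + (- pi / 2)" by algebra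
        also have "cis (- (t - r) * freq k + (- pi / 2)) = cis (- (t - r) * freq k) * cis (- pi / 2)"
          by (rule cis_mult[symmetric])
        also have "cis (- pi / 2) = - \<i>" by (simp add: complex_eq_iff)
        finally show ?thesis by (simp add: mult.assoc[symmetric])
      qed
      then have 2: "cis (- t * freq k) * integral {0..t} (\<lambda>r. cis (r * freq k + (- pi / 2)) * \<phi> r)
         = \<i> * ?I t"
        by (simp only: integral_mult_right[symmetric])
      have canc: "cis (- t * freq k) * cis (t * freq k) = 1" by (simp add: cis_mult)
      have "of_ell2 \<sigma> (?E t) k = cis (t * freq k) * h t"
        by (simp add: of_ell2_phase_op h_def)
      moreover have "cis (t * freq k) * h t = b \<longleftrightarrow> h t = cis (- t * freq k) * b" for b
        using canc by (metis mult.assoc mult.commute mult_1)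
      ultimately show "of_ell2 \<sigma> (?E t) k
        = of_ell2 \<sigma> (gauge x0 + ?V t) k
        \<longleftrightarrow> h t = cis (- t * freq k) * of_ell2 \<sigma> (gauge x0) k
        + \<i> * ?I t"
        unfolding 1 by (simp only: distrib_left 2)
    qed
    also have "\<dots> \<longleftrightarrow> (\<forall>t\<in>{0..T}. h t = of_ell2 \<sigma> (gauge x0) k
        + integral {0..t} (\<lambda>r. \<i> * - \<phi> r - \<i> * of_real (freq k) * h r))"
      by (rule duhamel_iff[OF ch c\<phi>])
    also have "\<dots> \<longleftrightarrow> (\<forall>t\<in>{0..T}. raw_gauge (\<rho> t) k = 0)"
    proof (rule ball_cong[OF refl])
      fix t assume t: "t \<in> {0..T}"
      have \<phi>_eq: "\<phi> r = of_ell2 \<sigma> (res_op (x r)) k + of_real lam * of_ell2 \<sigma> (gauge (ell2_cubic \<sigma> (x r))) k" for r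
        by (simp add: \<phi>_def reduced_def of_ell2_add of_ell2_scaleR scaleR_conv_of_real)
      have I: "integral {0..t} (\<lambda>r. \<i> * - \<phi> r - \<i> * of_real (freq k) * h r)
        = - \<i> * (of_ell2 \<sigma> (res_op (X t)) k + of_real lam * of_ell2 \<sigma> (gauge (Z t)) k)
          - \<i> * of_real (freq k) * of_ell2 \<sigma> (gauge (X t)) k"
      proof -
        note blk = bounded_linear_compose[OF bounded_linear_of_ell2[of \<sigma> k] bounded_linear_gauge]
          bounded_linear_compose[OF bounded_linear_of_ell2[of \<sigma> k] bounded_linear_res_op]
        note i1 = int[OF blk(2) x t] and i2 = int[OF blk(1) cz t] and i3 = int[OF blk(1) x t]
        have "((\<lambda>r. \<i> * - (of_ell2 \<sigma> (res_op (x r)) k + of_real lam * of_ell2 \<sigma> (gauge (ell2_cubic \<sigma> (x r))) k)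
            - \<i> * of_real (freq k) * of_ell2 \<sigma> (gauge (x r)) k) has_integral
          (\<i> * - (of_ell2 \<sigma> (res_op (X t)) k + of_real lam * of_ell2 \<sigma> (gauge (Z t)) k)
            - \<i> * of_real (freq k) * of_ell2 \<sigma> (gauge (X t)) k)) {0..t}"
          unfolding X_def Z_def i1(1) i2(1) i3(1)
          by (intro has_integral_diff has_integral_mult_right has_integral_neg has_integral_add
              integrable_integral i1(2) i2(2) i3(2))
        from integral_unique[OF this] show ?thesis
          unfolding \<phi>_eq h_def by (simp only: mult_minus_left mult_minus_right)
      qed
      note w = weighted_summable_of_ell2 weighted_summable_cmult[OF weighted_summable_of_ell2] weighted_summable_cmult[OF ws']
      have "raw_gauge (\<rho> t) k = (h t + (- 1) * of_ell2 \<sigma> (gauge x0) k)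
        + (\<i> * raw_gauge (\<rho>' t) k + (\<i> * of_real lam) * of_ell2 \<sigma> (gauge (Z t)) k)"
        unfolding \<rho>_def[abs_def] h_def of_ell2_gauge
        by (simp only: raw_gauge_add[OF weighted_summable_add[OF w(1,2)] weighted_summable_add[OF w(3,2)]]
            raw_gauge_add[OF w(1,2)] raw_gauge_add[OF w(3,2)] raw_gauge_cmult)
      also have "raw_gauge (\<rho>' t) k = of_real (freq k) * of_ell2 \<sigma> (gauge (X t)) k + of_ell2 \<sigma> (res_op (X t)) k"
        unfolding \<rho>'_def[abs_def] by (rule gauge_intertwines)
      finally show "(h t = of_ell2 \<sigma> (gauge x0) k
        + integral {0..t} (\<lambda>r. \<i> * - \<phi> r - \<i> * of_real (freq k) * h r)) \<longleftrightarrow> raw_gauge (\<rho> t) k = 0"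
        unfolding I by (auto simp: algebra_simps)
    qed
    finally show ?thesis .
  qed
  have ws: "weighted_summable (\<rho> t)" for t
    unfolding \<rho>_def[abs_def]
    by (intro weighted_summable_add weighted_summable_cmult weighted_summable_of_ell2 ws')
  have inj: "(\<forall>k. raw_gauge (\<rho> t) k = 0) \<longleftrightarrow> (\<forall>k. \<rho> t k = 0)" for t
  proof (intro iffI allI)
    show "\<rho> t k = 0" if "\<forall>k. raw_gauge (\<rho> t) k = 0" for k
      by (rule raw_gauge_inj[OF ws]) (use that in blast)
    show "raw_gauge (\<rho> t) k = 0" if "\<forall>k. \<rho> t k = 0" for k
      using that by (simp add: raw_gauge_def)
  qed
  have ext: "v = w \<longleftrightarrow> (\<forall>k. of_ell2 \<sigma> v k = of_ell2 \<sigma> w k)" for v w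
    by (metis ext of_ell2_inject)
  \<comment> \<open>The integrating factor works for fixed k over all t, injectivity for fixed t
    over all k; hence the exchange of quantifiers in both directions.\<close>
  have comm: "(\<forall>t\<in>S. \<forall>k. Q t k) \<longleftrightarrow> (\<forall>k. \<forall>t\<in>S. Q t k)" for S and Q :: "real \<Rightarrow> int \<Rightarrow> bool"
    by blast
  show ?thesis unfolding ext comm lhs rhs unfolding comm[symmetric] inj ..
qed

section \<open>Change of variables and transfer of well-posedness\<close>

definition encode :: "real \<Rightarrow> torus_dist \<Rightarrow> int ell2" where
  "encode t f = phase_op (\<lambda>k. t * freq k) (gauge (to_ell2 \<sigma> f))"

definition decode :: "real \<Rightarrow> int ell2 \<Rightarrow> torus_dist" where
  "decode t z = of_ell2 \<sigma> (ungauge (phase_op (\<lambda>k. t * - freq k) z))"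

lemma decode_encode: "f \<in> sobolev \<sigma> \<Longrightarrow> decode t (encode t f) = f"
  by (simp add: encode_def decode_def phase_op_phase_op)

lemma encode_decode: "encode t (decode t z) = z"
  by (simp add: encode_def decode_def phase_op_phase_op)

lemma decode_in_sobolev: "decode t z \<in> sobolev \<sigma>"
  by (simp add: decode_def)

lemma encode_0: "encode 0 f = gauge (to_ell2 \<sigma> f)"
  by (simp add: encode_def)

text \<open>The change of variables depends on time, but its phases are strongly continuous
  isometries in both directions and \<open>gauge\<close> is bi-Lipschitz, so continuity is
  preserved.\<close>

lemma continuous_into_sobolev_iff:
  "continuous_into_sobolev \<sigma> I u \<longleftrightarrow> (\<forall>t\<in>I. u t \<in> sobolev \<sigma>) \<and> continuous_on I (\<lambda>t. encode t (u t))"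
proof -
  have "continuous_into_sobolev \<sigma> I u \<longleftrightarrow> (\<forall>t\<in>I. u t \<in> sobolev \<sigma>) \<and> continuous_on I (\<lambda>t. to_ell2 \<sigma> (u t))"
  proof -
    have "((\<lambda>r. sobolev_dist \<sigma> (u r) (u t)) \<longlongrightarrow> 0) (at t within I) \<longleftrightarrow>
        ((\<lambda>r. to_ell2 \<sigma> (u r)) \<longlongrightarrow> to_ell2 \<sigma> (u t)) (at t within I)"
      if u: "\<forall>t\<in>I. u t \<in> sobolev \<sigma>" and t: "t \<in> I" for t
    proof -
      have "((\<lambda>r. sobolev_dist \<sigma> (u r) (u t)) \<longlongrightarrow> 0) (at t within I) \<longleftrightarrow>
        ((\<lambda>r. sqrt (2 * pi) * norm (to_ell2 \<sigma> (u r) - to_ell2 \<sigma> (u t))) \<longlongrightarrow> 0) (at t within I)"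
        by (rule Lim_cong_within) (use u t in \<open>auto simp: sobolev_dist_to_ell2\<close>)
      also have "\<dots> \<longleftrightarrow> ((\<lambda>r. norm (to_ell2 \<sigma> (u r) - to_ell2 \<sigma> (u t))) \<longlongrightarrow> 0) (at t within I)"
        using tendsto_mult_left_iff[of "sqrt (2 * pi)" "\<lambda>r. norm (to_ell2 \<sigma> (u r) - to_ell2 \<sigma> (u t))" 0] by simp
      finally show ?thesis by (simp only: tendsto_norm_zero_iff LIM_zero_iff)
    qed
    then show ?thesis unfolding continuous_into_sobolev_def continuous_on_def by blast
  qed
  also have "continuous_on I (\<lambda>t. to_ell2 \<sigma> (u t)) \<longleftrightarrow> continuous_on I (\<lambda>t. encode t (u t))"
  proof
    assume "continuous_on I (\<lambda>t. to_ell2 \<sigma> (u t))"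
    from continuous_on_phase_op[OF continuous_on_gauge[OF this], of freq "\<lambda>_. 0"]
    show "continuous_on I (\<lambda>t. encode t (u t))" by (simp add: encode_def)
  next
    assume "continuous_on I (\<lambda>t. encode t (u t))"
    from continuous_on_ungauge[OF continuous_on_phase_op[OF this, of "\<lambda>k. - freq k" "\<lambda>_. 0"]]
    show "continuous_on I (\<lambda>t. to_ell2 \<sigma> (u t))" by (simp add: encode_def phase_op_phase_op)
  qed
  finally show ?thesis .
qed

text \<open>Regularity of the datum on the right comes from Duhamel's formula at t = 0, which reads
  u(0) = u0.\<close>

lemma strong_solution_iff:
  "strong_solution \<xi> lam \<sigma> I u0 u \<longleftrightarrow> time_interval I \<and> u0 \<in> sobolev \<sigma> \<and> (\<forall>t\<in>I. u t \<in> sobolev \<sigma>) \<and>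
    ode_solution vector_field I (encode 0 u0) (\<lambda>t. encode t (u t))" (is "?L \<longleftrightarrow> ?R")
proof -
  have u0: "u0 \<in> sobolev \<sigma>" if ?L
  proof -
    have "0 \<in> I" using that by (auto simp: strong_solution_def time_interval_def)
    then have "u 0 \<in> sobolev \<sigma>" and "u 0 k = u0 k" for k
      using that by (auto simp: strong_solution_def continuous_into_sobolev_def schroedinger_def)
    then show ?thesis by (metis ext)
  qed
  have iff: "?L \<longleftrightarrow> ?R" if I: "time_interval I" and u: "\<forall>t\<in>I. u t \<in> sobolev \<sigma>" and u0: "u0 \<in> sobolev \<sigma>"
    and c: "continuous_on I (\<lambda>t. encode t (u t))"
  proof -
    define x where "x t = to_ell2 \<sigma> (u t)" for t
    have cx: "continuous_on I x"
      using continuous_on_ungauge[OF continuous_on_phase_op[OF c, of "\<lambda>k. - freq k" "\<lambda>_. 0"]]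
      by (simp add: encode_def phase_op_phase_op x_def[abs_def])
    have ux: "u t = of_ell2 \<sigma> (x t)" if "t \<in> I" for t using u that by (simp add: x_def)
    have u0x: "u0 = of_ell2 \<sigma> (to_ell2 \<sigma> u0)" using u0 by simp
    have sub: "{0..t} \<subseteq> I" "0 \<le> t" if "t \<in> I" for t
      using time_interval_subset[OF I that] I that by (auto simp: time_interval_def)
    have int: "(\<lambda>r. schroedinger (t - r) (nls_forcing \<xi> lam (u r)) k) integrable_on {0..t}" if t: "t \<in> I" for t k
    proof -
      have cxt: "continuous_on {0..t} x" by (rule continuous_on_subset[OF cx sub(1)[OF t]])
      have "continuous_on {0..t} (\<lambda>r. cis (- (t - r) * freq k) *
          (potential_term k (x r) - of_real lam * of_ell2 \<sigma> (ell2_cubic \<sigma> (x r)) k))"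
        by (intro continuous_intros bounded_linear.continuous_on[OF bounded_linear_potential_term]
            bounded_linear.continuous_on[OF bounded_linear_of_ell2] continuous_on_cubic cxt)
      then have "(\<lambda>r. cis (- (t - r) * freq k) *
          (potential_term k (x r) - of_real lam * of_ell2 \<sigma> (ell2_cubic \<sigma> (x r)) k)) integrable_on {0..t}"
        by (rule integrable_continuous_real)
      then show ?thesis
        by (rule integrable_eq) (use ux sub[OF t] in
          \<open>auto simp: schroedinger_def nls_forcing_def potential_term_def of_ell2_cubic[OF sigma] freq_def\<close>)
    qed
    define A where "A t \<longleftrightarrow> (\<forall>k. of_ell2 \<sigma> (x t) k = schroedinger t (of_ell2 \<sigma> (to_ell2 \<sigma> u0)) k
      + \<i> * integral {0..t} (\<lambda>r. schroedinger (t - r) (nls_forcing \<xi> lam (of_ell2 \<sigma> (x r))) k))" for t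
    define B where "B t \<longleftrightarrow> phase_op (\<lambda>k. t * freq k) (gauge (x t)) = gauge (to_ell2 \<sigma> u0)
      + integral {0..t} (\<lambda>r. vector_field r (phase_op (\<lambda>k. r * freq k) (gauge (x r))))" for t
    have AB: "(\<forall>s\<in>{0..t}. A s) \<longleftrightarrow> (\<forall>s\<in>{0..t}. B s)" if t: "t \<in> I" for t
      unfolding A_def B_def
      by (rule conjugated_duhamel_iff[OF continuous_on_subset[OF cx sub(1)[OF t]]])
    \<comment> \<open>The equivalence \<open>AB\<close> concerns whole intervals [0,t], not single
      times, so both conditions are rewritten over all initial segments of I.\<close>
    have ball: "(\<forall>t\<in>I. Q t) \<longleftrightarrow> (\<forall>t\<in>I. \<forall>s\<in>{0..t}. Q s)" for Q
    proof (intro iffI ballI)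
      fix t s assume "\<forall>t\<in>I. Q t" "t \<in> I" "s \<in> {0..t}"
      then show "Q s" using sub(1)[of t] by blast
    next
      fix t assume "\<forall>t\<in>I. \<forall>s\<in>{0..t}. Q s" "t \<in> I"
      then show "Q t" using sub(2)[of t] by auto
    qed
    have "(\<forall>t\<in>I. A t) \<longleftrightarrow> (\<forall>t\<in>I. B t)"
      unfolding ball[of A] ball[of B] by (rule ball_cong[OF refl AB])
    moreover have "?L \<longleftrightarrow> (\<forall>t\<in>I. A t)"
    proof -
      have "(\<forall>k. u t k = schroedinger t u0 k
          + \<i> * integral {0..t} (\<lambda>r. schroedinger (t - r) (nls_forcing \<xi> lam (u r)) k)) \<longleftrightarrow> A t" if t: "t \<in> I" for t
      proof -
        have "integral {0..t} (\<lambda>r. schroedinger (t - r) (nls_forcing \<xi> lam (u r)) k)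
          = integral {0..t} (\<lambda>r. schroedinger (t - r) (nls_forcing \<xi> lam (of_ell2 \<sigma> (x r))) k)" for k
          by (rule integral_cong) (use ux sub[OF t] in auto)
        then show ?thesis using u0x ux[OF t] by (simp add: A_def)
      qed
      then show ?thesis
        using I u c int by (simp add: strong_solution_def continuous_into_sobolev_iff)
    qed
    moreover have "?R \<longleftrightarrow> (\<forall>t\<in>I. B t)"
      using I u u0 c by (simp add: ode_solution_def B_def encode_def x_def)
    ultimately show ?thesis by blast
  qed
  show ?thesis
  proof
    assume L: ?L
    then show ?R using iff u0[OF L]
      by (auto simp: strong_solution_def continuous_into_sobolev_iff)
  next
    assume R: ?R
    then show ?L using iff by (auto simp: ode_solution_def)
  qed
qed

theorem well_posed: "locally_well_posed \<xi> lam \<sigma>"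
proof -
  define T where "T u0 = lifespan (encode 0 u0)" for u0
  define S where "S u0 t = decode t (flow (encode 0 u0) t)" for u0 t
  have unique: "unconditional_uniqueness \<xi> lam \<sigma>"
    unfolding unconditional_uniqueness_def
  proof (intro allI impI ballI, elim conjE)
    fix I u0 u v t
    assume u: "strong_solution \<xi> lam \<sigma> I u0 u" and v: "strong_solution \<xi> lam \<sigma> I u0 v" and t: "t \<in> I"
    have "encode t (u t) = encode t (v t)"
      using solution_unique[of I "encode 0 u0" "\<lambda>t. encode t (u t)" "\<lambda>t. encode t (v t)" t] u v t
      unfolding strong_solution_iff by blast
    then show "u t = v t"
      using u v t unfolding strong_solution_iff by (metis decode_encode)
  qed
  have dom: "{t. 0 \<le> t \<and> ereal t < T u0} = existence_times (encode 0 u0)" for u0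
    by (simp add: T_def existence_times_eq)
  have enc: "encode t (S u0 t) = flow (encode 0 u0) t" for u0 t
    by (simp add: S_def encode_decode)
  have "solution_map \<xi> lam \<sigma> T S"
    unfolding solution_map_def maximal_strong_solution_def dom
  proof (intro ballI conjI allI impI)
    fix u0 assume u0: "u0 \<in> sobolev \<sigma>"
    show "0 < T u0" by (simp add: T_def lifespan_pos)
    show "strong_solution \<xi> lam \<sigma> (existence_times (encode 0 u0)) u0 (S u0)"
      unfolding strong_solution_iff enc
      using u0 time_interval_existence_times ode_solution_flow by (auto simp: S_def decode_in_sobolev)
    fix J v
    assume "strong_solution \<xi> lam \<sigma> J u0 v \<and> existence_times (encode 0 u0) \<subseteq> J
      \<and> (\<forall>t\<in>existence_times (encode 0 u0). v t = S u0 t)"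
    then show "J = existence_times (encode 0 u0)"
      unfolding strong_solution_iff using flow_maximal by blast
  qed
  moreover have "continuous_solution_map \<sigma> T S"
    unfolding continuous_solution_map_def
  proof (intro ballI allI impI)
    fix u0 t and e :: real
    assume u0: "u0 \<in> sobolev \<sigma>" and t: "0 \<le> t" "ereal t < T u0" and e: "0 < e"
    have tE: "t \<in> existence_times (encode 0 u0)" using t dom[of u0] by blast
    define c where "c = sqrt (2 * pi)"
    have c: "c > 0" by (simp add: c_def)
    obtain d where d: "d > 0" "\<And>w0. norm (w0 - encode 0 u0) < d \<Longrightarrow>
        t \<in> existence_times w0 \<and> norm (flow w0 t - flow (encode 0 u0) t) < e / (2 * c)"
      using flow_continuous[OF tE, of "e / (2 * c)"] e c by auto
    show "\<exists>d>0. \<forall>v0\<in>sobolev \<sigma>. sobolev_dist \<sigma> v0 u0 < d \<longrightarrow>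
           ereal t < T v0 \<and> sobolev_dist \<sigma> (S v0 t) (S u0 t) < e"
    \<comment> \<open>The halves reflect the bi-Lipschitz bounds of \<open>gauge\<close>:
      \<open>gauge_upper\<close> from the datum to the new variable (c d / 2),
      \<open>gauge_lower\<close> on the way back (e / (2 c)). The phases are isometries.\<close>
    proof (intro exI[of _ "c * d / 2"] conjI ballI impI)
      fix v0 assume v0: "v0 \<in> sobolev \<sigma>" and dist: "sobolev_dist \<sigma> v0 u0 < c * d / 2"
      have "c * (2 * norm (to_ell2 \<sigma> v0 - to_ell2 \<sigma> u0)) < c * d"
        using dist by (simp add: sobolev_dist_to_ell2 v0 u0 c_def)
      then have "2 * norm (to_ell2 \<sigma> v0 - to_ell2 \<sigma> u0) < d" using c by (simp only: mult_less_cancel_left_pos)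
      then have "norm (encode 0 v0 - encode 0 u0) < d"
        unfolding encode_0 using gauge_upper[of "to_ell2 \<sigma> v0" "to_ell2 \<sigma> u0"] by linarith
      note near = d(2)[OF this]
      then show "ereal t < T v0" using dom[of v0] by blast
      have "sobolev_dist \<sigma> (S v0 t) (S u0 t) = c * norm (to_ell2 \<sigma> (S v0 t) - to_ell2 \<sigma> (S u0 t))"
        by (simp add: sobolev_dist_to_ell2 c_def S_def decode_in_sobolev)
      also have "\<dots> \<le> c * (2 * norm (gauge (to_ell2 \<sigma> (S v0 t)) - gauge (to_ell2 \<sigma> (S u0 t))))"
        using c by (intro mult_left_mono gauge_lower) auto
      also have "norm (gauge (to_ell2 \<sigma> (S v0 t)) - gauge (to_ell2 \<sigma> (S u0 t))) = norm (encode t (S v0 t) - encode t (S u0 t))"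
        by (simp only: encode_def phase_op_diff[symmetric] norm_phase_op)
      also have "\<dots> = norm (flow (encode 0 v0) t - flow (encode 0 u0) t)" by (simp only: enc)
      also have "c * (2 * \<dots>) < c * (2 * (e / (2 * c)))"
        using near c by (intro mult_strict_left_mono) auto
      also have "\<dots> = e" using c by simp
      finally show "sobolev_dist \<sigma> (S v0 t) (S u0 t) < e" .
    qed (use c d in auto)
  qed
  ultimately show ?thesis using unique by (auto simp: locally_well_posed_def)
qed

end

section \<open>Potentials in Fourier-Lebesgue spaces\<close>

lemma lp_seq_bounded:
  assumes p: "2 < p" and a: "lp_seq p a"
  obtains B where "\<And>k. norm (a k) \<le> B"
proof (cases "p = \<infinity>")
  case True
  then have "bounded (range a)" using a by (simp add: lp_seq_def)
  then show ?thesis using that by (auto simp: bounded_iff)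
next
  case False
  then obtain q where q: "p = ereal q" "2 < q" using p by (cases p) auto
  have summ: "(\<lambda>k. norm (a k) powr q) summable_on UNIV" using a q by (simp add: lp_seq_def)
  define S where "S = (\<Sum>\<^sub>\<infinity>k. norm (a k) powr q)"
  have "norm (a k) \<le> S powr (1 / q)" for k
  proof -
    have "norm (a k) powr q \<le> S"
      unfolding S_def using finite_sum_le_infsum[OF summ, of "{k}"] by simp
    then have "(norm (a k) powr q) powr (1 / q) \<le> S powr (1 / q)" using q by (intro powr_mono2) auto
    then show ?thesis using q by (simp add: powr_powr)
  qed
  then show ?thesis using that by blast
qed

lemma jap_powr_le_abs:
  assumes "k \<noteq> 0" "0 \<le> s"
  shows "jap k powr s \<le> 2 powr s * \<bar>real_of_int k\<bar> powr s"
proof -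
  have "jap k powr s \<le> (2 * \<bar>real_of_int k\<bar>) powr s"
    using jap_le_double[OF assms(1)] assms(2) by (intro powr_mono2) auto
  then show ?thesis by (simp add: powr_mult)
qed

lemma bhat_bound:
  assumes s: "0 \<le> s" and p: "2 < p" and xi: "\<xi> \<in> bhat s p"
  obtains C where "0 < C" "\<And>k. norm (\<xi> k) \<le> C * jap k powr (- s)"
proof -
  obtain B where B: "\<And>k. \<bar>real_of_int k\<bar> powr s * norm (\<xi> k) \<le> B"
  proof -
    have "lp_seq p (\<lambda>k. of_real (\<bar>real_of_int k\<bar> powr s) * \<xi> k)" using xi by (simp add: bhat_def)
    from lp_seq_bounded[OF p this] obtain B
      where "\<And>k. norm (of_real (\<bar>real_of_int k\<bar> powr s) * \<xi> k) \<le> B" by blast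
    then show ?thesis by (intro that[of B]) (simp add: norm_mult)
  qed
  have B0: "0 \<le> B" using B[of 0] by (metis mult_nonneg_nonneg norm_ge_zero order_trans powr_ge_zero)
  \<comment> \<open>The seminorm does not see frequency 0, which is covered by
    \<open>norm (\<xi> 0)\<close>; the summand 1 makes C positive.\<close>
  define C where "C = 2 powr s * B + norm (\<xi> 0) + 1"
  have "norm (\<xi> k) \<le> C * jap k powr (- s)" for k
  proof (cases "k = 0")
    case True
    then show ?thesis using B0 by (simp add: C_def jap_def)
  next
    case False
    have "jap k powr s * norm (\<xi> k) \<le> (2 powr s * \<bar>real_of_int k\<bar> powr s) * norm (\<xi> k)"
      by (intro mult_right_mono jap_powr_le_abs False s) auto
    also have "\<dots> = 2 powr s * (\<bar>real_of_int k\<bar> powr s * norm (\<xi> k))" by simp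
    also have "\<dots> \<le> 2 powr s * B" by (intro mult_left_mono B) auto
    also have "\<dots> \<le> C" by (simp add: C_def)
    finally have "jap k powr (- s) * (jap k powr s * norm (\<xi> k)) \<le> jap k powr (- s) * C"
      by (rule mult_left_mono) simp
    then show ?thesis unfolding mult.assoc[symmetric] jap_powr_cancel by (simp add: mult.commute[of C])
  qed
  moreover have "0 < C" using B0 by (simp add: C_def add_nonneg_pos)
  ultimately show ?thesis using that by blast
qed

text \<open>Hoelder's inequality, in the form of Young's inequality for the exponents \<open>q / 2\<close> and \<open>q / (q - 2)\<close>.\<close>

lemma bhat_weighted_square_summable:
  assumes s: "0 \<le> s" and p: "2 < p" and xi: "\<xi> \<in> bhat s p" and \<epsilon>: "0 < \<epsilon>"
  shows "square_summable (weighted (s + gamma_exp p - \<epsilon> - 2) \<xi>)"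
proof (cases "p = \<infinity>")
  case True
  obtain C where C: "0 < C" "\<And>k. norm (\<xi> k) \<le> C * jap k powr (- s)" using bhat_bound[OF s p xi] by blast
  have g: "s + gamma_exp p - \<epsilon> - 2 = s - 1 / 2 - \<epsilon>" by (simp add: gamma_exp_def True)
  have "square_summable (\<lambda>k. of_real C * of_real (jap k powr (- 1 / 2 - \<epsilon>)))"
    using summable_jap[of "1 + 2 * \<epsilon>"] \<epsilon>
    by (intro square_summable_cmult) (simp add: square_summable_def jap_powr_power2)
  moreover have "norm (weighted (s - 1 / 2 - \<epsilon>) \<xi> k) \<le> norm (of_real C * of_real (jap k powr (- 1 / 2 - \<epsilon>)) :: complex)" for k
  proof -
    have "norm (weighted (s - 1 / 2 - \<epsilon>) \<xi> k) \<le> jap k powr (s - 1 / 2 - \<epsilon>) * (C * jap k powr (- s))"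
      unfolding norm_weighted by (intro mult_left_mono C) auto
    also have "\<dots> = C * (jap k powr (s - 1 / 2 - \<epsilon>) * jap k powr (- s))" by simp
    also have "jap k powr (s - 1 / 2 - \<epsilon>) * jap k powr (- s) = jap k powr (- 1 / 2 - \<epsilon>)"
      by (simp only: powr_add[symmetric]) simp
    finally show ?thesis using C by (simp add: norm_mult)
  qed
  ultimately show ?thesis unfolding g by (rule l2_norm_mono(2)[rotated])
next
  case False
  then obtain q where q: "p = ereal q" "2 < q" using p by (cases p) auto
  define a where "a k = \<bar>real_of_int k\<bar> powr s * norm (\<xi> k)" for k
  have a0: "0 \<le> a k" for k by (simp add: a_def)
  have summ: "(\<lambda>k. a k powr q) summable_on UNIV"
    using xi q by (simp add: bhat_def lp_seq_def norm_mult a_def)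
  have g: "s + gamma_exp p - \<epsilon> - 2 = s + (- 1 / 2 + 1 / q - \<epsilon>)"
    using q by (simp add: gamma_exp_def one_ereal_def)
  \<comment> \<open>The exponent conjugate to q/2.\<close>
  define r where "r = q / (q - 2)"
  have r: "1 < r" "1 / (q / 2) + 1 / r = 1" using q by (simp_all add: r_def field_simps)
  define \<tau> where "\<tau> = - 1 / 2 + 1 / q - \<epsilon>"
  \<comment> \<open>Without \<epsilon> the exponent would be the borderline 2 (1/q - 1/2) q/(q-2) =
    -1, which is how gamma_p arises; every positive \<epsilon> gives summability.\<close>
  have \<tau>r: "2 * \<tau> * r = - (1 + 2 * \<epsilon> * r)"
  proof -
    have 1: "(q - 2) * r = q" using q by (simp add: r_def)
    have 2: "2 * q * \<tau> = - (q - 2) - 2 * \<epsilon> * q"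
      unfolding \<tau>_def using q by (simp add: field_simps)
    have "q * (2 * \<tau> * r) = (2 * q * \<tau>) * r" by simp
    also have "\<dots> = - ((q - 2) * r) - 2 * \<epsilon> * q * r" unfolding 2 by algebra
    also have "\<dots> = q * (- (1 + 2 * \<epsilon> * r))" unfolding 1 by algebra
    finally have "q * (2 * \<tau> * r) = q * (- (1 + 2 * \<epsilon> * r))" .
    then show ?thesis using q by simp
  qed
  \<comment> \<open>Frequency 0 is treated apart, since \<open>a 0 = 0\<close> carries no
    information on \<open>\<xi> 0\<close>.\<close>
  define M where "M = (norm (weighted (s + \<tau>) \<xi> 0))\<^sup>2"
  have bound: "(norm (weighted (s + \<tau>) \<xi> k))\<^sup>2
    \<le> (2 powr s)\<^sup>2 * (a k powr q + jap k powr (- (1 + 2 * \<epsilon> * r))) + (if k = 0 then M else 0)" for k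
  proof (cases "k = 0")
    case True then show ?thesis by (simp add: M_def)
  next
    case False
    have "jap k powr s * norm (\<xi> k) \<le> 2 powr s * a k"
      unfolding a_def mult.assoc[symmetric] by (intro mult_right_mono jap_powr_le_abs False s) auto
    then have "norm (weighted (s + \<tau>) \<xi> k) \<le> 2 powr s * a k * jap k powr \<tau>"
      unfolding norm_weighted powr_add by (simp add: mult.commute mult.left_commute mult_left_mono)
    then have "(norm (weighted (s + \<tau>) \<xi> k))\<^sup>2 \<le> (2 powr s * a k * jap k powr \<tau>)\<^sup>2"
      by (intro power_mono) auto
    also have "\<dots> = (2 powr s)\<^sup>2 * ((a k)\<^sup>2 * jap k powr (2 * \<tau>))"
      by (simp add: power_mult_distrib jap_powr_power2)
    also have "(a k)\<^sup>2 * jap k powr (2 * \<tau>) \<le> a k powr q + jap k powr (- (1 + 2 * \<epsilon> * r))"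
    proof -
      have "(a k)\<^sup>2 * jap k powr (2 * \<tau>)
        \<le> ((a k)\<^sup>2) powr (q / 2) / (q / 2) + (jap k powr (2 * \<tau>)) powr r / r"
        by (rule Youngs_inequality) (use q r in auto)
      also have "((a k)\<^sup>2) powr (q / 2) = a k powr q"
      proof (cases "a k = 0")
        case False
        then have "(a k)\<^sup>2 = a k powr 2" using a0[of k] by simp
        then show ?thesis by (simp only: powr_powr) simp
      qed simp
      also have "(jap k powr (2 * \<tau>)) powr r = jap k powr (- (1 + 2 * \<epsilon> * r))"
        by (simp only: powr_powr \<tau>r)
      also have "a k powr q / (q / 2) \<le> a k powr q / 1" using q by (intro divide_left_mono) auto
      also have "jap k powr (- (1 + 2 * \<epsilon> * r)) / r \<le> jap k powr (- (1 + 2 * \<epsilon> * r)) / 1"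
        using r by (intro divide_left_mono) auto
      finally show ?thesis by simp
    qed
    finally show ?thesis using False by (simp add: mult_left_mono)
  qed
  have "0 < \<epsilon> * r" using \<epsilon> r by simp
  then have "(\<lambda>k. (2 powr s)\<^sup>2 * (a k powr q + jap k powr (- (1 + 2 * \<epsilon> * r))) + (if k = 0 then M else 0)) summable_on UNIV"
    by (intro summable_on_add summable_on_cmult_right summ summable_jap)
      (auto intro: finite_nonzero_values_imp_summable_on)
  then have "(\<lambda>k. (norm (weighted (s + \<tau>) \<xi> k))\<^sup>2) summable_on UNIV"
    by (rule summable_on_comparison_test) (use bound in auto)
  then show ?thesis unfolding square_summable_def g \<tau>_def .
qed

lemma gamma_exp_bounds:
  assumes p: "2 < p"
  shows "3 / 2 \<le> gamma_exp p" and "gamma_exp p < 2"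
proof -
  have "3 / 2 \<le> gamma_exp p \<and> gamma_exp p < 2"
  proof (cases "p = \<infinity>")
    case False
    then obtain q where q: "p = ereal q" "2 < q" using p by (cases p) auto
    then have "0 < 1 / q" and "1 / q < 1 / 2" by (simp_all add: field_simps)
    moreover have "gamma_exp p = 3 / 2 + 1 / q" using q by (simp add: gamma_exp_def one_ereal_def)
    ultimately show ?thesis by linarith
  qed (simp add: gamma_exp_def)
  then show "3 / 2 \<le> gamma_exp p" and "gamma_exp p < 2" by blast+
qed

theorem theorem1p1:
  fixes lam s :: real and p :: ereal and \<xi> :: torus_dist
  assumes "0 \<le> s" and "2 < p"
    and "\<xi> \<in> bhat s p" and "real_valued \<xi>"
  shows "\<forall>\<^sub>F \<epsilon> in at_right 0. locally_well_posed \<xi> lam (s + gamma_exp p - \<epsilon>)"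
proof -
  obtain C where C: "0 < C" "\<And>k. norm (\<xi> k) \<le> C * jap k powr (- s)"
    by (rule bhat_bound[OF assms(1-3)]) (rule that)
  interpret rough_potential \<xi> s C by (rule rough_potential.intro[OF assms(1) C])
  note gamma = gamma_exp_bounds[OF assms(2)]
  \<comment> \<open>Since gamma_p >= 3/2, \<epsilon> < 1 ensures \<sigma> > 1/2; since gamma_p < 2,
    also \<sigma> < s + 2.\<close>
  have "locally_well_posed \<xi> lam (s + gamma_exp p - \<epsilon>)" if \<epsilon>: "0 < \<epsilon>" "\<epsilon> < 1" for \<epsilon>
  proof -
    define \<sigma> where "\<sigma> = s + gamma_exp p - \<epsilon>"
    have \<sigma>: "1 / 2 < \<sigma>" "\<sigma> < s + 2" using gamma assms(1) \<epsilon> by (auto simp: \<sigma>_def)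
    have "square_summable (weighted (\<sigma> - 2) \<xi>)"
      unfolding \<sigma>_def by (rule bhat_weighted_square_summable[OF assms(1-3) \<epsilon>(1)])
    from conjugation_exists[OF \<sigma> this] obtain N where "conjugation \<xi> s C N" "16 * C * smallness N \<le> 1 / 2"
      "kernel_bound (1 / 2) (\<lambda>k l. norm (sobolev_kernel \<sigma> (conj_kernel N) k l))"
      by blast
    then interpret nls \<xi> s C N lam \<sigma>
      by (intro nls.intro nls_axioms.intro \<sigma>)
    show ?thesis using well_posed by (simp add: \<sigma>_def)
  qed
  then show ?thesis
    unfolding eventually_at_right_field by (intro exI[of _ 1]) auto
qed

end
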